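(* Let $c\in\mathbb{C}$, $c\neq0$, let $\{\tau_1,\tau_2,\tau_3\}=\{0,1,-1\}$, and let $\sigma_1,\sigma_2\in\mathbb{C}$ be constants, not necessarily distinct, with $\sigma_j\ne\tau_k$ for all $j,k$. Then all transcendental meromorphic solutions on $\mathbb{C}$ of the equation $$S(u,z)^3=c\,\frac{(u-\sigma_1)^3(u-\sigma_2)^3}{(u-\tau_1)^2(u-\tau_2)^2(u-\tau_3)^2}$$ are elliptic functions. Moreover, such solutions exist if and only if $$\{\sigma_1,\sigma_2\}=\left\{\frac{i}{\sqrt3},\,-\frac{i}{\sqrt3}\right\},$$ and in this case all the transcendental meromorphic solutions are given by $$u(z)=\frac{9\left[9\wp(z-z_0;g_2,g_3)+L^2\right]\wp'(z-z_0;g_2,g_3)}{2L\left[81\wp(z-z_0;g_2,g_3)^2-9L^2\wp(z-z_0;g_2,g_3)+L^4\right]},$$ where $L$ is any complex number with $L^6=-27c/64$, $g_2=0$, $g_3=c/432$, and $z_0\in\mathbb{C}$ is arbitrary.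
   Context: For a nonconstant meromorphic function $u$, the Schwarzian derivative is $S(u,z)=\left(\frac{u''}{u'}\right)'-\frac12\left(\frac{u''}{u'}\right)^2=\frac{u'''}{u'}-\frac32\left(\frac{u''}{u'}\right)^2$. "Transcendental" means not rational. $\wp(z;g_2,g_3)$ is the Weierstrass elliptic function with invariants $g_2,g_3$, satisfying $\wp'^2=4\wp^3-g_2\wp-g_3$. *)

theory Defs
  imports "HOL-Complex_Analysis.Complex_Analysis" "HOL-Computational_Algebra.Polynomial"
begin

(* A meromorphic function is represented by a total function complex => complex whose values
   on a sparse set (in particular at its poles) are irrelevant. Identities between meromorphic
   functions are therefore stated for all points outside a sparse set (filter cosparse UNIV). *)

definition transcendental_meromorphic :: "(complex \<Rightarrow> complex) \<Rightarrow> bool" where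
  "transcendental_meromorphic u \<longleftrightarrow>
     u meromorphic_on UNIV \<and>
     \<not> (\<exists>p q :: complex poly. q \<noteq> 0 \<and> (\<forall>\<^sub>\<approx>z\<in>UNIV. u z = poly p z / poly q z))"

definition schwarzian :: "(complex \<Rightarrow> complex) \<Rightarrow> complex \<Rightarrow> complex" where
  "schwarzian u z =
     deriv (\<lambda>w. deriv (deriv u) w / deriv u w) z - 1 / 2 * (deriv (deriv u) z / deriv u z) ^ 2"

definition elliptic :: "(complex \<Rightarrow> complex) \<Rightarrow> bool" where
  "elliptic u \<longleftrightarrow>
     u meromorphic_on UNIV \<and>
     (\<exists>\<omega>1 \<omega>2. \<omega>2 / \<omega>1 \<notin> \<real> \<and>
        (\<forall>\<^sub>\<approx>z\<in>UNIV. u (z + \<omega>1) = u z) \<and> (\<forall>\<^sub>\<approx>z\<in>UNIV. u (z + \<omega>2) = u z))"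

(* The condition on the quotient also excludes \<omega>1 = 0, since then \<omega>2 / \<omega>1 = 0. *)
definition complex_lattice :: "complex set \<Rightarrow> bool" where
  "complex_lattice \<Lambda> \<longleftrightarrow>
     (\<exists>\<omega>1 \<omega>2. \<omega>2 / \<omega>1 \<notin> \<real> \<and> \<Lambda> = {of_int m * \<omega>1 + of_int n * \<omega>2 | m n. True})"

definition lattice_g2 :: "complex set \<Rightarrow> complex" where
  "lattice_g2 \<Lambda> = 60 * (\<Sum>\<^sub>\<infinity>\<omega>\<in>\<Lambda> - {0}. 1 / \<omega> ^ 4)"

definition lattice_g3 :: "complex set \<Rightarrow> complex" where
  "lattice_g3 \<Lambda> = 140 * (\<Sum>\<^sub>\<infinity>\<omega>\<in>\<Lambda> - {0}. 1 / \<omega> ^ 6)"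

definition lattice_wp :: "complex set \<Rightarrow> complex \<Rightarrow> complex" where
  "lattice_wp \<Lambda> z = 1 / z ^ 2 + (\<Sum>\<^sub>\<infinity>\<omega>\<in>\<Lambda> - {0}. (1 / (z - \<omega>) ^ 2 - 1 / \<omega> ^ 2))"

(* If g2 ^ 3 \<noteq> 27 * g3 ^ 2, there is exactly one lattice with invariants g2 and g3;
   otherwise there is none and the value is unspecified. *)
definition weierstrass_wp :: "complex \<Rightarrow> complex \<Rightarrow> complex \<Rightarrow> complex" where
  "weierstrass_wp g2 g3 =
     lattice_wp (SOME \<Lambda>. complex_lattice \<Lambda> \<and> lattice_g2 \<Lambda> = g2 \<and> lattice_g3 \<Lambda> = g3)"

definition schwarzian_eq_solution ::
  "complex \<Rightarrow> complex \<Rightarrow> complex \<Rightarrow> complex \<Rightarrow> complex \<Rightarrow> complex \<Rightarrow> (complex \<Rightarrow> complex) \<Rightarrow> bool" where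
  "schwarzian_eq_solution c \<sigma>1 \<sigma>2 \<tau>1 \<tau>2 \<tau>3 u \<longleftrightarrow>
     (\<forall>\<^sub>\<approx>z\<in>UNIV. schwarzian u z ^ 3 =
        c * ((u z - \<sigma>1) ^ 3 * (u z - \<sigma>2) ^ 3) /
          ((u z - \<tau>1) ^ 2 * (u z - \<tau>2) ^ 2 * (u z - \<tau>3) ^ 2))"

definition explicit_solution :: "complex \<Rightarrow> complex \<Rightarrow> complex \<Rightarrow> complex \<Rightarrow> complex" where
  "explicit_solution c L z0 z =
     (let P = weierstrass_wp 0 (c / 432) in
        9 * (9 * P (z - z0) + L ^ 2) * deriv P (z - z0) /
          (2 * L * (81 * P (z - z0) ^ 2 - 9 * L ^ 2 * P (z - z0) + L ^ 4)))"

end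

theory Submission
  imports Defs
begin

text \<open>
  Write \<open>P(u) = u\<^sup>3 - u\<close>, so that the right-hand side of the equation is
  \<open>c (u - \<sigma>1)\<^sup>3 (u - \<sigma>2)\<^sup>3 / P(u)\<^sup>2\<close>.

  \<^bold>\<open>A first integral.\<close> If a meromorphic \<open>u\<close> takes a value (possibly \<open>\<infinity>\<close>) at \<open>x\<close> with
  multiplicity \<open>\<bar>m\<bar>\<close>, then \<open>(z - x)\<^sup>2 S(u,z)\<close> tends to \<open>(1 - m\<^sup>2) / 2\<close>.
  Comparing the orders of both sides of the equation shows that a solution takes the three roots of
  \<open>P\<close> with multiplicity exactly three and every other value simply
  (lemma \<open>schwarzian_equation_local\<close>). Therefore \<open>h = u'\<^sup>3 / P(u)\<^sup>2\<close> extends to an entire function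
  without zeros, \<open>h = E\<^sup>3\<close> with \<open>E\<close> entire. Where \<open>u\<close> vanishes, the leading coefficients of
  the equation moreover force \<open>h\<^sup>2\<close> to be one fixed constant.

  \<^bold>\<open>Uniformisation.\<close> The pair \<open>(u, w)\<close> with \<open>w = u' / E\<close> lies on the curve \<open>w\<^sup>3 = P(u)\<^sup>2\<close>, which has
  genus one. With \<open>e = L\<^sup>2 / 9\<close> it has Weierstrass coordinates \<open>X, Y\<close> satisfying
  \<open>Y\<^sup>2 = 4 X\<^sup>3 + 4 e\<^sup>3\<close>, \<open>u = 2 (X + e)\<^sup>2 / (L Y)\<close> and \<open>X' = (E / L) Y\<close>. Uniqueness for this
  differential system gives \<open>X = \<wp>(g)\<close>, \<open>Y = \<wp>'(g)\<close> with an entire \<open>g\<close> such that \<open>g' = E / L\<close>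
  (lemma \<open>uniformise_binomial_ode\<close>).

  \<^bold>\<open>Rigidity.\<close> The function \<open>u\<close> vanishes wherever \<open>\<wp>(g) = - e\<close>, so \<open>g'\<close> is bounded on the set of points
  that \<open>g\<close> maps into a certain translate of the period lattice. Such a translate meets every disc of
  some fixed radius. If \<open>g'\<close> were unbounded, then by Bloch's theorem \<open>g\<close> would cover discs of that
  radius with arbitrarily large derivative, and hit the translate there. So \<open>g'\<close> is bounded, and
  constant by Liouville's theorem (lemma \<open>deriv_const_of_bounded_on_net_preimage\<close>).

  \<^bold>\<open>Conclusion.\<close> Now \<open>u'\<^sup>3 = k P(u)\<^sup>2\<close> with a constant \<open>k\<close>, and a computation gives
  \<open>S(u,z)\<^sup>3 = - (64/27) k\<^sup>2 (u\<^sup>2 + 1/3)\<^sup>3 / P(u)\<^sup>2\<close>. As \<open>u\<close> is not constant, the two numerators agree as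
  polynomials, which determines \<open>\<sigma>1, \<sigma>2\<close> and \<open>k\<^sup>2 = - 27 c / 64\<close>. Uniformising once more with
  \<open>L\<close> equal to the constant \<open>E\<close> makes \<open>g\<close> a translation, and this is the explicit formula.
  Conversely, the formula satisfies \<open>u'\<^sup>3 = L\<^sup>3 P(u)\<^sup>2\<close>, and it is not rational because it has a pole
  at every point of a translated lattice.

  The first sections develop the theory of \<open>\<wp>\<close> that these arguments use: its differential
  equations, its surjectivity, and the existence of a lattice with \<open>g2 = 0\<close> and any given \<open>g3 \<noteq> 0\<close>.
\<close>

section \<open>Complex lattices\<close>

text \<open>
  A lattice element \<open>m \<omega>1 + n \<omega>2\<close> is at least a fixed multiple of \<open>\<bar>m\<bar>\<close> and of \<open>\<bar>n\<bar>\<close>: divide by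
  one generator and take imaginary parts. All discreteness and convergence statements for lattices
  come from these two inequalities.
\<close>
lemma complex_lattice_basis:
  assumes "complex_lattice \<Lambda>"
  shows "\<exists>\<omega>1 \<omega>2 \<delta>. \<Lambda> = {of_int m * \<omega>1 + of_int n * \<omega>2 | m n. True} \<and> \<delta> > 0 \<and>
    (\<forall>m n. \<delta> * \<bar>of_int m\<bar> \<le> norm (of_int m * \<omega>1 + of_int n * \<omega>2)) \<and>
    (\<forall>m n. \<delta> * \<bar>of_int n\<bar> \<le> norm (of_int m * \<omega>1 + of_int n * \<omega>2))"
proof -
  obtain \<omega>1 \<omega>2 where w: "\<omega>2 / \<omega>1 \<notin> \<real>" and L: "\<Lambda> = {of_int m * \<omega>1 + of_int n * \<omega>2 | m n. True}"
    using assms unfolding complex_lattice_def by auto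
  have nz: "\<omega>1 \<noteq> 0" "\<omega>2 \<noteq> 0" using w by auto
  have w': "\<omega>1 / \<omega>2 \<notin> \<real>"
    using w by (metis Reals_inverse inverse_divide)
  define d1 where "d1 = norm \<omega>1 * \<bar>Im (\<omega>2 / \<omega>1)\<bar>"
  define d2 where "d2 = norm \<omega>2 * \<bar>Im (\<omega>1 / \<omega>2)\<bar>"
  have pos: "d1 > 0" "d2 > 0"
    using w w' nz by (auto simp: d1_def d2_def complex_is_Real_iff)
  have ineq: "norm a * \<bar>Im (b / a)\<bar> * \<bar>of_int n\<bar> \<le> norm (of_int m * a + of_int n * b)"
    if "a \<noteq> 0" for a b m n
  proof -
    have "Im (of_int m + of_int n * (b / a)) = of_int n * Im (b / a)"
      by (simp del: times_divide_eq_right)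
    hence "\<bar>of_int n\<bar> * \<bar>Im (b / a)\<bar> \<le> norm (of_int m + of_int n * (b / a))"
      using abs_Im_le_cmod[of "of_int m + of_int n * (b / a)"] by (simp add: abs_mult del: times_divide_eq_right)
    hence "norm a * (\<bar>of_int n\<bar> * \<bar>Im (b / a)\<bar>) \<le> norm a * norm (of_int m + of_int n * (b / a))"
      by (intro mult_left_mono) auto
    also have "\<dots> = norm (of_int m * a + of_int n * b)"
      using that by (simp add: norm_mult [symmetric] algebra_simps)
    finally show ?thesis by (simp add: mult_ac)
  qed
  have n: "d1 * \<bar>of_int n\<bar> \<le> norm (of_int m * \<omega>1 + of_int n * \<omega>2)" for m n
    unfolding d1_def by (rule ineq[OF nz(1)])
  have m: "d2 * \<bar>of_int m\<bar> \<le> norm (of_int m * \<omega>1 + of_int n * \<omega>2)" for m n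
    using ineq[OF nz(2), of \<omega>1 m n] by (simp add: d2_def add.commute)
  have "min d1 d2 * \<bar>of_int m'\<bar> \<le> norm (of_int m' * \<omega>1 + of_int n * \<omega>2)" for m' n
    by (rule order_trans[OF _ m]) (auto intro: mult_right_mono)
  moreover have "min d1 d2 * \<bar>of_int n\<bar> \<le> norm (of_int m' * \<omega>1 + of_int n * \<omega>2)" for m' n
    by (rule order_trans[OF _ n]) (auto intro: mult_right_mono)
  moreover have "min d1 d2 > 0" using pos by auto
  ultimately show ?thesis using L by blast
qed

lemma complex_lattice_zero: "complex_lattice \<Lambda> \<Longrightarrow> 0 \<in> \<Lambda>"
  unfolding complex_lattice_def by (force intro: exI[of _ "0::int"])

lemma complex_lattice_uminus:
  assumes "complex_lattice \<Lambda>" "x \<in> \<Lambda>" shows "- x \<in> \<Lambda>"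
proof -
  obtain \<omega>1 \<omega>2 where L: "\<Lambda> = {of_int m * \<omega>1 + of_int n * \<omega>2 | m n. True}"
    using assms(1) unfolding complex_lattice_def by auto
  obtain m n where "x = of_int m * \<omega>1 + of_int n * \<omega>2" using assms(2) L by auto
  hence "- x = of_int (-m) * \<omega>1 + of_int (-n) * \<omega>2" by simp
  thus ?thesis unfolding L by blast
qed

lemma complex_lattice_add:
  assumes "complex_lattice \<Lambda>" "x \<in> \<Lambda>" "y \<in> \<Lambda>" shows "x + y \<in> \<Lambda>"
proof -
  obtain \<omega>1 \<omega>2 where L: "\<Lambda> = {of_int m * \<omega>1 + of_int n * \<omega>2 | m n. True}"
    using assms(1) unfolding complex_lattice_def by auto
  obtain m n where "x = of_int m * \<omega>1 + of_int n * \<omega>2" using assms(2) L by auto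
  moreover obtain m' n' where "y = of_int m' * \<omega>1 + of_int n' * \<omega>2" using assms(3) L by auto
  ultimately have "x + y = of_int (m + m') * \<omega>1 + of_int (n + n') * \<omega>2" by (simp add: algebra_simps)
  thus ?thesis unfolding L by blast
qed

lemma complex_lattice_diff:
  "complex_lattice \<Lambda> \<Longrightarrow> x \<in> \<Lambda> \<Longrightarrow> y \<in> \<Lambda> \<Longrightarrow> x - y \<in> \<Lambda>"
  using complex_lattice_add[of \<Lambda> x "- y"] complex_lattice_uminus[of \<Lambda> y] by simp

lemma complex_lattice_add_iff:
  assumes "complex_lattice \<Lambda>" "y \<in> \<Lambda>" shows "x + y \<in> \<Lambda> \<longleftrightarrow> x \<in> \<Lambda>"
  using complex_lattice_add[OF assms(1) _ assms(2)] complex_lattice_diff[OF assms(1) _ assms(2), of "x + y"]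
  by auto

lemma complex_lattice_uminus_iff:
  assumes "complex_lattice \<Lambda>" shows "- x \<in> \<Lambda> \<longleftrightarrow> x \<in> \<Lambda>"
  using complex_lattice_uminus[OF assms] by force

lemma complex_lattice_min_norm:
  assumes "complex_lattice \<Lambda>"
  obtains \<delta> where "\<delta> > 0" "\<And>\<omega>. \<omega> \<in> \<Lambda> - {0} \<Longrightarrow> \<delta> \<le> norm \<omega>"
proof -
  obtain \<omega>1 \<omega>2 \<delta> where b: "\<Lambda> = {of_int m * \<omega>1 + of_int n * \<omega>2 | m n. True}"
    "\<delta> > 0"
    "\<forall>m n. \<delta> * \<bar>of_int m\<bar> \<le> norm (of_int m * \<omega>1 + of_int n * \<omega>2)"
    "\<forall>m n. \<delta> * \<bar>of_int n\<bar> \<le> norm (of_int m * \<omega>1 + of_int n * \<omega>2)"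
    using complex_lattice_basis[OF assms] by blast
  have "\<delta> \<le> norm \<omega>" if nz: "\<omega> \<in> \<Lambda> - {0}" for \<omega>
  proof -
    obtain m n where mn: "\<omega> = of_int m * \<omega>1 + of_int n * \<omega>2" using nz unfolding b(1) by blast
    have "m \<noteq> 0 \<or> n \<noteq> 0" using nz mn by auto
    hence "1 \<le> \<bar>m\<bar> \<or> 1 \<le> \<bar>n\<bar>" by auto
    hence "1 \<le> \<bar>real_of_int m\<bar> \<or> 1 \<le> \<bar>real_of_int n\<bar>" by linarith
    thus ?thesis
    proof
      assume "1 \<le> \<bar>real_of_int m\<bar>"
      hence "\<delta> * 1 \<le> \<delta> * \<bar>real_of_int m\<bar>" using b(2) by (intro mult_left_mono) auto
      thus ?thesis using b(3)[rule_format, of m n] mn by simp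
    next
      assume "1 \<le> \<bar>real_of_int n\<bar>"
      hence "\<delta> * 1 \<le> \<delta> * \<bar>real_of_int n\<bar>" using b(2) by (intro mult_left_mono) auto
      thus ?thesis using b(4)[rule_format, of n m] mn by simp
    qed
  qed
  thus ?thesis using that b(2) by blast
qed

lemma complex_lattice_covering:
  assumes "complex_lattice \<Lambda>"
  obtains R where "R > 0" "\<And>z. \<exists>\<omega>\<in>\<Lambda>. dist z \<omega> < R"
proof -
  obtain \<omega>1 \<omega>2 where w: "\<omega>2 / \<omega>1 \<notin> \<real>" and L: "\<Lambda> = {of_int m * \<omega>1 + of_int n * \<omega>2 | m n. True}"
    using assms unfolding complex_lattice_def by auto
  have nz: "\<omega>1 \<noteq> 0" using w by auto
  define \<tau> where "\<tau> = \<omega>2 / \<omega>1"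
  have im: "Im \<tau> \<noteq> 0" using w by (auto simp: \<tau>_def complex_is_Real_iff)
  have "\<exists>\<omega>\<in>\<Lambda>. dist z \<omega> < norm \<omega>1 + norm \<omega>2 + 1" for z
  proof -
    define y where "y = Im (z / \<omega>1) / Im \<tau>"
    define x where "x = Re (z / \<omega>1) - y * Re \<tau>"
    have "z / \<omega>1 = of_real x + of_real y * \<tau>"
      using im by (intro complex_eqI) (auto simp: x_def y_def)
    hence z: "z = of_real x * \<omega>1 + of_real y * \<omega>2"
      using nz by (simp add: \<tau>_def field_simps)
    define \<omega> where "\<omega> = of_int \<lfloor>x\<rfloor> * \<omega>1 + of_int \<lfloor>y\<rfloor> * \<omega>2"
    have "z - \<omega> = of_real (frac x) * \<omega>1 + of_real (frac y) * \<omega>2"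
      by (simp add: z \<omega>_def frac_def algebra_simps)
    hence "norm (z - \<omega>) \<le> norm (of_real (frac x) * \<omega>1) + norm (of_real (frac y) * \<omega>2)"
      by (metis norm_triangle_ineq)
    also have "\<dots> = frac x * norm \<omega>1 + frac y * norm \<omega>2" by (simp add: norm_mult)
    also have "\<dots> \<le> 1 * norm \<omega>1 + 1 * norm \<omega>2"
      by (intro add_mono mult_right_mono) (auto simp: frac_lt_1 less_imp_le)
    finally have "dist z \<omega> < norm \<omega>1 + norm \<omega>2 + 1" by (simp add: dist_norm)
    moreover have "\<omega> \<in> \<Lambda>" unfolding L \<omega>_def by blast
    ultimately show ?thesis by blast
  qed
  moreover have "norm \<omega>1 + norm \<omega>2 + 1 > 0" by (simp add: add_nonneg_pos)
  ultimately show ?thesis using that by blast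
qed

lemma summable_on_int_powr:
  fixes p :: real assumes "p > 1"
  shows "(\<lambda>n::int. (1 + \<bar>of_int n\<bar>) powr (-p)) summable_on UNIV"
proof -
  let ?f = "\<lambda>n::int. (1 + \<bar>real_of_int n\<bar>) powr (-p)"
  have s: "summable (\<lambda>n::nat. (1 + real n) powr (-p))"
  proof -
    have "summable (\<lambda>n. real n powr (-p))" using assms by (simp add: summable_real_powr_iff)
    hence "summable (\<lambda>n. real (n + 1) powr (-p))" by (subst summable_iff_shift)
    thus ?thesis by (simp add: add_ac)
  qed
  have 1: "(\<lambda>n::nat. ?f (int n)) summable_on UNIV"
    using s by (intro norm_summable_imp_summable_on) simp
  have 2: "(\<lambda>n::nat. ?f (- int n)) summable_on UNIV"
    using s by (intro norm_summable_imp_summable_on) simp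
  have "?f summable_on (range int)"
    by (subst summable_on_reindex) (use 1 in \<open>auto simp: o_def inj_def\<close>)
  moreover have "?f summable_on (range (\<lambda>n. - int n))"
    by (subst summable_on_reindex) (use 2 in \<open>auto simp: o_def inj_def\<close>)
  ultimately have "?f summable_on (range int \<union> range (\<lambda>n. - int n))"
    by (rule summable_on_union)
  moreover have "range int \<union> range (\<lambda>n. - int n) = UNIV"
  proof -
    have "x \<in> range int \<union> range (\<lambda>n. - int n)" for x
      by (cases x rule: int_cases2) auto
    thus ?thesis by blast
  qed
  ultimately show ?thesis by simp
qed

text \<open>
  A lattice element is bounded below by a multiple of \<open>max \<bar>m\<bar> \<bar>n\<bar>\<close>, so the inverse cube of its norm is
  at most a multiple of \<open>(1 + \<bar>m\<bar>) powr (-3/2) * (1 + \<bar>n\<bar>) powr (-3/2)\<close>. This turns the double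
  series into a product of two convergent simple series.
\<close>
lemma lattice_summable_norm_cube:
  assumes "complex_lattice \<Lambda>"
  shows "(\<lambda>\<omega>. 1 / norm \<omega> ^ 3) summable_on (\<Lambda> - {0})"
proof -
  obtain \<omega>1 \<omega>2 \<delta> where b: "\<Lambda> = {of_int m * \<omega>1 + of_int n * \<omega>2 | m n. True}"
    "\<delta> > 0"
    "\<forall>m n. \<delta> * \<bar>of_int m\<bar> \<le> norm (of_int m * \<omega>1 + of_int n * \<omega>2)"
    "\<forall>m n. \<delta> * \<bar>of_int n\<bar> \<le> norm (of_int m * \<omega>1 + of_int n * \<omega>2)"
    using complex_lattice_basis[OF assms] by blast
  define \<phi> where "\<phi> = (\<lambda>(m::int, n::int). of_int m * \<omega>1 + of_int n * \<omega>2)"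
  define f where "f = (\<lambda>n::int. (1 + \<bar>real_of_int n\<bar>) powr (-(3/2)))"
  have f0: "f n > 0" for n by (auto simp: f_def)
  have fsum: "f summable_on UNIV" unfolding f_def by (rule summable_on_int_powr) auto
  have "(\<lambda>(m,n). f m * f n) summable_on (UNIV \<times> UNIV)"
  proof (rule summable_on_SigmaI)
    show "((\<lambda>n. case (m, n) of (m, n) \<Rightarrow> f m * f n) has_sum (f m * infsum f UNIV)) UNIV" for m
      using has_sum_cmult_right[OF has_sum_infsum[OF fsum]] by simp
    show "(\<lambda>m. f m * infsum f UNIV) summable_on UNIV"
      by (intro summable_on_cmult_left fsum)
  qed (auto intro: mult_nonneg_nonneg f0 less_imp_le)
  hence fs2: "(\<lambda>p. 8 / \<delta> ^ 3 * (f (fst p) * f (snd p))) summable_on S" for S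
    by (intro summable_on_cmult_right) (auto simp: case_prod_unfold intro: summable_on_subset)
  define S where "S = \<phi> -` (\<Lambda> - {0})"
  have "(\<lambda>p. 1 / norm (\<phi> p) ^ 3) summable_on S"
  proof (rule summable_on_comparison_test[OF fs2])
    fix p assume p: "p \<in> S"
    obtain m n where mn: "p = (m, n)" by (cases p)
    define M where "M = max \<bar>real_of_int m\<bar> \<bar>real_of_int n\<bar>"
    have nz: "\<phi> p \<noteq> 0" using p by (auto simp: S_def)
    hence "(m, n) \<noteq> (0, 0)" by (auto simp: \<phi>_def mn)
    hence "1 \<le> \<bar>m\<bar> \<or> 1 \<le> \<bar>n\<bar>" by auto
    hence "1 \<le> \<bar>real_of_int m\<bar> \<or> 1 \<le> \<bar>real_of_int n\<bar>" by linarith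
    hence M1: "M \<ge> 1" by (auto simp: M_def)
    have "\<delta> * M \<le> norm (\<phi> p)" using b(3)[rule_format, of m n] b(4)[rule_format, of n m] by (auto simp: \<phi>_def mn M_def max_def)
    hence "(\<delta> * M) ^ 3 \<le> norm (\<phi> p) ^ 3" using b(2) M1 by (intro power_mono) auto
    hence "1 / norm (\<phi> p) ^ 3 \<le> 1 / (\<delta> * M) ^ 3"
      using b(2) M1 by (intro divide_left_mono) (auto intro!: mult_pos_pos zero_less_power nz)
    also have "\<dots> = 8 / \<delta> ^ 3 * (1 / (2 * M) ^ 3)"
      by (simp add: power_mult_distrib)
    also have "1 / (2 * M) ^ 3 \<le> f m * f n"
    proof -
      have "(2 * M) ^ 3 = (2 * M) powr (3/2) * (2 * M) powr (3/2)"
        using M1 powr_realpow[of "2 * M" 3] powr_add[of "2 * M" "3/2" "3/2"] by simp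
      moreover have "(1 + \<bar>real_of_int m\<bar>) powr (3/2) * (1 + \<bar>real_of_int n\<bar>) powr (3/2) \<le>
           (2 * M) powr (3/2) * (2 * M) powr (3/2)"
        using M1 by (intro mult_mono powr_mono2) (auto simp: M_def)
      ultimately have "1 / (2 * M) ^ 3 \<le> 1 / ((1 + \<bar>real_of_int m\<bar>) powr (3/2) * (1 + \<bar>real_of_int n\<bar>) powr (3/2))"
        using M1 by (intro divide_left_mono) (auto intro!: mult_pos_pos)
      thus ?thesis by (simp add: f_def powr_minus field_simps)
    qed
    finally show "1 / norm (\<phi> p) ^ 3 \<le> 8 / \<delta> ^ 3 * (f (fst p) * f (snd p))"
      using b(2) by (simp add: mn divide_right_mono)
  qed auto
  hence "((\<lambda>\<omega>. 1 / norm \<omega> ^ 3) \<circ> \<phi>) summable_on S" by (simp add: o_def)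
  moreover have "inj \<phi>"
  proof (rule injI, clarify)
    fix m n m' n' assume "\<phi> (m, n) = \<phi> (m', n')"
    hence "of_int (m - m') * \<omega>1 + of_int (n - n') * \<omega>2 = 0" by (simp add: \<phi>_def algebra_simps)
    hence "\<delta> * \<bar>of_int (m - m')\<bar> \<le> 0" "\<delta> * \<bar>of_int (n - n')\<bar> \<le> 0" using b(3)[rule_format, of "m - m'" "n - n'"] b(4)[rule_format, of "n - n'" "m - m'"] by auto
    thus "m = m' \<and> n = n'" using b(2) by (auto simp: mult_le_0_iff)
  qed
  ultimately have "(\<lambda>\<omega>. 1 / norm \<omega> ^ 3) summable_on (\<phi> ` S)"
    by (subst summable_on_reindex) (auto intro: inj_on_subset)
  moreover have "\<phi> ` S = \<Lambda> - {0}"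
    by (auto simp: S_def \<phi>_def b(1) image_iff)
  ultimately show ?thesis by simp
qed

lemma complex_lattice_finite_ball:
  assumes "complex_lattice \<Lambda>"
  shows "finite {\<omega>\<in>\<Lambda>. norm \<omega> \<le> r}"
proof -
  obtain \<omega>1 \<omega>2 \<delta> where b: "\<Lambda> = {of_int m * \<omega>1 + of_int n * \<omega>2 | m n. True}"
    "\<delta> > 0"
    "\<forall>m n. \<delta> * \<bar>of_int m\<bar> \<le> norm (of_int m * \<omega>1 + of_int n * \<omega>2)"
    "\<forall>m n. \<delta> * \<bar>of_int n\<bar> \<le> norm (of_int m * \<omega>1 + of_int n * \<omega>2)"
    using complex_lattice_basis[OF assms] by blast
  define N where "N = \<lceil>r / \<delta>\<rceil>"
  have "{\<omega>\<in>\<Lambda>. norm \<omega> \<le> r} \<subseteq> (\<lambda>(m,n). of_int m * \<omega>1 + of_int n * \<omega>2) ` ({-N..N} \<times> {-N..N})"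
  proof
    fix \<omega> assume "\<omega> \<in> {\<omega>\<in>\<Lambda>. norm \<omega> \<le> r}"
    then obtain m n where mn: "\<omega> = of_int m * \<omega>1 + of_int n * \<omega>2" "norm \<omega> \<le> r" unfolding b(1) by auto
    have "\<delta> * \<bar>of_int m\<bar> \<le> r" "\<delta> * \<bar>of_int n\<bar> \<le> r"
      using b(3)[rule_format, of m n] b(4)[rule_format, of n m] mn by auto
    hence "\<bar>of_int m\<bar> \<le> r / \<delta>" "\<bar>of_int n\<bar> \<le> r / \<delta>"
      using b(2) by (auto simp: field_simps)
    hence "\<bar>m\<bar> \<le> N" "\<bar>n\<bar> \<le> N" unfolding N_def by linarith+
    thus "\<omega> \<in> (\<lambda>(m,n). of_int m * \<omega>1 + of_int n * \<omega>2) ` ({-N..N} \<times> {-N..N})"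
      unfolding mn(1) by (intro image_eqI[of _ _ "(m, n)"]) auto
  qed
  thus ?thesis by (rule finite_subset) auto
qed

lemma complex_lattice_sparse:
  assumes "complex_lattice \<Lambda>"
  shows "\<Lambda> sparse_in UNIV"
proof -
  have "\<not> x islimpt \<Lambda>" for x
  proof
    assume "x islimpt \<Lambda>"
    hence "infinite (\<Lambda> \<inter> ball x 1)" by (simp add: islimpt_eq_infinite_ball)
    moreover have "\<Lambda> \<inter> ball x 1 \<subseteq> {\<omega>\<in>\<Lambda>. norm \<omega> \<le> norm x + 1}"
    proof clarify
      fix \<omega> assume "\<omega> \<in> ball x 1"
      thus "norm \<omega> \<le> norm x + 1" using norm_triangle_ineq4[of x "x - \<omega>"] by (simp add: dist_norm)
    qed
    ultimately show False using finite_subset complex_lattice_finite_ball[OF assms] by blast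
  qed
  thus ?thesis by (auto simp: sparse_in_def)
qed

text \<open>
  Uniform convergence of holomorphic functions passes to derivatives; the Weierstrass M-test supplies
  the uniform convergence along the filter of finite partial sums. Stating the
  conclusion with \<open>has_sum\<close> includes the convergence of the series of derivatives.
\<close>
lemma infsum_termwise_derivative:
  fixes f f' :: "'a \<Rightarrow> complex \<Rightarrow> complex"
  assumes der: "\<And>x z. x \<in> X \<Longrightarrow> z \<in> cball c r \<Longrightarrow> (f x has_field_derivative f' x z) (at z)"
    and bound: "\<And>x z. x \<in> X \<Longrightarrow> z \<in> cball c r \<Longrightarrow> norm (f x z) \<le> M x"
    and M: "M summable_on X"
    and z: "z \<in> ball c r"
  shows "\<exists>D. ((\<lambda>z. \<Sum>\<^sub>\<infinity>x\<in>X. f x z) has_field_derivative D) (at z) \<and> ((\<lambda>x. f' x z) has_sum D) X"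
proof -
  have ul: "uniform_limit (cball c r) (\<lambda>A z. \<Sum>x\<in>A. f x z) (\<lambda>z. \<Sum>\<^sub>\<infinity>x\<in>X. f x z) (finite_subsets_at_top X)"
    by (rule Weierstrass_m_test_general[OF bound M])
  have ev: "\<forall>\<^sub>F A in finite_subsets_at_top X. A \<subseteq> X"
    by (rule eventually_finite_subsets_at_top_weakI) auto
  have "\<forall>\<^sub>F A in finite_subsets_at_top X. continuous_on (cball c r) (\<lambda>z. \<Sum>x\<in>A. f x z) \<and>
          (\<forall>w\<in>ball c r. ((\<lambda>z. \<Sum>x\<in>A. f x z) has_field_derivative (\<Sum>x\<in>A. f' x w)) (at w))"
    using ev
  proof eventually_elim
    case (elim A)
    have d: "((\<lambda>z. \<Sum>x\<in>A. f x z) has_field_derivative (\<Sum>x\<in>A. f' x w)) (at w)" if "w \<in> cball c r" for w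
      by (rule DERIV_sum) (use der elim that in auto)
    have "continuous_on (cball c r) (\<lambda>z. \<Sum>x\<in>A. f x z)"
      by (intro continuous_at_imp_continuous_on ballI DERIV_isCont[OF d])
    thus ?case using d by auto
  qed
  moreover have "0 < r" using z by (metis ball_empty empty_iff not_le)
  ultimately obtain g' where g': "\<And>w. w \<in> ball c r \<Longrightarrow> ((\<lambda>z. \<Sum>\<^sub>\<infinity>x\<in>X. f x z) has_field_derivative (g' w)) (at w) \<and>
       ((\<lambda>A. \<Sum>x\<in>A. f' x w) \<longlongrightarrow> g' w) (finite_subsets_at_top X)"
    using has_complex_derivative_uniform_limit[OF _ ul, of "\<lambda>A w. \<Sum>x\<in>A. f' x w"] by auto
  show ?thesis using g'[OF z] by (auto simp: has_sum_def)
qed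

section \<open>The Weierstrass function of a lattice\<close>

lemma wp_term_bound:
  fixes z \<omega> :: complex
  assumes "r > 0" "norm z \<le> r" "2 * r \<le> norm \<omega>"
  shows "norm (1 / (z - \<omega>) ^ 2 - 1 / \<omega> ^ 2) \<le> 10 * r * (1 / norm \<omega> ^ 3)"
proof -
  have \<omega>0: "\<omega> \<noteq> 0" "norm \<omega> > 0" using assms by auto
  have half: "norm \<omega> / 2 \<le> norm (z - \<omega>)"
    using norm_triangle_ineq2[of \<omega> z] assms by (simp add: norm_minus_commute)
  hence z\<omega>: "z - \<omega> \<noteq> 0" using \<omega>0 by auto
  have eq: "1 / (z - \<omega>) ^ 2 - 1 / \<omega> ^ 2 = z * (2 * \<omega> - z) / ((z - \<omega>) ^ 2 * \<omega> ^ 2)"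
    using \<omega>0 z\<omega> by (simp add: divide_simps) (simp add: power2_eq_square algebra_simps)
  have "norm (2 * \<omega> - z) \<le> norm (2 * \<omega>) + norm z" by (rule norm_triangle_ineq4)
  also have "\<dots> \<le> 5/2 * norm \<omega>" using assms by (simp add: norm_mult)
  finally have a: "norm (2 * \<omega> - z) \<le> 5/2 * norm \<omega>" .
  have "norm (1 / (z - \<omega>) ^ 2 - 1 / \<omega> ^ 2) = norm z * norm (2 * \<omega> - z) / (norm (z - \<omega>) ^ 2 * norm \<omega> ^ 2)"
    unfolding eq by (simp add: norm_mult norm_divide norm_power)
  also have "\<dots> \<le> r * (5/2 * norm \<omega>) / ((norm \<omega> / 2) ^ 2 * norm \<omega> ^ 2)"
    using assms \<omega>0 a half by (intro frac_le mult_mono power_mono mult_pos_pos) auto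
  also have "\<dots> = 10 * r * (1 / norm \<omega> ^ 3)"
    using \<omega>0 by (simp add: field_simps power2_eq_square power3_eq_cube)
  finally show ?thesis .
qed

lemma wp_term_derivative:
  fixes z \<omega> :: complex
  assumes "z \<noteq> \<omega>"
  shows "((\<lambda>z. 1 / (z - \<omega>) ^ 2 - 1 / \<omega> ^ 2) has_field_derivative (- 2 / (z - \<omega>) ^ 3)) (at z)"
proof -
  have "((\<lambda>z. inverse ((z - \<omega>) ^ 2)) has_field_derivative - (inverse ((z - \<omega>) ^ 2) * (2 * (z - \<omega>)) * inverse ((z - \<omega>) ^ 2))) (at z)"
    using assms by (auto intro!: derivative_eq_intros)
  moreover have "- (inverse (a ^ 2) * (2 * a) * inverse (a ^ 2)) = - 2 / a ^ 3" if "a \<noteq> 0" for a :: complex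
    using that by (simp add: field_simps power2_eq_square power3_eq_cube)
  ultimately have "((\<lambda>z. inverse ((z - \<omega>) ^ 2)) has_field_derivative - 2 / (z - \<omega>) ^ 3) (at z)"
    using assms by (metis right_minus_eq)
  from DERIV_diff[OF this DERIV_const[of "1 / \<omega> ^ 2"]] show ?thesis
    by (simp add: inverse_eq_divide)
qed

context
  fixes \<Lambda> :: "complex set"
  assumes lat: "complex_lattice \<Lambda>"
begin

lemma wp_term_summable: "(\<lambda>\<omega>. norm (1 / (z - \<omega>) ^ 2 - 1 / \<omega> ^ 2)) summable_on (\<Lambda> - {0})"
proof -
  define r where "r = norm z + 1"
  have r: "r > 0" "norm z \<le> r" by (auto simp: r_def add_nonneg_pos)
  define A where "A = {\<omega>\<in>\<Lambda> - {0}. norm \<omega> < 2 * r}"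
  have "finite A"
    by (rule finite_subset[OF _ complex_lattice_finite_ball[OF lat, of "2 * r"]]) (auto simp: A_def)
  have "(\<lambda>\<omega>. 10 * r * (1 / norm \<omega> ^ 3)) summable_on (\<Lambda> - {0} - A)"
    by (intro summable_on_cmult_right summable_on_subset_banach[OF lattice_summable_norm_cube[OF lat]]) auto
  hence "(\<lambda>\<omega>. norm (1 / (z - \<omega>) ^ 2 - 1 / \<omega> ^ 2)) summable_on (\<Lambda> - {0} - A)"
  proof (rule Infinite_Sum.abs_summable_on_comparison_test')
    fix \<omega> assume "\<omega> \<in> \<Lambda> - {0} - A"
    thus "norm (1 / (z - \<omega>) ^ 2 - 1 / \<omega> ^ 2) \<le> 10 * r * (1 / norm \<omega> ^ 3)"
      using r by (intro wp_term_bound) (auto simp: A_def)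
  qed
  hence "(\<lambda>\<omega>. norm (1 / (z - \<omega>) ^ 2 - 1 / \<omega> ^ 2)) summable_on (A \<union> (\<Lambda> - {0} - A))"
    by (rule summable_on_union[OF summable_on_finite[OF \<open>finite A\<close>]])
  moreover have "A \<union> (\<Lambda> - {0} - A) = \<Lambda> - {0}" by (auto simp: A_def)
  ultimately show ?thesis by simp
qed

text \<open>
  On a disc of radius \<open>r\<close> only the finitely many terms with \<open>norm \<omega> < 2 * r\<close> can be singular; the others sum
  to a holomorphic function. Meromorphy and the derivative of \<open>\<wp>\<close> are both read off from this splitting.
\<close>
lemma wp_local_decomposition:
  assumes r: "r > 0"
  shows "\<exists>A \<psi>. finite A \<and> A \<subseteq> \<Lambda> - {0} \<and> \<psi> holomorphic_on ball 0 r \<and>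
     (\<forall>z\<in>ball 0 r. lattice_wp \<Lambda> z = 1 / z ^ 2 + (\<Sum>\<omega>\<in>A. 1 / (z - \<omega>) ^ 2 - 1 / \<omega> ^ 2) + \<psi> z \<and>
        ((\<lambda>\<omega>. - 2 / (z - \<omega>) ^ 3) has_sum deriv \<psi> z) (\<Lambda> - {0} - A))"
proof -
  define A where "A = {\<omega>\<in>\<Lambda> - {0}. norm \<omega> < 2 * r}"
  define B where "B = \<Lambda> - {0} - A"
  define \<psi> where "\<psi> = (\<lambda>z. \<Sum>\<^sub>\<infinity>\<omega>\<in>B. (1 / (z - \<omega>) ^ 2 - 1 / \<omega> ^ 2))"
  have "finite A"
    by (rule finite_subset[OF _ complex_lattice_finite_ball[OF lat, of "2 * r"]]) (auto simp: A_def)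
  have sB: "(\<lambda>\<omega>. 10 * r * (1 / norm \<omega> ^ 3)) summable_on B"
    unfolding B_def
    by (intro summable_on_cmult_right summable_on_subset_banach[OF lattice_summable_norm_cube[OF lat]]) auto
  have nz: "z - \<omega> \<noteq> 0" if "\<omega> \<in> B" "z \<in> cball 0 r" for z \<omega>
    using that r by (auto simp: A_def B_def)
  have D: "\<exists>D. (\<psi> has_field_derivative D) (at z) \<and> ((\<lambda>\<omega>. - 2 / (z - \<omega>) ^ 3) has_sum D) B"
    if "z \<in> ball 0 r" for z
    unfolding \<psi>_def
  proof (rule infsum_termwise_derivative[OF _ _ sB that])
    fix \<omega> z :: complex assume *: "\<omega> \<in> B" "z \<in> cball 0 r"
    show "((\<lambda>z. 1 / (z - \<omega>)\<^sup>2 - 1 / \<omega>\<^sup>2) has_field_derivative - 2 / (z - \<omega>) ^ 3) (at z)"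
      using nz[OF *] by (intro wp_term_derivative) auto
    show "norm (1 / (z - \<omega>)\<^sup>2 - 1 / \<omega>\<^sup>2) \<le> 10 * r * (1 / norm \<omega> ^ 3)"
      using * r by (intro wp_term_bound) (auto simp: A_def B_def)
  qed
  have "\<psi> holomorphic_on ball 0 r"
    using D by (subst holomorphic_on_open) blast+
  moreover have "((\<lambda>\<omega>. - 2 / (z - \<omega>) ^ 3) has_sum deriv \<psi> z) B" if "z \<in> ball 0 r" for z
    using D[OF that] DERIV_imp_deriv by blast
  moreover have "lattice_wp \<Lambda> z = 1 / z ^ 2 + (\<Sum>\<omega>\<in>A. 1 / (z - \<omega>) ^ 2 - 1 / \<omega> ^ 2) + \<psi> z" for z
  proof -
    have s: "(\<lambda>\<omega>. 1 / (z - \<omega>) ^ 2 - 1 / \<omega> ^ 2) summable_on (\<Lambda> - {0})"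
      by (rule abs_summable_summable[OF wp_term_summable])
    have "\<Lambda> - {0} = A \<union> B" by (auto simp: A_def B_def)
    hence "(\<Sum>\<^sub>\<infinity>\<omega>\<in>\<Lambda>-{0}. (1 / (z - \<omega>) ^ 2 - 1 / \<omega> ^ 2)) = (\<Sum>\<^sub>\<infinity>\<omega>\<in>A \<union> B. (1 / (z - \<omega>) ^ 2 - 1 / \<omega> ^ 2))" by simp
    also have "\<dots> = (\<Sum>\<^sub>\<infinity>\<omega>\<in>A. (1 / (z - \<omega>) ^ 2 - 1 / \<omega> ^ 2)) + \<psi> z"
      unfolding \<psi>_def using s
      by (intro infsum_Un_disjoint) (auto simp: A_def B_def intro: summable_on_subset_banach)
    finally show ?thesis using \<open>finite A\<close> by (simp add: lattice_wp_def)
  qed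
  moreover have "A \<subseteq> \<Lambda> - {0}" by (auto simp: A_def)
  ultimately show ?thesis using \<open>finite A\<close> unfolding B_def by blast
qed

lemma wp_meromorphic: "lattice_wp \<Lambda> meromorphic_on UNIV"
proof -
  have "lattice_wp \<Lambda> meromorphic_on {x}" for x
  proof -
    define r where "r = norm x + 1"
    have r: "r > 0" "x \<in> ball 0 r" by (auto simp: r_def add_nonneg_pos)
    obtain A \<psi> where A: "finite A" "A \<subseteq> \<Lambda> - {0}" "\<psi> holomorphic_on ball 0 r"
      "\<And>z. z \<in> ball 0 r \<Longrightarrow> lattice_wp \<Lambda> z = 1 / z ^ 2 + (\<Sum>\<omega>\<in>A. 1 / (z - \<omega>) ^ 2 - 1 / \<omega> ^ 2) + \<psi> z"
      using wp_local_decomposition[OF r(1)] by blast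
    have "\<psi> analytic_on {x}" using A(3) r(2) by (meson analytic_at open_ball)
    hence m: "(\<lambda>z. 1 / z ^ 2 + (\<Sum>\<omega>\<in>A. 1 / (z - \<omega>) ^ 2 - 1 / \<omega> ^ 2) + \<psi> z) meromorphic_on {x}"
      by (intro meromorphic_intros analytic_on_imp_meromorphic_on) auto
    have "\<forall>\<^sub>F z in nhds x. z \<in> ball 0 r" using r(2) by (intro eventually_nhds_in_open) auto
    hence "\<forall>\<^sub>F z in at x. z \<in> ball 0 r" by (rule eventually_nhds_conv_at[THEN iffD1, THEN conjunct1])
    hence "\<forall>\<^sub>F z in at x. lattice_wp \<Lambda> z = 1 / z ^ 2 + (\<Sum>\<omega>\<in>A. 1 / (z - \<omega>) ^ 2 - 1 / \<omega> ^ 2) + \<psi> z"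
      by eventually_elim (rule A(4))
    thus ?thesis using m by (subst meromorphic_on_cong[OF _ refl]) auto
  qed
  thus ?thesis using meromorphic_on_meromorphic_at by blast
qed

lemma wp_termwise_derivative:
  assumes z: "z \<notin> \<Lambda>"
  shows "\<exists>D. (lattice_wp \<Lambda> has_field_derivative D) (at z) \<and> ((\<lambda>\<omega>. - 2 / (z - \<omega>) ^ 3) has_sum D) \<Lambda>"
proof -
  define r where "r = norm z + 1"
  have r: "r > 0" "z \<in> ball 0 r" by (auto simp: r_def add_nonneg_pos)
  obtain A \<psi> where A: "finite A" "A \<subseteq> \<Lambda> - {0}" "\<psi> holomorphic_on ball 0 r"
    "\<And>z. z \<in> ball 0 r \<Longrightarrow> lattice_wp \<Lambda> z = 1 / z ^ 2 + (\<Sum>\<omega>\<in>A. 1 / (z - \<omega>) ^ 2 - 1 / \<omega> ^ 2) + \<psi> z"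
    "\<And>z. z \<in> ball 0 r \<Longrightarrow> ((\<lambda>\<omega>. - 2 / (z - \<omega>) ^ 3) has_sum deriv \<psi> z) (\<Lambda> - {0} - A)"
    using wp_local_decomposition[OF r(1)] by blast
  have nz: "z \<noteq> 0" "\<And>\<omega>. \<omega> \<in> A \<Longrightarrow> z - \<omega> \<noteq> 0"
    using z complex_lattice_zero[OF lat] A(2) by auto
  define D where "D = - 2 / z ^ 3 + (\<Sum>\<omega>\<in>A. - 2 / (z - \<omega>) ^ 3) + deriv \<psi> z"
  have "(\<psi> has_field_derivative deriv \<psi> z) (at z)"
    using A(3) r(2) by (meson holomorphic_derivI open_ball)
  moreover have "((\<lambda>z. 1 / z ^ 2) has_field_derivative - 2 / z ^ 3) (at z)"
    using wp_term_derivative[of z 0] nz by simp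
  moreover have "((\<lambda>z. \<Sum>\<omega>\<in>A. 1 / (z - \<omega>) ^ 2 - 1 / \<omega> ^ 2) has_field_derivative (\<Sum>\<omega>\<in>A. - 2 / (z - \<omega>) ^ 3)) (at z)"
  proof (rule DERIV_sum)
    fix \<omega> assume "\<omega> \<in> A"
    thus "((\<lambda>z. 1 / (z - \<omega>) ^ 2 - 1 / \<omega> ^ 2) has_field_derivative (- 2 / (z - \<omega>) ^ 3)) (at z)"
      using nz(2)[of \<omega>] by (intro wp_term_derivative) auto
  qed
  ultimately have "((\<lambda>z. 1 / z ^ 2 + (\<Sum>\<omega>\<in>A. 1 / (z - \<omega>) ^ 2 - 1 / \<omega> ^ 2) + \<psi> z) has_field_derivative D) (at z)"
    unfolding D_def by (intro DERIV_add)
  hence "(lattice_wp \<Lambda> has_field_derivative D) (at z)"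
    by (rule has_field_derivative_transform_within_open[OF _ open_ball r(2)]) (simp add: A(4))
  moreover have "((\<lambda>\<omega>. - 2 / (z - \<omega>) ^ 3) has_sum ((\<Sum>\<omega>\<in>insert 0 A. - 2 / (z - \<omega>) ^ 3) + deriv \<psi> z)) (insert 0 A \<union> (\<Lambda> - {0} - A))"
    by (intro has_sum_Un_disjoint has_sum_finite A(5) r(2)) (use A(1) in auto)
  moreover have "insert 0 A \<union> (\<Lambda> - {0} - A) = \<Lambda>" using A(2) complex_lattice_zero[OF lat] by auto
  moreover have "(\<Sum>\<omega>\<in>insert 0 A. - 2 / (z - \<omega>) ^ 3) + deriv \<psi> z = D"
    using A(1,2) by (subst sum.insert) (auto simp: D_def)
  ultimately show ?thesis by metis
qed

lemma lattice_open_compl: "open (- \<Lambda>)"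
  using sparse_in_UNIV_imp_closed[OF complex_lattice_sparse[OF lat]] by auto

lemma wp_holomorphic: "lattice_wp \<Lambda> holomorphic_on - \<Lambda>"
  using wp_termwise_derivative by (subst holomorphic_on_open[OF lattice_open_compl]) blast

lemma wp_has_deriv: "z \<notin> \<Lambda> \<Longrightarrow> (lattice_wp \<Lambda> has_field_derivative deriv (lattice_wp \<Lambda>) z) (at z)"
  using wp_termwise_derivative DERIV_imp_deriv by blast

lemma deriv_wp_has_sum: "z \<notin> \<Lambda> \<Longrightarrow> ((\<lambda>\<omega>. - 2 / (z - \<omega>) ^ 3) has_sum deriv (lattice_wp \<Lambda>) z) \<Lambda>"
  using wp_termwise_derivative DERIV_imp_deriv by blast

lemma deriv_wp_holomorphic: "deriv (lattice_wp \<Lambda>) holomorphic_on - \<Lambda>"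
  by (rule holomorphic_deriv[OF wp_holomorphic lattice_open_compl])

lemma lattice_translate_bij: "\<omega> \<in> \<Lambda> \<Longrightarrow> bij_betw (\<lambda>x. x + \<omega>) \<Lambda> \<Lambda>"
  by (rule bij_betwI[of _ _ _ "\<lambda>x. x - \<omega>"])
     (auto intro: complex_lattice_add[OF lat] complex_lattice_diff[OF lat])

lemma lattice_uminus_bij: "bij_betw uminus (\<Lambda> - {0}) (\<Lambda> - {0})"
  by (rule bij_betwI[of _ _ _ uminus]) (auto intro: complex_lattice_uminus[OF lat])

lemma deriv_wp_periodic:
  assumes "\<omega> \<in> \<Lambda>" "z \<notin> \<Lambda>"
  shows "deriv (lattice_wp \<Lambda>) (z + \<omega>) = deriv (lattice_wp \<Lambda>) z"
proof -
  have "z + \<omega> \<notin> \<Lambda>" using assms complex_lattice_add_iff[OF lat] by auto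
  hence "((\<lambda>x. - 2 / (z + \<omega> - x) ^ 3) has_sum deriv (lattice_wp \<Lambda>) (z + \<omega>)) \<Lambda>"
    by (rule deriv_wp_has_sum)
  hence "((\<lambda>x. - 2 / (z + \<omega> - (x + \<omega>)) ^ 3) has_sum deriv (lattice_wp \<Lambda>) (z + \<omega>)) \<Lambda>"
    by (subst has_sum_reindex_bij_betw[OF lattice_translate_bij[OF assms(1)]])
  thus ?thesis using has_sum_unique deriv_wp_has_sum[OF assms(2)] by fastforce
qed

lemma wp_even: "lattice_wp \<Lambda> (- z) = lattice_wp \<Lambda> z"
proof -
  have "(\<Sum>\<^sub>\<infinity>\<omega>\<in>\<Lambda> - {0}. (1 / (- z - \<omega>) ^ 2 - 1 / \<omega> ^ 2)) =
        (\<Sum>\<^sub>\<infinity>\<omega>\<in>\<Lambda> - {0}. (1 / (- z - (-\<omega>)) ^ 2 - 1 / (-\<omega>) ^ 2))"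
    by (rule infsum_reindex_bij_betw[OF lattice_uminus_bij, symmetric])
  also have "\<dots> = (\<Sum>\<^sub>\<infinity>\<omega>\<in>\<Lambda> - {0}. (1 / (z - \<omega>) ^ 2 - 1 / \<omega> ^ 2))"
    by (intro infsum_cong) (simp add: power2_commute)
  finally show ?thesis by (simp add: lattice_wp_def)
qed

lemma deriv_wp_odd:
  assumes "z \<notin> \<Lambda>" shows "deriv (lattice_wp \<Lambda>) (- z) = - deriv (lattice_wp \<Lambda>) z"
proof -
  have "- z \<notin> \<Lambda>" using assms complex_lattice_uminus_iff[OF lat] by auto
  hence "((\<lambda>z. lattice_wp \<Lambda> (- z)) has_field_derivative deriv (lattice_wp \<Lambda>) (- z) * (- 1)) (at z)"
    by (intro DERIV_chain'[where f = uminus] wp_has_deriv) (auto intro!: derivative_eq_intros)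
  hence "(lattice_wp \<Lambda> has_field_derivative deriv (lattice_wp \<Lambda>) (- z) * (- 1)) (at z)"
    by (simp add: wp_even)
  thus ?thesis using DERIV_unique[OF wp_has_deriv[OF assms]] by fastforce
qed

lemma lattice_compl_connected: "connected (- \<Lambda>)"
  using sparse_imp_connected[OF _ connected_UNIV open_UNIV complex_lattice_sparse[OF lat]]
  by (simp add: Compl_eq_Diff_UNIV)

text \<open>
  Since \<open>\<wp>'\<close> is periodic, \<open>\<wp>(z + \<omega>) - \<wp>(z)\<close> is a constant. Evenness of \<open>\<wp>\<close> turns this difference at
  \<open>- z\<close> into the negative of the difference at \<open>z - \<omega>\<close>, so the constant is its own negative.
\<close>
lemma wp_periodic:
  assumes "\<omega> \<in> \<Lambda>" "z \<notin> \<Lambda>"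
  shows "lattice_wp \<Lambda> (z + \<omega>) = lattice_wp \<Lambda> z"
proof -
  define f where "f = (\<lambda>z. lattice_wp \<Lambda> (z + \<omega>) - lattice_wp \<Lambda> z)"
  have "f constant_on - \<Lambda>"
  proof (rule has_field_derivative_0_imp_constant_on)
    fix x assume x: "x \<in> - \<Lambda>"
    hence "x + \<omega> \<notin> \<Lambda>" using assms complex_lattice_add_iff[OF lat] by auto
    hence "((\<lambda>z. lattice_wp \<Lambda> (z + \<omega>)) has_field_derivative deriv (lattice_wp \<Lambda>) x) (at x)"
      using wp_has_deriv[of "x + \<omega>"] deriv_wp_periodic[OF assms(1), of x] x by (simp add: DERIV_shift)
    from DERIV_diff[OF this wp_has_deriv] x show "(f has_field_derivative 0) (at x)"
      by (simp add: f_def)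
  qed (auto simp: lattice_compl_connected lattice_open_compl)
  then obtain c where c: "\<And>x. x \<notin> \<Lambda> \<Longrightarrow> f x = c" by (auto simp: constant_on_def)
  have n: "z - \<omega> \<notin> \<Lambda>" "- z \<notin> \<Lambda>"
    using assms complex_lattice_add_iff[OF lat, of \<omega> "z - \<omega>"] complex_lattice_uminus_iff[OF lat] by auto
  \<comment> \<open>evaluate the constant at \<open>- z\<close> and at \<open>z - \<omega>\<close>\<close>
  have "c = lattice_wp \<Lambda> (- (z - \<omega>)) - lattice_wp \<Lambda> (- z)"
    using c[OF n(2)] by (simp add: f_def)
  also have "\<dots> = - f (z - \<omega>)" by (simp only: wp_even) (simp add: f_def)
  also have "\<dots> = - c" using c[OF n(1)] by simp
  finally have "c = 0" by simp
  thus ?thesis using c[OF assms(2)] by (simp add: f_def)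
qed

text \<open>
  Periodicity transports the limit at \<open>0\<close> to every lattice point. The singularities are therefore
  removable, the extension is bounded because a compact disc contains a representative of every point
  modulo the lattice, and Liouville's theorem applies. This is the device by which identities
  between elliptic functions are proved from their behaviour at \<open>0\<close>.
\<close>
lemma lattice_Liouville:
  assumes hol: "f holomorphic_on - \<Lambda>"
    and per: "\<And>z \<omega>. \<omega> \<in> \<Lambda> \<Longrightarrow> z \<notin> \<Lambda> \<Longrightarrow> f (z + \<omega>) = f z"
    and lim: "(f \<longlongrightarrow> l) (at 0)"
    and z: "z \<notin> \<Lambda>"
  shows "f z = l"
proof -
  define F where "F = (\<lambda>z. if z \<in> \<Lambda> then l else f z)"
  have lim': "(F \<longlongrightarrow> l) (at \<omega>)" if w: "\<omega> \<in> \<Lambda>" for \<omega>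
  proof -
    have ev: "\<forall>\<^sub>F z in at 0. z \<notin> \<Lambda>"
      using complex_lattice_sparse[OF lat] by (auto simp: sparse_in_eventually_iff)
    have "((\<lambda>z. F (z + \<omega>)) \<longlongrightarrow> l) (at 0)"
    proof (rule Lim_transform_eventually[OF lim])
      show "\<forall>\<^sub>F z in at 0. f z = F (z + \<omega>)"
        using ev by eventually_elim (auto simp: F_def per[OF w] complex_lattice_add_iff[OF lat w])
    qed
    thus ?thesis by (intro LIM_offset_zero_cancel[of F \<omega>]) (simp add: add.commute)
  qed
  have holF: "F holomorphic_on - \<Lambda>"
    by (rule holomorphic_transform[OF hol]) (auto simp: F_def)
  have cont: "isCont F x" for x
  proof (cases "x \<in> \<Lambda>")
    case True
    thus ?thesis using lim'[OF True] by (simp add: isCont_def F_def)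
  next
    case False
    thus ?thesis using holF lattice_open_compl
      by (metis ComplI continuous_on_eq_continuous_at holomorphic_on_imp_continuous_on)
  qed
  have entire: "F holomorphic_on UNIV"
  proof -
    have "F field_differentiable at x" for x
    proof -
      have "\<forall>\<^sub>F z in at x. z \<notin> \<Lambda>"
        using complex_lattice_sparse[OF lat] by (simp add: sparse_in_eventually_iff)
      then obtain e where e: "e > 0" "\<And>y. y \<in> ball x e \<Longrightarrow> y \<noteq> x \<Longrightarrow> y \<notin> \<Lambda>"
        unfolding eventually_at by (auto simp: dist_commute)
      have "F holomorphic_on ball x e"
      proof (rule no_isolated_singularity[of _ _ "{x}"])
        show "F holomorphic_on ball x e - {x}"
          by (rule holomorphic_on_subset[OF holF]) (use e in auto)
      qed (auto intro!: continuous_at_imp_continuous_on cont)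
      thus ?thesis using e(1) by (meson centre_in_ball holomorphic_on_imp_differentiable_at open_ball)
    qed
    thus ?thesis by (auto simp: holomorphic_on_def field_differentiable_at_within)
  qed
  obtain R where R: "R > 0" "\<And>z. \<exists>\<omega>\<in>\<Lambda>. dist z \<omega> < R"
    using complex_lattice_covering[OF lat] by blast
  have perF: "F (z + \<omega>) = F z" if "\<omega> \<in> \<Lambda>" for z \<omega>
    using that by (auto simp: F_def per complex_lattice_add_iff[OF lat])
  have "bounded (F ` cball 0 R)"
    by (intro compact_imp_bounded compact_continuous_image continuous_at_imp_continuous_on) (auto intro: cont)
  then obtain B where B: "\<And>z. z \<in> cball 0 R \<Longrightarrow> norm (F z) \<le> B"
    unfolding bounded_iff by blast
  have "norm (F z) \<le> B" for z
  proof -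
    obtain \<omega> where w: "\<omega> \<in> \<Lambda>" "dist z \<omega> < R" using R(2) by blast
    have "F (z - \<omega> + \<omega>) = F (z - \<omega>)" by (rule perF[OF w(1)])
    moreover have "norm (F (z - \<omega>)) \<le> B" using w(2) by (intro B) (auto simp: dist_norm norm_minus_commute)
    ultimately show ?thesis by simp
  qed
  hence "bounded (range F)" by (auto simp: bounded_iff)
  then obtain c where c: "\<And>z. F z = c" using Liouville_theorem[OF entire] by (auto simp: constant_on_def)
  have "F 0 = l" using complex_lattice_zero[OF lat] by (simp add: F_def)
  thus ?thesis using c[of 0] c[of z] z by (simp add: F_def)
qed

end

section \<open>The differential equation of the Weierstrass function\<close>

lemma has_sum_diff':
  fixes f g :: "'a \<Rightarrow> complex"
  assumes "(f has_sum a) A" "(g has_sum b) A"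
  shows "((\<lambda>x. f x - g x) has_sum (a - b)) A"
  using has_sum_add[OF assms(1), of "\<lambda>x. - g x" "- b"] assms(2) by (simp add: has_sum_uminus)

text \<open>
  With \<open>x = (z / \<omega>)\<^sup>2\<close> the symmetrised term is \<open>((1 + x) / (1 - x)\<^sup>2 - 1) / \<omega>\<^sup>2\<close>, and
  \<open>(1 + x) / (1 - x)\<^sup>2 = 1 + 3 x + 5 x\<^sup>2 + x\<^sup>3 (7 - 5 x) / (1 - x)\<^sup>2\<close>. The
  exact remainder makes the estimate uniform over the lattice.
\<close>
lemma wp_regular_part_term_expansion:
  fixes z \<omega> :: complex
  assumes "\<omega> \<noteq> 0" "2 * norm z \<le> norm \<omega>"
  shows "norm ((1 / (z - \<omega>) ^ 2 + 1 / (z + \<omega>) ^ 2) / 2 - 1 / \<omega> ^ 2 - (3 * z ^ 2 * (1 / \<omega> ^ 4) + 5 * z ^ 4 * (1 / \<omega> ^ 6)))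
     \<le> 16 * norm z ^ 6 * (1 / norm \<omega> ^ 8)"
proof -
  define y where "y = z / \<omega>"
  define x where "x = y ^ 2"
  have z: "z = y * \<omega>" using assms by (simp add: y_def)
  have ny: "norm y \<le> 1 / 2" using assms by (simp add: y_def norm_divide field_simps)
  have nx: "norm x \<le> 1 / 4" using power_mono[OF ny, of 2] by (simp add: x_def norm_power power_divide)
  have y1: "y - 1 \<noteq> 0" "y + 1 \<noteq> 0" "1 - x \<noteq> 0"
    using ny nx norm_minus_cancel[of y] by (auto simp: add_eq_0_iff simp del: norm_minus_cancel)
  have e1: "(1 / (z - \<omega>) ^ 2 + 1 / (z + \<omega>) ^ 2) / 2 = (1 / (y - 1) ^ 2 + 1 / (y + 1) ^ 2) / 2 * (1 / \<omega> ^ 2)"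
  proof -
    have "z - \<omega> = (y - 1) * \<omega>" "z + \<omega> = (y + 1) * \<omega>" by (auto simp: z algebra_simps)
    thus ?thesis by (simp add: power_mult_distrib add_divide_distrib mult_ac)
  qed
  have e2: "(1 / (y - 1) ^ 2 + 1 / (y + 1) ^ 2) / 2 = (1 + x) / (1 - x) ^ 2"
  proof -
    have "1 / (y - 1) ^ 2 + 1 / (y + 1) ^ 2 = ((y + 1) ^ 2 + (y - 1) ^ 2) / ((y - 1) ^ 2 * (y + 1) ^ 2)"
      using y1 by (simp add: field_simps)
    also have "(y - 1) ^ 2 * (y + 1) ^ 2 = (1 - x) ^ 2" by (simp add: x_def power2_eq_square algebra_simps)
    also have "(y + 1) ^ 2 + (y - 1) ^ 2 = 2 * (1 + x)" by (simp add: x_def power2_eq_square algebra_simps)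
    finally have *: "1 / (y - 1) ^ 2 + 1 / (y + 1) ^ 2 = 2 * ((1 + x) / (1 - x) ^ 2)" by simp
    show ?thesis unfolding * by (rule nonzero_mult_div_cancel_left) simp
  qed
  have e3: "(1 + x) / (1 - x) ^ 2 - 1 - (3 * x + 5 * x ^ 2) = x ^ 3 * (7 - 5 * x) / (1 - x) ^ 2"
    using y1 by (simp add: divide_simps) (simp add: power2_eq_square power3_eq_cube algebra_simps)
  have "(1 / (z - \<omega>) ^ 2 + 1 / (z + \<omega>) ^ 2) / 2 - 1 / \<omega> ^ 2 - (3 * z ^ 2 * (1 / \<omega> ^ 4) + 5 * z ^ 4 * (1 / \<omega> ^ 6))
     = ((1 + x) / (1 - x) ^ 2 - 1 - (3 * x + 5 * x ^ 2)) * (1 / \<omega> ^ 2)"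
  proof -
    have "3 * z ^ 2 * (1 / \<omega> ^ 4) = 3 * x * (1 / \<omega> ^ 2)" 
      using assms by (simp add: z x_def power_mult_distrib field_simps flip: power_add)
    moreover have "5 * z ^ 4 * (1 / \<omega> ^ 6) = 5 * x ^ 2 * (1 / \<omega> ^ 2)" 
      using assms by (simp add: z x_def power_mult_distrib field_simps flip: power_add power_mult)
    ultimately show ?thesis unfolding e1 e2 by (simp add: algebra_simps)
  qed
  hence "norm ((1 / (z - \<omega>) ^ 2 + 1 / (z + \<omega>) ^ 2) / 2 - 1 / \<omega> ^ 2 - (3 * z ^ 2 * (1 / \<omega> ^ 4) + 5 * z ^ 4 * (1 / \<omega> ^ 6)))
     = norm x ^ 3 * (norm (7 - 5 * x) / norm (1 - x) ^ 2) * (1 / norm \<omega> ^ 2)"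
    unfolding e3 by (simp add: norm_mult norm_divide norm_power)
  also have "\<dots> \<le> norm x ^ 3 * (9 / (3 / 4) ^ 2) * (1 / norm \<omega> ^ 2)"
  proof (intro mult_right_mono mult_left_mono frac_le power_mono)
    show "norm (7 - 5 * x) \<le> 9"
      using norm_triangle_ineq4[of 7 "5 * x"] nx by (simp add: norm_mult)
    show "3 / 4 \<le> norm (1 - x)"
      using norm_triangle_ineq2[of 1 x] nx by simp
  qed auto
  also have "\<dots> = 16 * norm z ^ 6 * (1 / norm \<omega> ^ 8)"
    using assms by (simp add: x_def y_def norm_power norm_divide power_divide flip: power_mult power_add)
  finally show ?thesis .
qed

definition wp_regular_part :: "complex set \<Rightarrow> complex \<Rightarrow> complex" where
  "wp_regular_part \<Lambda> z = (\<Sum>\<^sub>\<infinity>\<omega>\<in>\<Lambda> - {0}. (1 / (z - \<omega>) ^ 2 - 1 / \<omega> ^ 2))"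

context
  fixes \<Lambda> :: "complex set"
  assumes lat: "complex_lattice \<Lambda>"
begin

lemma lattice_summable_inverse_power:
  assumes "k \<ge> 3"
  shows "(\<lambda>\<omega>. 1 / \<omega> ^ k) summable_on (\<Lambda> - {0})"
proof -
  obtain \<delta> where d: "\<delta> > 0" "\<And>\<omega>. \<omega> \<in> \<Lambda> - {0} \<Longrightarrow> \<delta> \<le> norm \<omega>"
    using complex_lattice_min_norm[OF lat] by blast
  have "(\<lambda>\<omega>. 1 / \<delta> ^ (k - 3) * (1 / norm \<omega> ^ 3)) summable_on (\<Lambda> - {0})"
    by (intro summable_on_cmult_right lattice_summable_norm_cube lat)
  hence "(\<lambda>\<omega>. norm (1 / \<omega> ^ k)) summable_on (\<Lambda> - {0})"
  proof (rule Infinite_Sum.abs_summable_on_comparison_test')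
    fix \<omega> assume w: "\<omega> \<in> \<Lambda> - {0}"
    have "norm \<omega> ^ k = norm \<omega> ^ (k - 3) * norm \<omega> ^ 3" using assms by (simp flip: power_add)
    moreover have "\<delta> ^ (k - 3) * norm \<omega> ^ 3 \<le> norm \<omega> ^ (k - 3) * norm \<omega> ^ 3"
      using d w by (intro mult_right_mono power_mono) auto
    ultimately have "1 / norm \<omega> ^ k \<le> 1 / (\<delta> ^ (k - 3) * norm \<omega> ^ 3)"
      using d w by (intro divide_left_mono) auto
    thus "norm (1 / \<omega> ^ k) \<le> 1 / \<delta> ^ (k - 3) * (1 / norm \<omega> ^ 3)"
      by (simp add: norm_divide norm_power)
  qed
  thus ?thesis by (rule abs_summable_summable)
qed

lemma wp_regular_part_eq: "lattice_wp \<Lambda> z = 1 / z ^ 2 + wp_regular_part \<Lambda> z"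
  by (simp add: lattice_wp_def wp_regular_part_def)

text \<open>
  Averaging the series over \<open>\<omega>\<close> and \<open>- \<omega>\<close> removes the odd powers of \<open>z\<close> term by term, which is why the
  expansion at \<open>0\<close> involves only the sums of \<open>1 / \<omega>\<^sup>4\<close> and \<open>1 / \<omega>\<^sup>6\<close>.
\<close>
lemma wp_regular_part_symmetrised:
  "((\<lambda>\<omega>. (1 / (z - \<omega>) ^ 2 + 1 / (z + \<omega>) ^ 2) / 2 - 1 / \<omega> ^ 2) has_sum wp_regular_part \<Lambda> z) (\<Lambda> - {0})"
proof -
  have 1: "((\<lambda>\<omega>. 1 / (z - \<omega>) ^ 2 - 1 / \<omega> ^ 2) has_sum wp_regular_part \<Lambda> z) (\<Lambda> - {0})"
    unfolding wp_regular_part_def by (intro has_sum_infsum abs_summable_summable[OF wp_term_summable[OF lat]])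
  hence "((\<lambda>\<omega>. 1 / (z - (-\<omega>)) ^ 2 - 1 / (-\<omega>) ^ 2) has_sum wp_regular_part \<Lambda> z) (\<Lambda> - {0})"
    by (subst has_sum_reindex_bij_betw[OF lattice_uminus_bij[OF lat]])
  from has_sum_cmult_right[OF has_sum_add[OF 1 this], of "1/2"] show ?thesis
    by (rule has_sum_cong[THEN iffD1, rotated -1] | simp add: add_divide_distrib diff_divide_distrib)+
qed

lemma wp_regular_part_expansion:
  obtains C \<delta> where "\<delta> > 0" "C \<ge> 0" "\<And>z. norm z < \<delta> \<Longrightarrow>
     norm (wp_regular_part \<Lambda> z - (lattice_g2 \<Lambda> / 20 * z ^ 2 + lattice_g3 \<Lambda> / 28 * z ^ 4)) \<le> C * norm z ^ 6"
proof -
  obtain \<delta> where d: "\<delta> > 0" "\<And>\<omega>. \<omega> \<in> \<Lambda> - {0} \<Longrightarrow> \<delta> \<le> norm \<omega>"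
    using complex_lattice_min_norm[OF lat] by blast
  define G where "G k = (\<Sum>\<^sub>\<infinity>\<omega>\<in>\<Lambda> - {0}. 1 / \<omega> ^ k)" for k :: nat
  have G: "((\<lambda>\<omega>. 1 / \<omega> ^ k) has_sum G k) (\<Lambda> - {0})" if "k \<ge> 3" for k
    unfolding G_def by (intro has_sum_infsum lattice_summable_inverse_power that)
  have s8: "(\<lambda>\<omega>. 1 / norm \<omega> ^ 8) summable_on (\<Lambda> - {0})"
    using lattice_summable_inverse_power[of 8] by (simp add: summable_on_iff_abs_summable_on_complex norm_divide norm_power)
  define C where "C = 16 * (\<Sum>\<^sub>\<infinity>\<omega>\<in>\<Lambda> - {0}. 1 / norm \<omega> ^ 8)"
  have "norm (wp_regular_part \<Lambda> z - (lattice_g2 \<Lambda> / 20 * z ^ 2 + lattice_g3 \<Lambda> / 28 * z ^ 4)) \<le> C * norm z ^ 6"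
    if z: "norm z < \<delta> / 2" for z
  proof -
    have "((\<lambda>\<omega>. (1 / (z - \<omega>) ^ 2 + 1 / (z + \<omega>) ^ 2) / 2 - 1 / \<omega> ^ 2 - (3 * z ^ 2 * (1 / \<omega> ^ 4) + 5 * z ^ 4 * (1 / \<omega> ^ 6))) has_sum
       (wp_regular_part \<Lambda> z - (3 * z ^ 2 * G 4 + 5 * z ^ 4 * G 6))) (\<Lambda> - {0})"
      by (intro has_sum_diff' wp_regular_part_symmetrised has_sum_add has_sum_cmult_right G) auto
    moreover have "((\<lambda>\<omega>. 16 * norm z ^ 6 * (1 / norm \<omega> ^ 8)) has_sum 16 * norm z ^ 6 * (\<Sum>\<^sub>\<infinity>\<omega>\<in>\<Lambda> - {0}. 1 / norm \<omega> ^ 8)) (\<Lambda> - {0})"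
      by (intro has_sum_cmult_right has_sum_infsum s8)
    ultimately have "norm (wp_regular_part \<Lambda> z - (3 * z ^ 2 * G 4 + 5 * z ^ 4 * G 6)) \<le> 16 * norm z ^ 6 * (\<Sum>\<^sub>\<infinity>\<omega>\<in>\<Lambda> - {0}. 1 / norm \<omega> ^ 8)"
    proof (rule norm_infsum_le)
      fix \<omega> assume w: "\<omega> \<in> \<Lambda> - {0}"
      show "norm ((1 / (z - \<omega>) ^ 2 + 1 / (z + \<omega>) ^ 2) / 2 - 1 / \<omega> ^ 2 - (3 * z ^ 2 * (1 / \<omega> ^ 4) + 5 * z ^ 4 * (1 / \<omega> ^ 6)))
          \<le> 16 * norm z ^ 6 * (1 / norm \<omega> ^ 8)"
        using d(2)[OF w] z w by (intro wp_regular_part_term_expansion) auto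
    qed
    moreover have "lattice_g2 \<Lambda> = 60 * G 4" "lattice_g3 \<Lambda> = 140 * G 6" by (simp_all add: lattice_g2_def lattice_g3_def G_def)
    ultimately show ?thesis by (simp add: C_def mult_ac)
  qed
  moreover have "C \<ge> 0" unfolding C_def by (intro mult_nonneg_nonneg infsum_nonneg) auto
  ultimately show ?thesis using d(1) by (intro that[of "\<delta> / 2"]) auto
qed

text \<open>
  The difference \<open>N\<close> of the two sides is elliptic, so it suffices that \<open>N\<close> tends to \<open>0\<close> at \<open>0\<close>. There
  \<open>\<wp>(z) = 1/z\<^sup>2 + \<alpha> z\<^sup>2 + \<beta> z\<^sup>4 + \<rho>(z)\<close> with \<open>\<rho>(z) = O(z\<^sup>6)\<close>, where
  \<open>g2 = 20 \<alpha>\<close> and \<open>g3 = 28 \<beta>\<close>, and substituting cancels all negative powers and the constant term.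
\<close>
lemma wp_differential_equation:
  assumes z: "z \<notin> \<Lambda>"
  shows "deriv (lattice_wp \<Lambda>) z ^ 2 = 4 * lattice_wp \<Lambda> z ^ 3 - lattice_g2 \<Lambda> * lattice_wp \<Lambda> z - lattice_g3 \<Lambda>"
proof -
  define \<alpha> where "\<alpha> = lattice_g2 \<Lambda> / 20"
  define \<beta> where "\<beta> = lattice_g3 \<Lambda> / 28"
  define N where "N = (\<lambda>z. deriv (lattice_wp \<Lambda>) z ^ 2 - 4 * lattice_wp \<Lambda> z ^ 3 + lattice_g2 \<Lambda> * lattice_wp \<Lambda> z + lattice_g3 \<Lambda>)"
  define \<rho> where "\<rho> = (\<lambda>z. lattice_wp \<Lambda> z - 1 / z ^ 2 - (\<alpha> * z ^ 2 + \<beta> * z ^ 4))"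
  obtain C \<delta>1 where C: "\<delta>1 > 0" "C \<ge> 0" "\<And>z. norm z < \<delta>1 \<Longrightarrow> norm (\<rho> z) \<le> C * norm z ^ 6"
    using wp_regular_part_expansion unfolding \<rho>_def \<alpha>_def \<beta>_def wp_regular_part_eq by (metis add_diff_cancel_left')
  obtain \<delta>2 where d2: "\<delta>2 > 0" "\<And>\<omega>. \<omega> \<in> \<Lambda> - {0} \<Longrightarrow> \<delta>2 \<le> norm \<omega>"
    using complex_lattice_min_norm[OF lat] by blast
  define \<delta> where "\<delta> = min \<delta>1 \<delta>2"
  have \<delta>: "\<delta> > 0" "\<delta> \<le> \<delta>1" "\<delta> \<le> \<delta>2" using C d2 by (auto simp: \<delta>_def)
  have notin: "z \<notin> \<Lambda>" if "norm z < \<delta>" "z \<noteq> 0" for z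
    using d2(2)[of z] that \<delta> by force
  have d\<rho>: "(\<rho> has_field_derivative (deriv (lattice_wp \<Lambda>) z - (- 2 / z ^ 3) - (2 * \<alpha> * z + 4 * \<beta> * z ^ 3))) (at z)"
    if "norm z < \<delta>" "z \<noteq> 0" for z
  proof -
    have "((\<lambda>z. 1 / z ^ 2) has_field_derivative (- 2 / z ^ 3)) (at z)"
      using wp_term_derivative[of z 0] that by simp
    moreover have "((\<lambda>z. \<alpha> * z ^ 2 + \<beta> * z ^ 4) has_field_derivative (2 * \<alpha> * z + 4 * \<beta> * z ^ 3)) (at z)"
      by (auto intro!: derivative_eq_intros)
    ultimately show ?thesis
      unfolding \<rho>_def by (intro DERIV_diff wp_has_deriv[OF lat notin[OF that]])
  qed
  \<comment> \<open>Cauchy's estimate on the disc of radius \<open>norm z / 2\<close> around \<open>z\<close>, on which \<open>norm w \<le> 3/2 * norm z\<close>\<close>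
  have bound': "norm (deriv \<rho> z) \<le> 24 * C * norm z ^ 5" if z: "norm z < \<delta> / 2" "z \<noteq> 0" for z
  proof -
    have sub: "norm w < \<delta> \<and> w \<noteq> 0 \<and> norm w \<le> 3/2 * norm z" if "w \<in> cball z (norm z / 2)" for w
    proof -
      have "norm (z - w) \<le> norm z / 2" using that by (simp add: dist_norm)
      moreover have "norm w \<le> norm z + norm (z - w)" using norm_triangle_ineq4[of z "z - w"] by simp
      moreover have "norm z \<le> norm (z - w) + norm w" using norm_triangle_ineq[of "z - w" w] by simp
      ultimately show ?thesis using z by auto
    qed
    have hol: "\<rho> field_differentiable at w" if "w \<in> cball z (norm z / 2)" for w
      using d\<rho>[of w] sub[OF that] unfolding field_differentiable_def by blast
    have "norm ((deriv ^^ 1) \<rho> z) \<le> fact 1 * (C * (3/2 * norm z) ^ 6) / (norm z / 2) ^ 1"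
    proof (rule Cauchy_inequality)
      show "\<rho> holomorphic_on ball z (norm z / 2)"
        unfolding holomorphic_on_def using hol field_differentiable_at_within ball_subset_cball by blast
      show "continuous_on (cball z (norm z / 2)) \<rho>"
        by (intro continuous_at_imp_continuous_on ballI field_differentiable_imp_continuous_at hol)
      fix w assume w: "norm (z - w) = norm z / 2"
      hence s: "norm w < \<delta>" "norm w \<le> 3/2 * norm z" using sub[of w] by (auto simp: dist_norm)
      have "norm (\<rho> w) \<le> C * norm w ^ 6" using s \<delta> by (intro C(3)) auto
      also have "\<dots> \<le> C * (3/2 * norm z) ^ 6" using s C by (intro mult_left_mono power_mono) auto
      finally show "norm (\<rho> w) \<le> C * (3/2 * norm z) ^ 6" .
    qed (use z in auto)
    also have "\<dots> = 2 * (3/2) ^ 6 * C * (norm z ^ 6 / norm z)"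
      by (simp add: power_mult_distrib power_divide)
    also have "norm z ^ 6 / norm z = norm z ^ 5" using z power_Suc2[of "norm z" 5] by simp
    also have "2 * (3/2) ^ 6 * C * norm z ^ 5 \<le> 24 * C * norm z ^ 5"
    proof (rule mult_right_mono)
      have "2 * (3/2) ^ 6 \<le> (24::real)" by (simp add: power_divide)
      thus "2 * (3/2) ^ 6 * C \<le> 24 * C" using C(2) by (rule mult_right_mono)
    qed auto
    finally show ?thesis by simp
  qed
  \<comment> \<open>one power of \<open>z\<close> less than the order of vanishing, so that both quotients tend to \<open>0\<close>\<close>
  define A where "A = (\<lambda>z. \<rho> z / z ^ 5)"
  define B where "B = (\<lambda>z. deriv \<rho> z / z ^ 4)"
  have ev: "\<forall>\<^sub>F z in at (0::complex). norm z < \<delta> / 2 \<and> z \<noteq> 0"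
    using \<delta>(1) unfolding eventually_at by (intro exI[of _ "\<delta> / 2"]) auto
  have limA: "(A \<longlongrightarrow> 0) (at 0)"
  proof (rule Lim_null_comparison)
    show "((\<lambda>z::complex. C * norm z) \<longlongrightarrow> 0) (at 0)" by (auto intro!: tendsto_eq_intros)
    show "\<forall>\<^sub>F z in at 0. norm (A z) \<le> C * norm z"
      using ev
    proof eventually_elim
      case (elim z)
      have "norm (\<rho> z) \<le> C * norm z ^ 6" using elim \<delta> by (intro C(3)) auto
      hence "norm (A z) \<le> C * norm z ^ 6 / norm z ^ 5"
        by (simp add: A_def norm_divide norm_power divide_right_mono)
      also have "\<dots> = C * norm z" using elim power_Suc2[of "norm z" 5] by simp
      finally show ?case .
    qed
  qed
  have limB: "(B \<longlongrightarrow> 0) (at 0)"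
  proof (rule Lim_null_comparison)
    show "((\<lambda>z::complex. 24 * C * norm z) \<longlongrightarrow> 0) (at 0)" by (auto intro!: tendsto_eq_intros)
    show "\<forall>\<^sub>F z in at 0. norm (B z) \<le> 24 * C * norm z"
      using ev
    proof eventually_elim
      case (elim z)
      have "norm (B z) \<le> 24 * C * norm z ^ 5 / norm z ^ 4"
        using bound'[of z] elim by (simp add: B_def norm_divide norm_power divide_right_mono)
      also have "\<dots> = 24 * C * norm z" using elim power_Suc2[of "norm z" 4] by simp
      finally show ?case .
    qed
  qed
  have "(N \<longlongrightarrow> 0) (at 0)"
  proof (rule Lim_transform_eventually)
    define q where "q = (\<lambda>z. \<alpha> + \<beta> * z ^ 2 + z ^ 3 * A z)"
    define p where "p = (\<lambda>z. 2 * \<alpha> + 4 * \<beta> * z ^ 2 + z ^ 3 * B z)"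
    have q: "(q \<longlongrightarrow> \<alpha>) (at 0)" unfolding q_def by (rule tendsto_eq_intros limA refl | simp)+
    have p: "(p \<longlongrightarrow> 2 * \<alpha>) (at 0)" unfolding p_def by (rule tendsto_eq_intros limB refl | simp)+
    show "((\<lambda>z. z * (- 4 * B z + z * p z ^ 2 - 12 * A z - 12 * z * q z ^ 2 - 4 * z ^ 5 * q z ^ 3 + 20 * \<alpha> * z * q z)) \<longlongrightarrow> 0) (at 0)"
      by (rule tendsto_eq_intros limA limB p q refl | simp)+
    show "\<forall>\<^sub>F z in at 0. z * (- 4 * B z + z * p z ^ 2 - 12 * A z - 12 * z * q z ^ 2 - 4 * z ^ 5 * q z ^ 3 + 20 * \<alpha> * z * q z) = N z"
      using ev
    proof eventually_elim
      case (elim z)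
      hence z: "norm z < \<delta>" "z \<noteq> 0" using \<delta> by auto
      define i where "i = 1 / z"
      have i: "z * i = 1" using z by (simp add: i_def)
      have "\<rho> z = z ^ 5 * A z" using z by (simp add: A_def)
      hence P: "lattice_wp \<Lambda> z = i ^ 2 + (\<alpha> * z ^ 2 + \<beta> * z ^ 4 + z ^ 5 * A z)"
        by (simp add: \<rho>_def i_def power_divide algebra_simps)
      have "deriv \<rho> z = z ^ 4 * B z" using z by (simp add: B_def)
      hence P': "deriv (lattice_wp \<Lambda>) z = - 2 * i ^ 3 + (2 * \<alpha> * z + 4 * \<beta> * z ^ 3 + z ^ 4 * B z)"
        using DERIV_imp_deriv[OF d\<rho>[OF z]] by (simp add: i_def power_divide algebra_simps)
      have g: "lattice_g2 \<Lambda> = 20 * \<alpha>" "lattice_g3 \<Lambda> = 28 * \<beta>" by (auto simp: \<alpha>_def \<beta>_def)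
      show ?case
        unfolding N_def P P' g p_def q_def using i by algebra
    qed
  qed
  moreover have "N holomorphic_on - \<Lambda>"
    unfolding N_def by (intro holomorphic_intros wp_holomorphic[OF lat] deriv_wp_holomorphic[OF lat])
  moreover have "N (z + \<omega>) = N z" if "\<omega> \<in> \<Lambda>" "z \<notin> \<Lambda>" for z \<omega>
    using that by (simp add: N_def wp_periodic[OF lat] deriv_wp_periodic[OF lat])
  ultimately have "N z = 0"
    using lattice_Liouville[OF lat, of N 0 z] z by blast
  thus ?thesis by (simp add: N_def algebra_simps)
qed

lemma wp_tends_to_infinity_at_0: "filterlim (lattice_wp \<Lambda>) at_infinity (at 0)"
proof -
  obtain C \<delta> where C: "\<delta> > 0" "C \<ge> 0" "\<And>z. norm z < \<delta> \<Longrightarrow>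
     norm (wp_regular_part \<Lambda> z - (lattice_g2 \<Lambda> / 20 * z ^ 2 + lattice_g3 \<Lambda> / 28 * z ^ 4)) \<le> C * norm z ^ 6"
    using wp_regular_part_expansion by blast
  have "((\<lambda>z. wp_regular_part \<Lambda> z - (lattice_g2 \<Lambda> / 20 * z ^ 2 + lattice_g3 \<Lambda> / 28 * z ^ 4)) \<longlongrightarrow> 0) (at 0)"
  proof (rule Lim_null_comparison)
    show "((\<lambda>z::complex. C * norm z ^ 6) \<longlongrightarrow> 0) (at 0)" by (auto intro!: tendsto_eq_intros)
    show "\<forall>\<^sub>F z in at 0. norm (wp_regular_part \<Lambda> z - (lattice_g2 \<Lambda> / 20 * z ^ 2 + lattice_g3 \<Lambda> / 28 * z ^ 4)) \<le> C * norm z ^ 6"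
      using C unfolding eventually_at by (intro exI[of _ \<delta>]) auto
  qed
  moreover have "((\<lambda>z. lattice_g2 \<Lambda> / 20 * z ^ 2 + lattice_g3 \<Lambda> / 28 * z ^ 4) \<longlongrightarrow> 0) (at 0)"
    by (rule tendsto_eq_intros refl | simp)+
  ultimately have "((\<lambda>z. (wp_regular_part \<Lambda> z - (lattice_g2 \<Lambda> / 20 * z ^ 2 + lattice_g3 \<Lambda> / 28 * z ^ 4)) + 
      (lattice_g2 \<Lambda> / 20 * z ^ 2 + lattice_g3 \<Lambda> / 28 * z ^ 4)) \<longlongrightarrow> 0 + 0) (at 0)"
    by (rule tendsto_add)
  hence r: "(wp_regular_part \<Lambda> \<longlongrightarrow> 0) (at 0)" by simp
  have "filterlim (\<lambda>z::complex. 1 / z ^ 2) at_infinity (at 0)"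
    by (rule filterlim_divide_at_infinity[OF tendsto_const]) (auto intro!: tendsto_eq_intros filterlim_atI simp: eventually_at_filter)
  hence "filterlim (\<lambda>z. wp_regular_part \<Lambda> z + 1 / z ^ 2) at_infinity (at 0)"
    by (rule tendsto_add_filterlim_at_infinity[OF r])
  thus ?thesis unfolding wp_regular_part_eq[abs_def] by (simp add: add.commute)
qed

text \<open>
  Otherwise \<open>1 / (\<wp> - a)\<close> would be elliptic, holomorphic off the lattice, and tend to \<open>0\<close> at \<open>0\<close>, hence
  vanish identically.
\<close>
lemma wp_surj: "\<exists>z. z \<notin> \<Lambda> \<and> lattice_wp \<Lambda> z = a"
proof (rule ccontr)
  assume "\<not> ?thesis"
  hence nz: "lattice_wp \<Lambda> z - a \<noteq> 0" if "z \<notin> \<Lambda>" for z using that by auto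
  define f where "f = (\<lambda>z. 1 / (lattice_wp \<Lambda> z - a))"
  have "f holomorphic_on - \<Lambda>"
    unfolding f_def by (intro holomorphic_intros wp_holomorphic[OF lat]) (use nz in auto)
  moreover have "(f \<longlongrightarrow> 0) (at 0)"
  proof -
    have "filterlim (\<lambda>z. - a + lattice_wp \<Lambda> z) at_infinity (at 0)"
      by (rule tendsto_add_filterlim_at_infinity[OF tendsto_const wp_tends_to_infinity_at_0])
    hence "filterlim (\<lambda>z. lattice_wp \<Lambda> z - a) at_infinity (at 0)" by simp
    thus ?thesis unfolding f_def by (intro tendsto_divide_0[OF tendsto_const])
  qed
  moreover have "f (z + \<omega>) = f z" if "\<omega> \<in> \<Lambda>" "z \<notin> \<Lambda>" for z \<omega>
    using that by (simp add: f_def wp_periodic[OF lat])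
  ultimately have f0: "f z = 0" if "z \<notin> \<Lambda>" for z
    using lattice_Liouville[OF lat, of f 0 z] that by blast
  have "\<forall>\<^sub>F z in at 0. z \<notin> \<Lambda>"
    using complex_lattice_sparse[OF lat] by (simp add: sparse_in_eventually_iff)
  then obtain z where "z \<notin> \<Lambda>"
    using eventually_happens'[OF at_neq_bot] by blast
  thus False using f0[of z] nz[of z] by (simp add: f_def)
qed

text \<open>
  Every finite point of the curve \<open>Y\<^sup>2 = 4 X\<^sup>3 - g2 X - g3\<close> is \<open>(\<wp>(z), \<wp>'(z))\<close>: choose \<open>z\<close> with
  \<open>\<wp>(z) = X\<close> and replace it by \<open>- z\<close> if \<open>\<wp>'\<close> has the wrong sign.
\<close>
lemma wp_surj_pair:
  assumes "Y ^ 2 = 4 * X ^ 3 - lattice_g2 \<Lambda> * X - lattice_g3 \<Lambda>"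
  obtains z where "z \<notin> \<Lambda>" "lattice_wp \<Lambda> z = X" "deriv (lattice_wp \<Lambda>) z = Y"
proof -
  obtain z where z: "z \<notin> \<Lambda>" "lattice_wp \<Lambda> z = X" using wp_surj by blast
  have "deriv (lattice_wp \<Lambda>) z ^ 2 = Y ^ 2" using wp_differential_equation[OF z(1)] z(2) assms by simp
  hence "deriv (lattice_wp \<Lambda>) z = Y \<or> deriv (lattice_wp \<Lambda>) z = - Y" by (simp add: power2_eq_iff)
  thus ?thesis
  proof
    assume "deriv (lattice_wp \<Lambda>) z = - Y"
    thus ?thesis using z complex_lattice_uminus_iff[OF lat]
      by (intro that[of "- z"]) (auto simp: wp_even[OF lat] deriv_wp_odd[OF lat])
  qed (use that z in auto)
qed

end

section \<open>Uniqueness for the equation and equianharmonic lattices\<close>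

text \<open>
  A homogeneous linear system propagates zero initial values: by Leibniz' rule all derivatives of \<open>f\<close> and
  \<open>g\<close> at \<open>z0\<close> vanish inductively, and the identity theorem does the rest.
\<close>
lemma linear_system_unique:
  fixes f g a b :: "complex \<Rightarrow> complex"
  assumes "open S" "connected S" "z0 \<in> S" "z \<in> S"
    and hol: "f holomorphic_on S" "g holomorphic_on S" "a holomorphic_on S" "b holomorphic_on S"
    and f': "\<And>z. z \<in> S \<Longrightarrow> deriv f z = a z * g z"
    and g': "\<And>z. z \<in> S \<Longrightarrow> deriv g z = b z * f z"
    and init: "f z0 = 0" "g z0 = 0"
  shows "f z = 0 \<and> g z = 0"
proof -
  have step: "(deriv ^^ Suc n) p z0 = 0"
    if "\<And>z. z \<in> S \<Longrightarrow> deriv p z = c z * q z" "c holomorphic_on S" "q holomorphic_on S"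
       "\<And>i. i \<le> n \<Longrightarrow> (deriv ^^ i) q z0 = 0" for n p q c
  proof -
    have "(deriv ^^ Suc n) p z0 = (deriv ^^ n) (deriv p) z0" by (simp only: funpow_Suc_right o_def)
    also have "\<dots> = (deriv ^^ n) (\<lambda>z. c z * q z) z0"
    proof (rule higher_deriv_cong_ev)
      show "\<forall>\<^sub>F z in nhds z0. deriv p z = c z * q z"
        using eventually_nhds_in_open[OF assms(1,3)] by eventually_elim (rule that(1))
    qed auto
    also have "\<dots> = (\<Sum>i = 0..n. of_nat (n choose i) * (deriv ^^ i) c z0 * (deriv ^^ (n - i)) q z0)"
      by (rule higher_deriv_mult[OF that(2,3) assms(1,3)])
    also have "\<dots> = 0" by (intro sum.neutral ballI) (simp add: that(4))
    finally show ?thesis .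
  qed
  have van: "\<forall>i\<le>n. (deriv ^^ i) f z0 = 0 \<and> (deriv ^^ i) g z0 = 0" for n
  proof (induction n)
    case 0
    thus ?case using init by simp
  next
    case (Suc n)
    have "(deriv ^^ Suc n) f z0 = 0" by (rule step[OF f' hol(3,2)]) (use Suc in auto)
    moreover have "(deriv ^^ Suc n) g z0 = 0" by (rule step[OF g' hol(4,1)]) (use Suc in auto)
    ultimately show ?case using Suc by (metis le_Suc_eq)
  qed
  have "f z = 0"
    by (rule holomorphic_fun_eq_0_on_connected[OF hol(1) assms(1,2) _ assms(3,4)]) (use van in blast)
  moreover have "g z = 0"
    by (rule holomorphic_fun_eq_0_on_connected[OF hol(2) assms(1,2) _ assms(3,4)]) (use van in blast)
  ultimately show ?thesis by blast
qed

text \<open>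
  Differentiating \<open>\<wp>'\<^sup>2 = 4 \<wp>\<^sup>3 - g2 \<wp> - g3\<close> gives the claim multiplied by \<open>\<wp>'\<close>. The factor can be
  cancelled because a product of two holomorphic functions vanishes identically on a connected set only
  if one of the factors does, and \<open>\<wp>\<close> is not constant.
\<close>
lemma wp_second_derivative:
  assumes lat: "complex_lattice \<Lambda>" and z: "z \<notin> \<Lambda>"
  shows "(deriv (lattice_wp \<Lambda>) has_field_derivative 6 * lattice_wp \<Lambda> z ^ 2 - lattice_g2 \<Lambda> / 2) (at z)"
proof -
  let ?p = "lattice_wp \<Lambda>"
  note op = lattice_open_compl[OF lat]
  define h where "h = (\<lambda>z. 2 * deriv (deriv ?p) z - 12 * ?p z ^ 2 + lattice_g2 \<Lambda>)"
  have dd: "(deriv ?p has_field_derivative deriv (deriv ?p) w) (at w)" if "w \<notin> \<Lambda>" for w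
    by (rule holomorphic_derivI[OF deriv_wp_holomorphic[OF lat] op]) (use that in auto)
  have prod: "deriv ?p w * h w = 0" if w: "w \<notin> \<Lambda>" for w
  proof -
    have "((\<lambda>z. deriv ?p z ^ 2 - (4 * ?p z ^ 3 - lattice_g2 \<Lambda> * ?p z - lattice_g3 \<Lambda>)) has_field_derivative
        (2 * deriv ?p w * deriv (deriv ?p) w - (12 * ?p w ^ 2 * deriv ?p w - lattice_g2 \<Lambda> * deriv ?p w))) (at w)"
      using dd[OF w] wp_has_deriv[OF lat w] by (auto intro!: derivative_eq_intros)
    moreover have "((\<lambda>z. deriv ?p z ^ 2 - (4 * ?p z ^ 3 - lattice_g2 \<Lambda> * ?p z - lattice_g3 \<Lambda>)) has_field_derivative 0) (at w)"
      by (rule has_field_derivative_transform_within_open[OF DERIV_const op])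
         (use w in \<open>auto simp: wp_differential_equation[OF lat]\<close>)
    ultimately have "2 * deriv ?p w * deriv (deriv ?p) w - (12 * ?p w ^ 2 * deriv ?p w - lattice_g2 \<Lambda> * deriv ?p w) = 0"
      by (rule DERIV_unique)
    thus ?thesis by (simp add: h_def algebra_simps)
  qed
  have holh: "h holomorphic_on - \<Lambda>"
    unfolding h_def by (intro holomorphic_intros wp_holomorphic[OF lat] deriv_wp_holomorphic[OF lat] op)
  have "h z = 0"
  proof (rule ccontr)
    assume "h z \<noteq> 0"
    define U where "U = {w \<in> - \<Lambda>. h w \<noteq> 0}"
    have "open U"
    proof -
      have "open (- \<Lambda> \<inter> h -` (- {0}))"
        by (rule continuous_open_preimage[OF holomorphic_on_imp_continuous_on[OF holh] op]) auto
      moreover have "- \<Lambda> \<inter> h -` (- {0}) = U" by (auto simp: U_def)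
      ultimately show ?thesis by simp
    qed
    have "deriv ?p w = 0" if "w \<in> - \<Lambda>" for w
      by (rule analytic_continuation_open[OF \<open>open U\<close> op _ lattice_compl_connected[OF lat] _ deriv_wp_holomorphic[OF lat] holomorphic_on_const _ that])
         (use \<open>h z \<noteq> 0\<close> z prod in \<open>auto simp: U_def\<close>)
    hence "?p constant_on - \<Lambda>"
      using wp_has_deriv[OF lat]
      by (intro has_field_derivative_0_imp_constant_on op lattice_compl_connected lat) (metis ComplD)
    moreover obtain z0 z1 where "z0 \<notin> \<Lambda>" "?p z0 = 0" "z1 \<notin> \<Lambda>" "?p z1 = 1"
      using wp_surj[OF lat] by metis
    ultimately show False by (metis ComplI constant_on_def zero_neq_one)
  qed
  hence "deriv (deriv ?p) z = 6 * ?p z ^ 2 - lattice_g2 \<Lambda> / 2" by (simp add: h_def field_simps)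
  thus ?thesis using dd[OF z] by simp
qed

text \<open>
  If both invariants vanished, then \<open>\<wp>' = 0\<close> at a zero of \<open>\<wp>\<close>, and the linear system
  \<open>\<wp>' = 1 \<cdot> \<wp>'\<close>, \<open>\<wp>'' = (6 \<wp>) \<cdot> \<wp>\<close> would force \<open>\<wp>\<close> to vanish identically.
\<close>
lemma lattice_invariants_nonzero:
  assumes lat: "complex_lattice \<Lambda>"
  shows "\<not> (lattice_g2 \<Lambda> = 0 \<and> lattice_g3 \<Lambda> = 0)"
proof
  assume g: "lattice_g2 \<Lambda> = 0 \<and> lattice_g3 \<Lambda> = 0"
  obtain z0 where z0: "z0 \<notin> \<Lambda>" "lattice_wp \<Lambda> z0 = 0" "deriv (lattice_wp \<Lambda>) z0 = 0"
    by (rule wp_surj_pair[OF lat, of 0 0]) (use g in auto)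
  obtain z1 where z1: "z1 \<notin> \<Lambda>" "lattice_wp \<Lambda> z1 = 1" using wp_surj[OF lat] by metis
  have "lattice_wp \<Lambda> z1 = 0 \<and> deriv (lattice_wp \<Lambda>) z1 = 0"
  proof (rule linear_system_unique[OF lattice_open_compl[OF lat] lattice_compl_connected[OF lat], of z0 z1
           _ _ "\<lambda>_. 1" "\<lambda>z. 6 * lattice_wp \<Lambda> z"])
    show "deriv (deriv (lattice_wp \<Lambda>)) z = 6 * lattice_wp \<Lambda> z * lattice_wp \<Lambda> z" if "z \<in> - \<Lambda>" for z
      using DERIV_imp_deriv[OF wp_second_derivative[OF lat, of z]] that g by (simp add: power2_eq_square)
  qed (use z0 z1 in \<open>auto intro!: holomorphic_intros wp_holomorphic[OF lat] deriv_wp_holomorphic[OF lat]\<close>)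
  thus False using z1 by simp
qed

lemma lattice_scale:
  assumes lat: "complex_lattice \<Lambda>" and \<mu>: "\<mu> \<noteq> 0"
  shows "complex_lattice ((*) \<mu> ` \<Lambda>)" "lattice_g2 ((*) \<mu> ` \<Lambda>) = lattice_g2 \<Lambda> / \<mu> ^ 4"
    "lattice_g3 ((*) \<mu> ` \<Lambda>) = lattice_g3 \<Lambda> / \<mu> ^ 6"
proof -
  obtain \<omega>1 \<omega>2 where w: "\<omega>2 / \<omega>1 \<notin> \<real>" "\<Lambda> = {of_int m * \<omega>1 + of_int n * \<omega>2 | m n. True}"
    using lat unfolding complex_lattice_def by auto
  have "(*) \<mu> ` \<Lambda> = {of_int m * (\<mu> * \<omega>1) + of_int n * (\<mu> * \<omega>2) | m n. True}"
  proof (intro equalityI subsetI)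
    fix x assume "x \<in> (*) \<mu> ` \<Lambda>"
    then obtain m n where "x = \<mu> * (of_int m * \<omega>1 + of_int n * \<omega>2)" unfolding w(2) by blast
    hence "x = of_int m * (\<mu> * \<omega>1) + of_int n * (\<mu> * \<omega>2)" by (simp add: algebra_simps)
    thus "x \<in> {of_int m * (\<mu> * \<omega>1) + of_int n * (\<mu> * \<omega>2) | m n. True}" by blast
  next
    fix x assume "x \<in> {of_int m * (\<mu> * \<omega>1) + of_int n * (\<mu> * \<omega>2) | m n. True}"
    then obtain m n where "x = \<mu> * (of_int m * \<omega>1 + of_int n * \<omega>2)" by (auto simp: algebra_simps)
    thus "x \<in> (*) \<mu> ` \<Lambda>" unfolding w(2) by blast
  qed
  moreover have "(\<mu> * \<omega>2) / (\<mu> * \<omega>1) \<notin> \<real>" using w(1) \<mu> by simp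
  ultimately show "complex_lattice ((*) \<mu> ` \<Lambda>)" unfolding complex_lattice_def by blast
  have im: "(*) \<mu> ` \<Lambda> - {0} = (*) \<mu> ` (\<Lambda> - {0})" using \<mu> by auto
  have G: "(\<Sum>\<^sub>\<infinity>\<omega>\<in>(*) \<mu> ` \<Lambda> - {0}. 1 / \<omega> ^ k) = (\<Sum>\<^sub>\<infinity>\<omega>\<in>\<Lambda> - {0}. 1 / \<omega> ^ k) / \<mu> ^ k" for k :: nat
  proof -
    have "(\<Sum>\<^sub>\<infinity>\<omega>\<in>(*) \<mu> ` \<Lambda> - {0}. 1 / \<omega> ^ k) = (\<Sum>\<^sub>\<infinity>\<omega>\<in>\<Lambda> - {0}. 1 / \<mu> ^ k * (1 / \<omega> ^ k))"
      unfolding im by (subst infsum_reindex) (auto simp: inj_on_def \<mu> o_def power_mult_distrib)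
    also have "\<dots> = 1 / \<mu> ^ k * (\<Sum>\<^sub>\<infinity>\<omega>\<in>\<Lambda> - {0}. 1 / \<omega> ^ k)" by (rule infsum_cmult_right')
    finally show ?thesis by simp
  qed
  show "lattice_g2 ((*) \<mu> ` \<Lambda>) = lattice_g2 \<Lambda> / \<mu> ^ 4" "lattice_g3 ((*) \<mu> ` \<Lambda>) = lattice_g3 \<Lambda> / \<mu> ^ 6"
    by (simp_all add: lattice_g2_def lattice_g3_def G)
qed

text \<open>
  The lattice of Eisenstein integers is invariant under multiplication by the primitive cube root of unity \<open>\<rho>\<close>,
  whereas this substitution multiplies the sum of \<open>1 / \<omega>\<^sup>4\<close> by \<open>1 / \<rho> \<noteq> 1\<close>.
\<close>
lemma hexagonal_lattice: "\<exists>\<Lambda>. complex_lattice \<Lambda> \<and> lattice_g2 \<Lambda> = 0"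
proof -
  define \<rho> where "\<rho> = Complex (-1/2) (sqrt 3 / 2)"
  have r2: "\<rho> ^ 2 = - 1 - \<rho>"
    by (simp add: \<rho>_def power2_eq_square complex_eq_iff)
  have r3: "\<rho> ^ 3 = 1"
    using r2 by algebra
  have \<rho>0: "\<rho> \<noteq> 0" "\<rho> \<noteq> 1" using r3 by (auto simp: \<rho>_def complex_eq_iff)
  define \<Lambda> where "\<Lambda> = {of_int m * 1 + of_int n * \<rho> | m n. True}"
  have "\<rho> / 1 \<notin> \<real>" by (simp add: \<rho>_def complex_is_Real_iff)
  hence lat: "complex_lattice \<Lambda>" unfolding complex_lattice_def \<Lambda>_def by blast
  have mul: "\<rho> * x \<in> \<Lambda>" if x: "x \<in> \<Lambda>" for x
  proof -
    obtain m n where "x = of_int m * 1 + of_int n * \<rho>" using x unfolding \<Lambda>_def by blast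
    hence "\<rho> * x = of_int m * \<rho> + of_int n * \<rho> ^ 2" by (simp add: algebra_simps power2_eq_square)
    also have "\<dots> = of_int (- n) * 1 + of_int (m - n) * \<rho>" unfolding r2 by (simp add: algebra_simps)
    finally show ?thesis unfolding \<Lambda>_def by blast
  qed
  have "bij_betw ((*) \<rho>) (\<Lambda> - {0}) (\<Lambda> - {0})"
  proof (rule bij_betwI[of _ _ _ "\<lambda>x. \<rho> * (\<rho> * x)"])
    show "\<rho> * (\<rho> * (\<rho> * x)) = x" "\<rho> * (\<rho> * (\<rho> * x)) = x" for x
      using r3 by (simp_all add: power3_eq_cube mult.assoc [symmetric])
  qed (use \<rho>0 mul in auto)
  hence "(\<Sum>\<^sub>\<infinity>\<omega>\<in>\<Lambda> - {0}. 1 / (\<rho> * \<omega>) ^ 4) = (\<Sum>\<^sub>\<infinity>\<omega>\<in>\<Lambda> - {0}. 1 / \<omega> ^ 4)"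
    by (rule infsum_reindex_bij_betw)
  moreover have "1 / (\<rho> * \<omega>) ^ 4 = 1 / \<rho> * (1 / \<omega> ^ 4)" for \<omega>
  proof -
    have "\<rho> ^ 4 = \<rho> ^ 3 * \<rho>" by (simp add: eval_nat_numeral)
    thus ?thesis by (simp add: power_mult_distrib r3)
  qed
  ultimately have "(\<Sum>\<^sub>\<infinity>\<omega>\<in>\<Lambda> - {0}. 1 / \<omega> ^ 4) = (\<Sum>\<^sub>\<infinity>\<omega>\<in>\<Lambda> - {0}. 1 / \<rho> * (1 / \<omega> ^ 4))" by simp
  also have "\<dots> = 1 / \<rho> * (\<Sum>\<^sub>\<infinity>\<omega>\<in>\<Lambda> - {0}. 1 / \<omega> ^ 4)" by (rule infsum_cmult_right')
  finally have "(1 - 1 / \<rho>) * (\<Sum>\<^sub>\<infinity>\<omega>\<in>\<Lambda> - {0}. 1 / \<omega> ^ 4) = 0" unfolding left_diff_distrib by simp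
  hence "(\<Sum>\<^sub>\<infinity>\<omega>\<in>\<Lambda> - {0}. 1 / \<omega> ^ 4) = 0" using \<rho>0 by simp
  thus ?thesis using lat by (auto simp: lattice_g2_def)
qed

text \<open>
  Scaling the hexagonal lattice realises every nonzero \<open>g3\<close>. So the choice in the definition of
  \<open>weierstrass_wp\<close> is not vacuous, and everything below holds for whichever lattice is chosen.
\<close>
lemma weierstrass_wp_equianharmonic:
  assumes "\<gamma> \<noteq> 0"
  obtains \<Lambda> where "complex_lattice \<Lambda>" "lattice_g2 \<Lambda> = 0" "lattice_g3 \<Lambda> = \<gamma>"
    "weierstrass_wp 0 \<gamma> = lattice_wp \<Lambda>"
proof -
  obtain \<Lambda> where L: "complex_lattice \<Lambda>" "lattice_g2 \<Lambda> = 0" using hexagonal_lattice by blast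
  hence g3: "lattice_g3 \<Lambda> \<noteq> 0" using lattice_invariants_nonzero by blast
  obtain \<mu> where "lattice_g3 \<Lambda> / \<gamma> = \<mu> ^ 6" using exists_complex_root[of 6 "lattice_g3 \<Lambda> / \<gamma>"] by auto
  hence "\<mu> \<noteq> 0" "lattice_g3 \<Lambda> / \<mu> ^ 6 = \<gamma>" using g3 assms by (auto simp: field_simps)
  hence "\<exists>\<Lambda>. complex_lattice \<Lambda> \<and> lattice_g2 \<Lambda> = 0 \<and> lattice_g3 \<Lambda> = \<gamma>"
    using lattice_scale[OF L(1), of \<mu>] L(2) by auto
  from someI_ex[OF this] show ?thesis using that unfolding weierstrass_wp_def by blast
qed

section \<open>Entire functions with bounded derivative over a net, and uniformisation\<close>

text \<open>
  This is the rigidity step. Landau's maximum trick is combined with Bloch's theorem: near a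
  point \<open>p\<close> maximising \<open>norm (g' z) * (1 - norm (z - a))\<close> on a unit disc, \<open>g'\<close> varies by a bounded factor on a
  disc of radius proportional to \<open>1 - norm (p - a)\<close>. If \<open>norm (g' a)\<close> is large, then the image of that disc
  contains a disc of radius \<open>R\<close>, hence a point of \<open>N\<close>, at whose preimage \<open>g'\<close> is still larger than
  \<open>M\<close>. So \<open>g'\<close> is bounded, and Liouville's theorem applies.
\<close>
lemma deriv_const_of_bounded_on_net_preimage:
  assumes g: "g holomorphic_on UNIV"
    and net: "R > 0" "\<And>z. \<exists>\<omega>\<in>N. dist z \<omega> < R"
    and bound: "\<And>z. g z \<in> N \<Longrightarrow> norm (deriv g z) \<le> M"
  shows "\<exists>c. \<forall>z. deriv g z = c"
proof -
  define f where "f = deriv g"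
  have f: "f holomorphic_on S" for S
    unfolding f_def by (rule holomorphic_on_subset[OF holomorphic_deriv[OF g open_UNIV]]) auto
  have gS: "g holomorphic_on S" for S by (rule holomorphic_on_subset[OF g]) auto
  have "sqrt 2 < 3 / 2" by (rule real_less_lsqrt) (auto simp: power2_eq_square)
  hence q: "3 - 2 * sqrt 2 > (0::real)" by simp
  \<comment> \<open>\<open>3 - 2 sqrt 2\<close> is the constant in Bloch's theorem, which is applied below on the disc of radius \<open>t / 8\<close>\<close>
  define K where "K = 16 * R / (3 - 2 * sqrt 2)"
  have K: "K > 0" using net(1) q by (simp add: K_def)
  have "norm (f a) \<le> max (2 * M) K" for a
  proof (rule ccontr)
    assume "\<not> ?thesis"
    hence fa: "norm (f a) > 2 * M" "norm (f a) > K" by auto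
    define h where "h = (\<lambda>z. norm (f z) * (1 - norm (z - a)))"
    have "continuous_on (cball a 1) h"
      unfolding h_def by (intro continuous_intros holomorphic_on_imp_continuous_on f)
    then obtain p where p: "p \<in> cball a 1" "\<And>z. z \<in> cball a 1 \<Longrightarrow> h z \<le> h p"
      using continuous_attains_sup[of "cball a 1" h] by auto
    define r where "r = 1 - norm (p - a)"
    define t where "t = r / 2"
    have hp: "h p = norm (f p) * r" by (simp add: h_def r_def)
    have "norm (f a) \<le> h p" using p(2)[of a] by (simp add: h_def)
    hence m: "h p > 2 * M" "h p > K" using fa by auto
    have "r \<ge> 0" "r \<le> 1" using p(1) by (auto simp: r_def dist_norm norm_minus_commute)
    moreover have "r \<noteq> 0" using m(2) K hp by auto
    ultimately have r: "0 < r" "r \<le> 1" by auto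
    have t: "t > 0" "r = 2 * t" using r by (auto simp: t_def)
    have fp: "norm (f p) \<ge> h p"
      using r mult_left_mono[of r 1 "norm (f p)"] by (simp add: hp)
    have le2: "norm (f z) \<le> 2 * norm (f p)" if "z \<in> cball p t" for z
    proof -
      have "norm (z - a) \<le> norm (z - p) + norm (p - a)" using norm_triangle_ineq[of "z - p" "p - a"] by simp
      also have "\<dots> \<le> t + (1 - r)" using that by (simp add: r_def dist_norm norm_minus_commute)
      finally have za: "norm (z - a) \<le> 1 - t" using t by simp
      hence "norm (f z) * t \<le> h z" unfolding h_def by (intro mult_left_mono) auto
      also have "h z \<le> h p" using za t by (intro p(2)) (auto simp: dist_norm norm_minus_commute)
      also have "\<dots> = (2 * norm (f p)) * t" by (simp add: hp t(2))
      finally show ?thesis using t(1) by simp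
    qed
    \<comment> \<open>Cauchy's estimate bounds the second derivative of \<open>g\<close>, so \<open>g'\<close> loses at most half of its size on the disc of radius \<open>t / 8\<close>\<close>
    have df: "norm (deriv f z) \<le> 4 * norm (f p) / t" if z: "z \<in> ball p (t / 2)" for z
    proof -
      have sub: "w \<in> cball p t" if "w \<in> cball z (t / 2)" for w
        using that z dist_triangle[of p w z] by simp
      have "norm ((deriv ^^ 1) f z) \<le> fact 1 * (2 * norm (f p)) / (t / 2) ^ 1"
      proof (rule Cauchy_inequality)
        show "norm (f w) \<le> 2 * norm (f p)" if "norm (z - w) = t / 2" for w
          using that by (intro le2 sub) (simp add: dist_norm)
      qed (use t in \<open>auto intro!: f holomorphic_on_imp_continuous_on\<close>)
      thus ?thesis by simp
    qed
    have lower: "norm (f z) \<ge> norm (f p) / 2" if z: "z \<in> ball p (t / 8)" for z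
    proof -
      have "norm (f z - f p) \<le> 4 * norm (f p) / t * norm (z - p)"
      proof (rule field_differentiable_bound[where S = "ball p (t / 2)"])
        show "(f has_field_derivative deriv f w) (at w within ball p (t / 2))" for w
          using holomorphic_derivI[OF f[of UNIV] open_UNIV UNIV_I] by (rule has_field_derivative_at_within)
      qed (use z t in \<open>auto intro!: df simp: dist_norm\<close>)
      also have "\<dots> \<le> 4 * norm (f p) / t * (t / 8)"
        using z t by (intro mult_left_mono) (auto simp: dist_norm norm_minus_commute)
      also have "\<dots> = norm (f p) / 2" using t by simp
      finally have "norm (f z - f p) \<le> norm (f p) / 2" .
      moreover have "norm (f p) \<le> norm (f z) + norm (f z - f p)"
        using norm_triangle_ineq4[of "f z" "f z - f p"] by simp
      ultimately show ?thesis by simp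
    qed
    have sub: "ball (g p) ((3 - 2 * sqrt 2) * (t / 8) * norm (deriv g p)) \<subseteq> g ` ball p (t / 8)"
    proof (rule Bloch_lemma)
      show "norm (deriv g z) \<le> 2 * norm (deriv g p)" if "z \<in> ball p (t / 8)" for z
        using le2[of z] that t by (simp add: f_def)
    qed (use t gS in auto)
    have Rlt: "R < (3 - 2 * sqrt 2) * (t / 8) * norm (deriv g p)"
    proof -
      have "K < 2 * t * norm (f p)" using m(2) hp t by (simp add: mult_ac)
      hence "(3 - 2 * sqrt 2) / 16 * K < (3 - 2 * sqrt 2) / 16 * (2 * t * norm (f p))"
        using q by (intro mult_strict_left_mono) auto
      moreover have "(3 - 2 * sqrt 2) / 16 * K = R" using q by (simp add: K_def)
      ultimately show ?thesis by (simp add: f_def field_simps)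
    qed
    obtain \<omega> where \<omega>: "\<omega> \<in> N" "dist (g p) \<omega> < R" using net(2) by blast
    have "\<omega> \<in> g ` ball p (t / 8)" by (rule subsetD[OF sub]) (use \<omega>(2) Rlt in simp)
    then obtain z where z: "z \<in> ball p (t / 8)" "g z \<in> N" using \<omega>(1) by blast
    have "norm (f z) \<le> M" using bound[OF z(2)] by (simp add: f_def)
    with lower[OF z(1)] fp m(1) show False by simp
  qed
  hence "bounded (range f)" by (auto simp: bounded_iff)
  then obtain c where "\<And>z. f z = c" using Liouville_theorem[OF f] by (auto simp: constant_on_def)
  thus ?thesis by (auto simp: f_def)
qed

text \<open>
  A nonzero derivative makes \<open>g\<close> locally injective at each point, so accumulation of the preimage would be
  accumulation of \<open>S\<close>.
\<close>
lemma sparse_vimage_nonzero_deriv: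
  assumes "S sparse_in UNIV" and g: "\<And>z::complex. (g has_field_derivative g' z) (at z)" and nz: "\<And>z. g' z \<noteq> 0"
  shows "(g -` S) sparse_in UNIV"
proof -
  have "\<forall>\<^sub>F z in at x. z \<notin> g -` S" for x
  proof -
    have "\<forall>\<^sub>F z in at x. (g z - g x) / (z - x) \<noteq> 0"
      using tendsto_imp_eventually_ne[OF g[unfolded has_field_derivative_iff] nz] .
    hence "\<forall>\<^sub>F z in at x. g z \<noteq> g x" by eventually_elim auto
    hence "filterlim g (at (g x)) (at x)"
      using DERIV_isCont[OF g] by (intro filterlim_atI) (auto simp: isCont_def)
    moreover have "\<forall>\<^sub>F z in at (g x). z \<notin> S" using assms(1) by (simp add: sparse_in_eventually_iff)
    ultimately show ?thesis by (auto simp: filterlim_iff)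
  qed
  thus ?thesis by (simp add: sparse_in_eventually_iff)
qed

text \<open>
  A solution \<open>(X, Y)\<close> of the time-changed Weierstrass equation is \<open>(\<wp>, \<wp>')\<close> along a primitive \<open>g\<close> of \<open>F\<close>:
  surjectivity matches the values at one point, and the differences \<open>X - \<wp>(g)\<close> and \<open>Y - \<wp>'(g)\<close> solve a
  homogeneous linear system on the connected complement of a sparse set.
\<close>
lemma wp_uniformisation:
  assumes lat: "complex_lattice \<Lambda>"
    and D: "D sparse_in UNIV"
    and F: "F holomorphic_on UNIV" "\<And>z. F z \<noteq> 0"
    and X: "\<And>z. z \<notin> D \<Longrightarrow> (X has_field_derivative F z * Y z) (at z)"
    and Y: "Y holomorphic_on - D" "\<And>z. z \<notin> D \<Longrightarrow> Y z \<noteq> 0"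
    and eq: "\<And>z. z \<notin> D \<Longrightarrow> Y z ^ 2 = 4 * X z ^ 3 - lattice_g2 \<Lambda> * X z - lattice_g3 \<Lambda>"
  shows "\<exists>g. (\<forall>z. (g has_field_derivative F z) (at z)) \<and>
     (\<forall>z. z \<notin> D \<longrightarrow> g z \<notin> \<Lambda> \<longrightarrow> X z = lattice_wp \<Lambda> (g z) \<and> Y z = deriv (lattice_wp \<Lambda>) (g z))"
proof -
  have opD: "open (- D)" using sparse_in_UNIV_imp_closed[OF D] by auto
  have "\<forall>\<^sub>F z in at 0. z \<notin> D" using D by (simp add: sparse_in_eventually_iff)
  then obtain z1 where z1: "z1 \<notin> D" using eventually_happens'[OF at_neq_bot] by blast
  obtain \<zeta> where \<zeta>: "\<zeta> \<notin> \<Lambda>" "lattice_wp \<Lambda> \<zeta> = X z1" "deriv (lattice_wp \<Lambda>) \<zeta> = Y z1"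
    using wp_surj_pair[OF lat eq[OF z1]] by blast
  obtain g0 where g0: "\<And>z. (g0 has_field_derivative F z) (at z)"
    using holomorphic_convex_primitive'[OF convex_UNIV open_UNIV F(1)] by auto
  define g where "g = (\<lambda>z. g0 z - g0 z1 + \<zeta>)"
  have g: "(g has_field_derivative F z) (at z)" for z
    unfolding g_def using g0 by (auto intro!: derivative_eq_intros)
  have dY: "(Y has_field_derivative F z * (6 * X z ^ 2 - lattice_g2 \<Lambda> / 2)) (at z)" if z: "z \<notin> D" for z
  proof -
    have Y': "(Y has_field_derivative deriv Y z) (at z)"
      using holomorphic_derivI[OF Y(1) opD] z by auto
    have "((\<lambda>z. Y z ^ 2 - (4 * X z ^ 3 - lattice_g2 \<Lambda> * X z - lattice_g3 \<Lambda>)) has_field_derivative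
        (2 * Y z * deriv Y z - (12 * X z ^ 2 * (F z * Y z) - lattice_g2 \<Lambda> * (F z * Y z)))) (at z)"
      using Y' X[OF z] by (auto intro!: derivative_eq_intros)
    moreover have "((\<lambda>z. Y z ^ 2 - (4 * X z ^ 3 - lattice_g2 \<Lambda> * X z - lattice_g3 \<Lambda>)) has_field_derivative 0) (at z)"
      by (rule has_field_derivative_transform_within_open[OF DERIV_const opD]) (use z in \<open>auto simp: eq\<close>)
    ultimately have "2 * Y z * deriv Y z - (12 * X z ^ 2 * (F z * Y z) - lattice_g2 \<Lambda> * (F z * Y z)) = 0"
      by (rule DERIV_unique)
    hence "Y z * (deriv Y z - F z * (6 * X z ^ 2 - lattice_g2 \<Lambda> / 2)) = 0" by (simp add: field_simps)
    hence "deriv Y z = F z * (6 * X z ^ 2 - lattice_g2 \<Lambda> / 2)" using Y(2)[OF z] by simp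
    thus ?thesis using Y' by simp
  qed
  define S where "S = - (D \<union> g -` \<Lambda>)"
  have sp: "(D \<union> g -` \<Lambda>) sparse_in UNIV"
    by (intro sparse_in_union' D sparse_vimage_nonzero_deriv[OF complex_lattice_sparse[OF lat] g F(2)])
  have S: "open S" "connected S"
    using sparse_in_UNIV_imp_closed[OF sp] sparse_imp_connected[OF _ connected_UNIV open_UNIV sp]
    by (auto simp: S_def Compl_eq_Diff_UNIV)
  let ?p = "lattice_wp \<Lambda>"
  have 1: "((\<lambda>z. X z - ?p (g z)) has_field_derivative F z * (Y z - deriv ?p (g z))) (at z)" if "z \<in> S" for z
    using that by (auto simp: S_def algebra_simps intro!: derivative_eq_intros X DERIV_chain'[OF g wp_has_deriv[OF lat]])
  have 2: "((\<lambda>z. Y z - deriv ?p (g z)) has_field_derivative (6 * F z * (X z + ?p (g z))) * (X z - ?p (g z))) (at z)" if "z \<in> S" for z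
  proof -
    have "((\<lambda>z. Y z - deriv ?p (g z)) has_field_derivative (F z * (6 * X z ^ 2 - lattice_g2 \<Lambda> / 2) - (6 * ?p (g z) ^ 2 - lattice_g2 \<Lambda> / 2) * F z)) (at z)"
      using that by (intro DERIV_diff dY DERIV_chain'[OF g wp_second_derivative[OF lat]]) (auto simp: S_def)
    thus ?thesis by (rule DERIV_cong) (simp add: algebra_simps power2_eq_square)
  qed
  have hol: "(\<lambda>z. X z - ?p (g z)) holomorphic_on S" "(\<lambda>z. Y z - deriv ?p (g z)) holomorphic_on S"
    using 1 2 holomorphic_on_open[OF S(1)] by blast+
  have holXg: "X holomorphic_on S"
    using X holomorphic_on_open[OF S(1)] by (auto simp: S_def)
  have holF: "F holomorphic_on S" by (rule holomorphic_on_subset[OF F(1)]) auto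
  have holp: "(\<lambda>z. ?p (g z)) holomorphic_on S"
    using holomorphic_on_diff[OF holXg hol(1)] by simp
  have main: "X z - ?p (g z) = 0 \<and> Y z - deriv ?p (g z) = 0" if z: "z \<in> S" for z
  proof (rule linear_system_unique[OF S _ z hol holF, of z1])
    show "(\<lambda>z. 6 * F z * (X z + ?p (g z))) holomorphic_on S"
      by (intro holomorphic_intros holF holXg holp)
    show "z1 \<in> S" using z1 \<zeta> by (simp add: S_def g_def)
    show "X z1 - ?p (g z1) = 0" "Y z1 - deriv ?p (g z1) = 0" using \<zeta> by (simp_all add: g_def)
  qed (use 1 2 DERIV_imp_deriv in blast)+
  show ?thesis by (intro exI[of _ g] conjI allI impI g) (use main in \<open>auto simp: S_def\<close>)
qed

section \<open>Local form of the Schwarzian derivative\<close>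

lemma isCont_holomorphic_centre:
  "f holomorphic_on ball x r \<Longrightarrow> r > 0 \<Longrightarrow> isCont f x" for f :: "complex \<Rightarrow> complex"
  by (intro field_differentiable_imp_continuous_at holomorphic_on_imp_differentiable_at[of f "ball x r"]) auto

text \<open>
  The integer \<open>m\<close> is the multiplicity of the value \<open>a\<close> at \<open>x\<close> or, for negative \<open>m\<close>, minus the order of the
  pole, in which case \<open>a\<close> is set to \<open>0\<close>. Excluding \<open>m = 0\<close> lets zeros, poles and other values be
  treated by the same formulas.
\<close>
lemma meromorphic_local_power_form:
  assumes u: "u meromorphic_on {x}" and nc: "\<And>a. \<not> (\<forall>\<^sub>F z in at x. u z = a)"
  obtains m a r v where "m \<noteq> 0" "m < 0 \<longrightarrow> a = 0" "r > 0" "v holomorphic_on ball x r" "v x \<noteq> 0"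
    "\<And>z. z \<in> ball x r - {x} \<Longrightarrow> u z = a + (z - x) powi m * v z"
proof -
  have ex: "\<exists>m v r. r > 0 \<and> v holomorphic_on ball x r \<and> v x \<noteq> 0 \<and>
      (\<forall>z\<in>ball x r - {x}. u z = a + (z - x) powi m * v z)" for a
  proof -
    have mer: "(\<lambda>z. u z - a) meromorphic_on {x}" by (intro meromorphic_intros u)
    have "\<exists>\<^sub>F z in at x. u z - a \<noteq> 0" using nc[of a] by (simp add: frequently_def)
    from zorder_exist[OF _ _ this] mer
    obtain r where "zor_poly (\<lambda>z. u z - a) x x \<noteq> 0" "r > 0" "zor_poly (\<lambda>z. u z - a) x holomorphic_on cball x r"
      "\<forall>w\<in>cball x r - {x}. u w - a = zor_poly (\<lambda>z. u z - a) x w * (w - x) powi (zorder (\<lambda>z. u z - a) x)"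
      by (auto simp: meromorphic_at_iff)
    thus ?thesis
      by (intro exI[of _ "zorder (\<lambda>z. u z - a) x"] exI[of _ "zor_poly (\<lambda>z. u z - a) x"] exI[of _ r])
         (auto simp: diff_eq_eq mult_ac elim!: holomorphic_on_subset)
  qed
  obtain m v r where 0: "r > 0" "v holomorphic_on ball x r" "v x \<noteq> 0"
      "\<And>z. z\<in>ball x r - {x} \<Longrightarrow> u z = 0 + (z - x) powi m * v z" using ex[of 0] by blast
  show ?thesis
  proof (cases "m = 0")
    case False
    thus ?thesis using that[OF False _ 0(1-3), of 0] 0(4) by simp
  next
    case True
    have ball: "\<forall>\<^sub>F z in at x. z \<in> ball x r - {x}" if "r > 0" for r
      using that by (auto simp: eventually_at dist_commute intro!: exI[of _ r])
    have "isCont v x" by (rule isCont_holomorphic_centre[OF 0(2,1)])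
    hence "(v \<longlongrightarrow> v x) (at x)" by (simp add: isCont_def)
    moreover have "\<forall>\<^sub>F z in at x. v z = u z"
      using ball[OF 0(1)] by eventually_elim (simp add: 0(4) True)
    ultimately have lim: "(u \<longlongrightarrow> v x) (at x)" by (rule Lim_transform_eventually)
    obtain m' v' r' where 1: "r' > 0" "v' holomorphic_on ball x r'" "v' x \<noteq> 0"
      "\<And>z. z\<in>ball x r' - {x} \<Longrightarrow> u z = v x + (z - x) powi m' * v' z" using ex[of "v x"] by blast
    have "m' > 0"
    proof (rule ccontr)
      assume "\<not> m' > 0"
      define k where "k = nat (- m')"
      have k: "m' = - int k" using \<open>\<not> m' > 0\<close> by (simp add: k_def)
      have "((\<lambda>z. (u z - v x) * (z - x) ^ k) \<longlongrightarrow> (v x - v x) * (x - x) ^ k) (at x)"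
        by (intro tendsto_intros lim)
      moreover have "\<forall>\<^sub>F z in at x. (u z - v x) * (z - x) ^ k = v' z"
        using ball[OF 1(1)] by eventually_elim (auto simp: 1(4) k power_int_minus)
      ultimately have "(v' \<longlongrightarrow> (v x - v x) * (x - x) ^ k) (at x)" by (rule Lim_transform_eventually)
      hence "(v' \<longlongrightarrow> 0) (at x)" by simp
      moreover have "isCont v' x" by (rule isCont_holomorphic_centre[OF 1(2,1)])
      hence "(v' \<longlongrightarrow> v' x) (at x)" by (simp add: isCont_def)
      ultimately have "v' x = 0" using tendsto_unique[of "at x" v'] by auto
      thus False using 1(3) by simp
    qed
    thus ?thesis using that[of m' "v x" r' v'] 1 by auto
  qed
qed

text \<open>
  Writing \<open>u' = (z - x) powi (m - 1) * w\<close> with \<open>w x \<noteq> 0\<close> gives \<open>u'' / u' = (m - 1) / (z - x) + A\<close> with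
  \<open>A = w' / w\<close> holomorphic, and hence the stated expansion with \<open>B = A' - A\<^sup>2 / 2\<close>. For \<open>m = 1\<close>
  the Schwarzian stays bounded; this sharper form excludes simple values at the roots of \<open>P\<close>.
\<close>
lemma schwarzian_local_form:
  assumes u: "u meromorphic_on {x}" and nc: "\<And>a. \<not> (\<forall>\<^sub>F z in at x. u z = a)"
  obtains m a v w A B where "m \<noteq> (0::int)" "m < 0 \<longrightarrow> a = 0"
    "isCont v x" "v x \<noteq> 0" "isCont w x" "w x = of_int m * v x" "isCont A x" "isCont B x"
    "\<forall>\<^sub>F z in at x. z \<noteq> x \<and> u z = a + (z - x) powi m * v z \<and> deriv u z = (z - x) powi (m - 1) * w z \<and>
        schwarzian u z = (1 - of_int m ^ 2) / 2 / (z - x) ^ 2 - (of_int m - 1) * A z / (z - x) + B z"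
proof -
  obtain a m v r where m: "m \<noteq> 0" "m < 0 \<longrightarrow> a = 0" and r: "r > 0" and v: "v holomorphic_on ball x r" "v x \<noteq> 0"
    and ueq: "\<And>z. z \<in> ball x r - {x} \<Longrightarrow> u z = a + (z - x) powi m * v z"
    by (rule meromorphic_local_power_form[OF u nc]) (rule that; assumption)
  define w where "w = (\<lambda>z. of_int m * v z + (z - x) * deriv v z)"
  have w: "w holomorphic_on ball x r" unfolding w_def by (intro holomorphic_intros v) auto
  have wx: "w x \<noteq> 0" using v m by (simp add: w_def)
  have "isCont w x" by (rule isCont_holomorphic_centre[OF w r])
  then obtain s0 where s0: "s0 > 0" "\<And>z. dist x z < s0 \<Longrightarrow> w z \<noteq> 0"
    using continuous_at_avoid[of x w 0] wx by blast
  define s where "s = min r s0"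
  have s: "s > 0" "\<And>z. z \<in> ball x s \<Longrightarrow> w z \<noteq> 0" "ball x s \<subseteq> ball x r"
    using s0 r by (auto simp: s_def)
  define U where "U = ball x s - {x}"
  have U: "open U" "\<And>z. z \<in> U \<Longrightarrow> z \<noteq> x" "\<And>z. z \<in> U \<Longrightarrow> z \<in> ball x r" "\<And>z. z \<in> U \<Longrightarrow> w z \<noteq> 0"
    using s by (auto simp: U_def)
  have dv: "(v has_field_derivative deriv v z) (at z)" if "z \<in> ball x r" for z
    by (rule holomorphic_derivI[OF v(1) _ that]) auto
  have dw: "(w has_field_derivative deriv w z) (at z)" if "z \<in> ball x r" for z
    by (rule holomorphic_derivI[OF w _ that]) auto
  have split: "(z - x) powi n = (z - x) powi (n - 1) * (z - x)" if "z \<in> U" for z n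
    using U(2)[OF that] power_int_add_1[of "z - x" "n - 1"] by simp
  have du: "(u has_field_derivative (z - x) powi (m - 1) * w z) (at z)" if z: "z \<in> U" for z
  proof -
    have "((\<lambda>z. a + (z - x) powi m * v z) has_field_derivative
        (of_int m * (z - x) powi (m - 1) * v z + (z - x) powi m * deriv v z)) (at z)"
      using U(2)[OF z] by (auto intro!: derivative_eq_intros dv U(3) z)
    also have "of_int m * (z - x) powi (m - 1) * v z + (z - x) powi m * deriv v z = (z - x) powi (m - 1) * w z"
      unfolding split[OF z, of m] by (simp add: w_def algebra_simps)
    finally show ?thesis
      by (rule has_field_derivative_transform_within_open[OF _ U(1) z]) (use ueq U in auto)
  qed
  have ddu: "(deriv u has_field_derivative ((of_int m - 1) * (z - x) powi (m - 2) * w z + (z - x) powi (m - 1) * deriv w z)) (at z)"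
    if z: "z \<in> U" for z
  proof -
    have "((\<lambda>z. (z - x) powi (m - 1) * w z) has_field_derivative
        ((of_int m - 1) * (z - x) powi (m - 2) * w z + (z - x) powi (m - 1) * deriv w z)) (at z)"
      using U(2)[OF z] by (auto intro!: derivative_eq_intros dw U(3) z)
    thus ?thesis
      by (rule has_field_derivative_transform_within_open[OF _ U(1) z]) (use DERIV_imp_deriv[OF du] in auto)
  qed
  define A where "A = (\<lambda>z. deriv w z / w z)"
  have holA: "A holomorphic_on ball x s"
    unfolding A_def by (intro holomorphic_intros holomorphic_on_subset[OF w s(3)]) (use s in auto)
  have dA: "(A has_field_derivative deriv A z) (at z)" if "z \<in> ball x s" for z
    by (rule holomorphic_derivI[OF holA _ that]) auto
  define B where "B = (\<lambda>z. deriv A z - A z ^ 2 / 2)"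
  have holB: "B holomorphic_on ball x s"
    unfolding B_def by (intro holomorphic_intros holA) auto
  have q: "deriv (deriv u) z / deriv u z = (of_int m - 1) / (z - x) + A z" if z: "z \<in> U" for z
  proof -
    have "deriv u z = (z - x) powi (m - 2) * (z - x) * w z"
      unfolding DERIV_imp_deriv[OF du[OF z]] split[OF z, of "m - 1"] by simp
    moreover have "deriv (deriv u) z = (z - x) powi (m - 2) * ((of_int m - 1) * w z + (z - x) * deriv w z)"
      unfolding DERIV_imp_deriv[OF ddu[OF z]] split[OF z, of "m - 1"] by (simp add: algebra_simps)
    moreover have "(k * (M * p + e * d)) / (k * e * p) = M / e + d / p"
      if "k \<noteq> 0" "e \<noteq> 0" "p \<noteq> 0" for k M p e d :: complex
      using that by (simp add: divide_simps)
    ultimately show ?thesis using U(2,4)[OF z] by (simp add: A_def)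
  qed
  have S: "schwarzian u z = (1 - of_int m ^ 2) / 2 / (z - x) ^ 2 - (of_int m - 1) * A z / (z - x) + B z" if z: "z \<in> U" for z
  proof -
    have "((\<lambda>z. (of_int m - 1) / (z - x) + A z) has_field_derivative (- (of_int m - 1) / (z - x) ^ 2 + deriv A z)) (at z)"
      using U(2)[OF z] z by (auto intro!: derivative_eq_intros dA simp: U_def power2_eq_square)
    hence "((\<lambda>z. deriv (deriv u) z / deriv u z) has_field_derivative (- (of_int m - 1) / (z - x) ^ 2 + deriv A z)) (at z)"
      by (rule has_field_derivative_transform_within_open[OF _ U(1) z]) (use q in auto)
    hence "schwarzian u z = (- (of_int m - 1) / (z - x) ^ 2 + deriv A z) - 1 / 2 * ((of_int m - 1) / (z - x) + A z) ^ 2"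
      unfolding schwarzian_def q[OF z] by (simp add: DERIV_imp_deriv)
    moreover have "(- (M - 1) / e ^ 2 + d) - 1 / 2 * ((M - 1) / e + p) ^ 2 = (1 - M ^ 2) / 2 / e ^ 2 - (M - 1) * p / e + (d - p ^ 2 / 2)"
      if "e \<noteq> 0" for M e d p :: complex
      using that by (simp add: field_simps power2_eq_square)
    ultimately show ?thesis using U(2)[OF z] by (simp add: B_def)
  qed
  note cont = isCont_holomorphic_centre
  have "\<forall>\<^sub>F z in at x. z \<in> U"
    using s(1) by (auto simp: U_def eventually_at dist_commute intro!: exI[of _ s])
  hence "\<forall>\<^sub>F z in at x. z \<noteq> x \<and> u z = a + (z - x) powi m * v z \<and> deriv u z = (z - x) powi (m - 1) * w z \<and>
        schwarzian u z = (1 - of_int m ^ 2) / 2 / (z - x) ^ 2 - (of_int m - 1) * A z / (z - x) + B z"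
    by eventually_elim (use U ueq S DERIV_imp_deriv[OF du] in auto)
  thus ?thesis
    using that[OF m cont[OF v(1) r] v(2) cont[OF w r] _ cont[OF holA s(1)] cont[OF holB s(1)]] by (simp add: w_def)
qed

text \<open>
  The heart of the local analysis. The hypotheses on \<open>\<sigma>1\<close> and \<open>\<sigma>2\<close> say that neither is a root of
  \<open>u\<^sup>3 - u\<close>. At a pole or a value that is not such a root, the right-hand side has a limit, so \<open>m\<^sup>2 = 1\<close>. At
  a root it grows like \<open>(z - x)\<close> to the power \<open>- 2 m\<close>, the cube of the Schwarzian at most like the power
  \<open>- 6\<close>, and exactly so unless \<open>m = 1\<close>; this leaves \<open>m = 3\<close>. In each case
  \<open>u'\<^sup>3 / (u\<^sup>3 - u)\<^sup>2\<close> has a nonzero limit \<open>l\<close>. If \<open>u\<close> vanishes at \<open>x\<close>, comparing leading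
  coefficients with \<open>m = 3\<close> determines \<open>l\<^sup>2\<close>.
\<close>
lemma schwarzian_equation_local:
  fixes c \<sigma>1 \<sigma>2 :: complex
  assumes u: "u meromorphic_on {x}" and nc: "\<And>a. \<not> (\<forall>\<^sub>F z in at x. u z = a)"
    and c: "c \<noteq> 0" and \<sigma>: "\<sigma>1 ^ 3 \<noteq> \<sigma>1" "\<sigma>2 ^ 3 \<noteq> \<sigma>2"
    and ode: "\<forall>\<^sub>F z in at x. schwarzian u z ^ 3 = c * ((u z - \<sigma>1) ^ 3 * (u z - \<sigma>2) ^ 3) / (u z ^ 3 - u z) ^ 2"
  shows "\<exists>l. l \<noteq> 0 \<and> ((\<lambda>z. deriv u z ^ 3 / (u z ^ 3 - u z) ^ 2) \<longlongrightarrow> l) (at x) \<and>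
     ((u \<longlongrightarrow> 0) (at x) \<longrightarrow> l ^ 2 = - 729 * c * (\<sigma>1 * \<sigma>2) ^ 3 / 64)"
proof -
  obtain m a v w A B where m: "m \<noteq> (0::int)" "m < 0 \<longrightarrow> a = 0"
    and v: "isCont v x" "v x \<noteq> 0" and w: "isCont w x" "w x = of_int m * v x" and AB: "isCont A x" "isCont B x"
    and ev0: "\<forall>\<^sub>F z in at x. z \<noteq> x \<and> u z = a + (z - x) powi m * v z \<and> deriv u z = (z - x) powi (m - 1) * w z \<and>
        schwarzian u z = (1 - of_int m ^ 2) / 2 / (z - x) ^ 2 - (of_int m - 1) * A z / (z - x) + B z"
    by (rule schwarzian_local_form[OF u nc]) (rule that; assumption)
  define e where "e = (\<lambda>z. z - x)"
  define S where "S = schwarzian u"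
  define R where "R = (\<lambda>z. c * ((u z - \<sigma>1) ^ 3 * (u z - \<sigma>2) ^ 3) / (u z ^ 3 - u z) ^ 2)"
  define s0 where "s0 = (1 - of_int m ^ 2) / (2::complex)"
  define M where "M = (\<lambda>z. s0 - (of_int m - 1) * A z * e z + B z * e z ^ 2)"
  have lim: "(v \<longlongrightarrow> v x) (at x)" "(w \<longlongrightarrow> w x) (at x)" "(A \<longlongrightarrow> A x) (at x)" "(B \<longlongrightarrow> B x) (at x)"
    using v(1) w(1) AB by (simp_all add: isCont_def)
  have lime: "(e \<longlongrightarrow> 0) (at x)" unfolding e_def by (rule tendsto_eq_intros refl | simp)+
  have limM: "(M \<longlongrightarrow> s0) (at x)" unfolding M_def by (rule tendsto_eq_intros lim lime refl | simp)+
  have ev: "\<forall>\<^sub>F z in at x. e z \<noteq> 0 \<and> u z = a + e z powi m * v z \<and> deriv u z = e z powi (m - 1) * w z \<and>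
      S z * e z ^ 2 = M z \<and> S z ^ 3 = R z \<and> v z \<noteq> 0"
    using ev0 ode tendsto_imp_eventually_ne[OF lim(1) v(2)]
  proof eventually_elim
    case (elim z)
    have "(s / E ^ 2 - q * p / E + d) * E ^ 2 = s - q * p * E + d * E ^ 2" if "E \<noteq> 0" for s q p d E :: complex
      using that by (simp add: field_simps power2_eq_square)
    from this[of "z - x" "(1 - of_int m ^ 2) / 2" "of_int m - 1" "A z" "B z"]
    have "S z * e z ^ 2 = M z" using elim by (simp add: S_def e_def M_def s0_def)
    thus ?case using elim by (simp add: S_def e_def R_def)
  qed
  have evS: "\<forall>\<^sub>F z in at x. S z = (1 - of_int m ^ 2) / 2 / e z ^ 2 - (of_int m - 1) * A z / e z + B z"
    using ev0 by eventually_elim (simp add: S_def e_def)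
  have limM3: "((\<lambda>z. M z ^ 3) \<longlongrightarrow> s0 ^ 3) (at x)" by (intro tendsto_intros limM)
  have p6: "(s * E ^ 2) ^ 3 = s ^ 3 * E ^ 6" for s E :: complex
    by (simp add: power_mult_distrib flip: power_mult)
  have MR: "\<forall>\<^sub>F z in at x. e z ^ 6 * R z = M z ^ 3"
    using ev
  proof eventually_elim
    case (elim z)
    have "M z ^ 3 = (S z * e z ^ 2) ^ 3" using elim by simp
    also have "\<dots> = S z ^ 3 * e z ^ 6" by (rule p6)
    finally show ?case using elim by simp
  qed
  have unit: "m = 1 \<or> m = -1" if "(R \<longlongrightarrow> r) (at x)" for r
  proof -
    have "((\<lambda>z. e z ^ 6 * R z) \<longlongrightarrow> 0 ^ 6 * r) (at x)" by (intro tendsto_intros lime that)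
    hence "((\<lambda>z. M z ^ 3) \<longlongrightarrow> 0 ^ 6 * r) (at x)" using MR by (rule Lim_transform_eventually)
    hence "s0 ^ 3 = 0" using tendsto_unique[OF _ limM3] by simp
    hence "(of_int (m ^ 2) :: complex) = of_int 1" by (simp add: s0_def)
    hence "m ^ 2 = 1" unfolding of_int_eq_iff .
    thus ?thesis by (simp add: power2_eq_1_iff)
  qed
  consider "m < 0" | "m > 0" "a ^ 3 \<noteq> a" | "m > 0" "a ^ 3 = a" using m by linarith
  thus ?thesis
  proof cases
    case 1
    \<comment> \<open>here \<open>u = v / y\<close> with \<open>y \<longlongrightarrow> 0\<close>, so that the right-hand side tends to \<open>c\<close>\<close>
    define y where "y = (\<lambda>z. e z powi (- m))"
    have limy: "(y \<longlongrightarrow> 0) (at x)"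
    proof -
      have "y = (\<lambda>z. e z ^ nat (- m))" using 1 by (simp add: y_def power_int_def)
      thus ?thesis using tendsto_power[OF lime, of "nat (- m)"] 1 by (simp add: zero_power)
    qed
    have evy: "\<forall>\<^sub>F z in at x. y z \<noteq> 0 \<and> u z = v z / y z"
      using ev by eventually_elim (use 1 m in \<open>auto simp: y_def power_int_minus field_simps\<close>)
    have "((\<lambda>z. c * ((v z - \<sigma>1 * y z) ^ 3 * (v z - \<sigma>2 * y z) ^ 3) / (v z ^ 3 - v z * y z ^ 2) ^ 2) \<longlongrightarrow>
       c * ((v x - \<sigma>1 * 0) ^ 3 * (v x - \<sigma>2 * 0) ^ 3) / (v x ^ 3 - v x * 0 ^ 2) ^ 2) (at x)"
      using v(2) by (intro tendsto_intros lim limy) auto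
    moreover have "\<forall>\<^sub>F z in at x. c * ((v z - \<sigma>1 * y z) ^ 3 * (v z - \<sigma>2 * y z) ^ 3) / (v z ^ 3 - v z * y z ^ 2) ^ 2 = R z"
      using evy
    proof eventually_elim
      case (elim z)
      have vy: "v z = u z * y z" using elim by simp
      have "(v z - \<sigma> * y z) ^ 3 = (u z - \<sigma>) ^ 3 * y z ^ 3" for \<sigma>
        unfolding vy by (simp add: power_mult_distrib flip: left_diff_distrib)
      moreover have "v z ^ 3 - v z * y z ^ 2 = (u z ^ 3 - u z) * y z ^ 3"
        unfolding vy by (simp add: algebra_simps power3_eq_cube power2_eq_square)
      moreover have "c * ((p * k) * (q * k)) / (r * k) ^ 2 = c * (p * q) / r ^ 2" if "k \<noteq> 0" for p q r k
        using that by (simp add: power2_eq_square)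
      ultimately show ?case using elim by (simp add: R_def)
    qed
    ultimately have limR: "(R \<longlongrightarrow> c * ((v x - \<sigma>1 * 0) ^ 3 * (v x - \<sigma>2 * 0) ^ 3) / (v x ^ 3 - v x * 0 ^ 2) ^ 2) (at x)"
      by (rule Lim_transform_eventually)
    have m1: "m = -1" using unit[OF limR] 1 by auto
    have a0: "a = 0" using 1 m by simp
    have "((\<lambda>z. w z ^ 3 / (v z ^ 3 - v z * e z ^ 2) ^ 2) \<longlongrightarrow> w x ^ 3 / (v x ^ 3 - v x * 0 ^ 2) ^ 2) (at x)"
      using v(2) by (intro tendsto_intros lim lime) auto
    moreover have "\<forall>\<^sub>F z in at x. w z ^ 3 / (v z ^ 3 - v z * e z ^ 2) ^ 2 = deriv u z ^ 3 / (u z ^ 3 - u z) ^ 2"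
      using ev
    proof eventually_elim
      case (elim z)
      hence uz: "u z = v z / e z" by (simp add: m1 a0 power_int_minus divide_inverse)
      have duz: "deriv u z = w z / e z ^ 2" using elim by (simp add: m1 power_int_minus divide_inverse)
      have vz: "v z = u z * e z" unfolding uz using elim by auto
      have "v z ^ 3 - v z * e z ^ 2 = (u z ^ 3 - u z) * e z ^ 3"
        unfolding vz by (simp add: algebra_simps power3_eq_cube power2_eq_square)
      thus ?case by (simp add: duz power_divide power_mult_distrib mult.commute flip: power_mult)
    qed
    ultimately have "((\<lambda>z. deriv u z ^ 3 / (u z ^ 3 - u z) ^ 2) \<longlongrightarrow> w x ^ 3 / (v x ^ 3 - v x * 0 ^ 2) ^ 2) (at x)"
      by (rule Lim_transform_eventually)
    moreover have "w x ^ 3 / (v x ^ 3 - v x * 0 ^ 2) ^ 2 \<noteq> 0" using v(2) w(2) m1 by simp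
    moreover have "\<not> (u \<longlongrightarrow> 0) (at x)"
    proof
      assume "(u \<longlongrightarrow> 0) (at x)"
      hence "((\<lambda>z. u z * y z) \<longlongrightarrow> 0 * 0) (at x)" by (intro tendsto_intros limy)
      moreover have "\<forall>\<^sub>F z in at x. u z * y z = v z" using evy by eventually_elim auto
      ultimately have "(v \<longlongrightarrow> 0 * 0) (at x)" by (rule Lim_transform_eventually)
      thus False using tendsto_unique[OF _ lim(1)] v(2) by fastforce
    qed
    ultimately show ?thesis by blast
  next
    case 2
    have "((\<lambda>z. a + e z ^ nat m * v z) \<longlongrightarrow> a + 0 ^ nat m * v x) (at x)" by (intro tendsto_intros lim lime)
    moreover have "\<forall>\<^sub>F z in at x. a + e z ^ nat m * v z = u z"
      using ev by eventually_elim (use 2 in \<open>auto simp: power_int_def\<close>)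
    ultimately have "(u \<longlongrightarrow> a + 0 ^ nat m * v x) (at x)" by (rule Lim_transform_eventually)
    hence limu: "(u \<longlongrightarrow> a) (at x)" using 2 by (simp add: zero_power)
    have limR: "(R \<longlongrightarrow> c * ((a - \<sigma>1) ^ 3 * (a - \<sigma>2) ^ 3) / (a ^ 3 - a) ^ 2) (at x)"
      unfolding R_def using 2 by (intro tendsto_intros limu) auto
    have m1: "m = 1" using unit[OF limR] 2 by auto
    have "\<forall>\<^sub>F z in at x. w z = deriv u z" using ev by eventually_elim (auto simp: m1)
    hence limdu: "(deriv u \<longlongrightarrow> w x) (at x)" by (rule Lim_transform_eventually[OF lim(2)])
    have "((\<lambda>z. deriv u z ^ 3 / (u z ^ 3 - u z) ^ 2) \<longlongrightarrow> w x ^ 3 / (a ^ 3 - a) ^ 2) (at x)"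
      using 2 by (intro tendsto_intros limu limdu) auto
    moreover have "w x ^ 3 / (a ^ 3 - a) ^ 2 \<noteq> 0" using 2 v(2) w(2) m1 by simp
    moreover have "\<not> (u \<longlongrightarrow> 0) (at x)"
      using tendsto_unique[OF _ limu] 2(2) by fastforce
    ultimately show ?thesis by blast
  next
    case 3
    define n where "n = nat m"
    have n: "m = int n" "n > 0" using 3 by (auto simp: n_def)
    have pw: "e z powi m = e z ^ n" "e z powi (m - 1) = e z ^ (n - 1)" for z
      using n by (auto simp: power_int_def nat_diff_distrib)
    have "((\<lambda>z. a + e z ^ n * v z) \<longlongrightarrow> a + 0 ^ n * v x) (at x)" by (intro tendsto_intros lim lime)
    moreover have "\<forall>\<^sub>F z in at x. a + e z ^ n * v z = u z"
      using ev by eventually_elim (auto simp: pw)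
    ultimately have "(u \<longlongrightarrow> a + 0 ^ n * v x) (at x)" by (rule Lim_transform_eventually)
    hence limu: "(u \<longlongrightarrow> a) (at x)" using n by (simp add: zero_power)
    define Q where "Q = (\<lambda>z. v z * (3 * a ^ 2 - 1 + 3 * a * (e z ^ n * v z) + (e z ^ n * v z) ^ 2))"
    define q0 where "q0 = v x * (3 * a ^ 2 - 1)"
    define N where "N = (\<lambda>z. c * ((u z - \<sigma>1) ^ 3 * (u z - \<sigma>2) ^ 3))"
    define N0 where "N0 = c * ((a - \<sigma>1) ^ 3 * (a - \<sigma>2) ^ 3)"
    have limN: "(N \<longlongrightarrow> N0) (at x)" unfolding N_def N0_def by (intro tendsto_intros limu)
    have "(Q \<longlongrightarrow> v x * (3 * a ^ 2 - 1 + 3 * a * (0 ^ n * v x) + (0 ^ n * v x) ^ 2)) (at x)"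
      unfolding Q_def by (intro tendsto_intros lim lime)
    hence limQ: "(Q \<longlongrightarrow> q0) (at x)" using n by (simp add: q0_def zero_power)
    have a: "a = 0 \<or> a = 1 \<or> a = -1"
    proof -
      have "a * ((a - 1) * (a + 1)) = 0" using 3(2) by (simp add: algebra_simps power3_eq_cube)
      thus ?thesis by (simp add: eq_neg_iff_add_eq_0)
    qed
    have a2: "3 * a ^ 2 - 1 \<noteq> 0" using a by auto
    have q0: "q0 \<noteq> 0" using v(2) a2 by (simp add: q0_def)
    have N0: "N0 \<noteq> 0" using c \<sigma> a by (auto simp: N0_def)
    have P: "\<forall>\<^sub>F z in at x. u z ^ 3 - u z = e z ^ n * Q z"
      using ev
    proof eventually_elim
      case (elim z)
      have "u z = a + e z ^ n * v z" using elim by (simp add: pw)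
      moreover have "(a + d) ^ 3 - (a + d) = d * (3 * a ^ 2 - 1 + 3 * a * d + d ^ 2)" for d
      proof -
        have "(a + d) ^ 3 - (a + d) = (a ^ 3 - a) + d * (3 * a ^ 2 - 1 + 3 * a * d + d ^ 2)"
          by (simp add: power2_eq_square power3_eq_cube algebra_simps)
        thus ?thesis using 3(2) by simp
      qed
      ultimately show ?case by (simp add: Q_def mult_ac)
    qed
    have evQ: "\<forall>\<^sub>F z in at x. Q z \<noteq> 0" by (rule tendsto_imp_eventually_ne[OF limQ q0])
    \<comment> \<open>the equation with its denominator cleared; the right-hand side has a nonzero limit\<close>
    have key: "\<forall>\<^sub>F z in at x. S z ^ 3 * e z ^ (2 * n) * Q z ^ 2 = N z"
      using ev P evQ
    proof eventually_elim
      case (elim z)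
      have "S z ^ 3 = N z / (e z ^ n * Q z) ^ 2" using elim by (simp add: R_def N_def)
      thus ?case using elim by (simp add: power_mult_distrib mult.commute flip: power_mult)
    qed
    have contra: False if "((\<lambda>z. S z ^ 3 * e z ^ (2 * n) * Q z ^ 2) \<longlongrightarrow> 0) (at x)"
    proof -
      have "(N \<longlongrightarrow> 0) (at x)" using that key by (rule Lim_transform_eventually)
      thus False using tendsto_unique[OF _ limN] N0 by fastforce
    qed
    have "n \<noteq> 1"
    proof
      \<comment> \<open>the double pole of the Schwarzian and its simple pole both disappear, leaving the continuous term \<open>B\<close>\<close>
      assume n1: "n = 1"
      have "((\<lambda>z. B z ^ 3 * e z ^ 2 * Q z ^ 2) \<longlongrightarrow> B x ^ 3 * 0 ^ 2 * q0 ^ 2) (at x)"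
        by (intro tendsto_intros lim lime limQ)
      moreover have "\<forall>\<^sub>F z in at x. B z ^ 3 * e z ^ 2 * Q z ^ 2 = S z ^ 3 * e z ^ (2 * n) * Q z ^ 2"
        using evS by eventually_elim (simp add: n n1)
      ultimately have "((\<lambda>z. S z ^ 3 * e z ^ (2 * n) * Q z ^ 2) \<longlongrightarrow> B x ^ 3 * 0 ^ 2 * q0 ^ 2) (at x)"
        by (rule Lim_transform_eventually)
      thus False using contra by simp
    qed
    moreover have "n \<noteq> 2"
    proof
      assume n2: "n = 2"
      have "((\<lambda>z. N z * e z ^ 2) \<longlongrightarrow> N0 * 0 ^ 2) (at x)" by (intro tendsto_intros limN lime)
      moreover have "\<forall>\<^sub>F z in at x. N z * e z ^ 2 = M z ^ 3 * Q z ^ 2"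
        using ev key
      proof eventually_elim
        case (elim z)
        have "M z = S z * e z ^ 2" using elim by simp
        moreover have "N z = S z ^ 3 * e z ^ 4 * Q z ^ 2" using elim n2 by simp
        moreover have "e z ^ 6 = e z ^ 4 * e z ^ 2" by (simp flip: power_add)
        ultimately show ?case by (simp only: p6) (simp add: mult_ac)
      qed
      ultimately have "((\<lambda>z. M z ^ 3 * Q z ^ 2) \<longlongrightarrow> N0 * 0 ^ 2) (at x)" by (rule Lim_transform_eventually)
      from tendsto_unique[OF _ tendsto_mult[OF limM3 tendsto_power[OF limQ, of 2]] this]
      have "s0 ^ 3 * q0 ^ 2 = N0 * 0 ^ 2" by simp
      thus False using q0 by (simp add: s0_def n n2)
    qed
    moreover have "n \<le> 3"
    proof (rule ccontr)
      assume "\<not> n \<le> 3"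
      hence k: "2 * n = (2 * n - 6) + 6" "2 * n - 6 > 0" by auto
      have "((\<lambda>z. M z ^ 3 * e z ^ (2 * n - 6) * Q z ^ 2) \<longlongrightarrow> s0 ^ 3 * 0 ^ (2 * n - 6) * q0 ^ 2) (at x)"
        by (intro tendsto_intros limM lime limQ)
      moreover have "\<forall>\<^sub>F z in at x. M z ^ 3 * e z ^ (2 * n - 6) * Q z ^ 2 = S z ^ 3 * e z ^ (2 * n) * Q z ^ 2"
        using ev
      proof eventually_elim
        case (elim z)
        have "M z ^ 3 = (S z * e z ^ 2) ^ 3" using elim by simp
        also have "\<dots> = S z ^ 3 * e z ^ 6" by (rule p6)
        finally have "M z ^ 3 * e z ^ (2 * n - 6) = S z ^ 3 * (e z ^ (2 * n - 6) * e z ^ 6)" by (simp add: mult_ac)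
        thus ?case by (simp flip: power_add k(1))
      qed
      ultimately have "((\<lambda>z. S z ^ 3 * e z ^ (2 * n) * Q z ^ 2) \<longlongrightarrow> s0 ^ 3 * 0 ^ (2 * n - 6) * q0 ^ 2) (at x)"
        by (rule Lim_transform_eventually)
      thus False using contra k(2) by (simp add: zero_power)
    qed
    ultimately have n3: "n = 3" using n(2) by linarith
    have "((\<lambda>z. w z ^ 3 / Q z ^ 2) \<longlongrightarrow> w x ^ 3 / q0 ^ 2) (at x)" using q0 by (intro tendsto_intros lim limQ) auto
    moreover have "\<forall>\<^sub>F z in at x. w z ^ 3 / Q z ^ 2 = deriv u z ^ 3 / (u z ^ 3 - u z) ^ 2"
      using ev P
    proof eventually_elim
      case (elim z)
      thus ?case by (simp add: pw n3 power_mult_distrib flip: power_mult)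
    qed
    ultimately have "((\<lambda>z. deriv u z ^ 3 / (u z ^ 3 - u z) ^ 2) \<longlongrightarrow> w x ^ 3 / q0 ^ 2) (at x)"
      by (rule Lim_transform_eventually)
    moreover have "w x ^ 3 / q0 ^ 2 \<noteq> 0" using q0 w(2) v(2) n n3 by simp
    moreover have "(w x ^ 3 / q0 ^ 2) ^ 2 = - 729 * c * (\<sigma>1 * \<sigma>2) ^ 3 / 64" if "(u \<longlongrightarrow> 0) (at x)"
    proof -
      have a0: "a = 0" using tendsto_unique[OF _ limu that] by simp
      have "((\<lambda>z. M z ^ 3 * Q z ^ 2) \<longlongrightarrow> s0 ^ 3 * q0 ^ 2) (at x)" by (intro tendsto_intros limM limQ)
      moreover have "\<forall>\<^sub>F z in at x. M z ^ 3 * Q z ^ 2 = N z"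
        using ev key
      proof eventually_elim
        case (elim z)
        have "M z ^ 3 = (S z * e z ^ 2) ^ 3" using elim by simp
        also have "\<dots> = S z ^ 3 * e z ^ 6" by (rule p6)
        finally show ?case using elim by (simp add: n3)
      qed
      ultimately have "(N \<longlongrightarrow> s0 ^ 3 * q0 ^ 2) (at x)" by (rule Lim_transform_eventually)
      hence "s0 ^ 3 * q0 ^ 2 = N0" using tendsto_unique[OF _ limN] by auto
      hence "- 64 * v x ^ 2 = c * (\<sigma>1 * \<sigma>2) ^ 3"
        by (simp add: s0_def q0_def N0_def a0 n n3 power_mult_distrib)
      moreover have "(w x ^ 3 / q0 ^ 2) ^ 2 = 729 * v x ^ 2"
      proof -
        have "w x ^ 3 / q0 ^ 2 = 27 * v x"
          using v(2) by (simp add: w(2) q0_def a0 n n3 power_mult_distrib power3_eq_cube power2_eq_square)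
        thus ?thesis by (simp add: power_mult_distrib)
      qed
      moreover have "729 * X = - 729 * K / 64" if "- 64 * X = K" for X K :: complex
        using that[symmetric] by simp
      ultimately show ?thesis by (metis mult.assoc)
    qed
    ultimately show ?thesis by blast
  qed
qed

section \<open>The binomial equation\<close>

text \<open>
  With \<open>P(u) = u\<^sup>3 - u\<close>, differentiating \<open>u'\<^sup>3 = k P(u)\<^sup>2\<close> yields
  \<open>u'' / u' = (2/3) P'(u) u' / P(u)\<close>. One more differentiation gives
  \<open>S(u) = ((2/3) P P'' - (4/9) P'\<^sup>2) u'\<^sup>2 / P\<^sup>2\<close>, in which the bracket collapses to
  \<open>- (4/3) (u\<^sup>2 + 1/3)\<close>. This is where the special values of \<open>\<sigma>1\<close> and \<open>\<sigma>2\<close> come from.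
\<close>
lemma schwarzian_cube_of_binomial_ode:
  fixes k :: complex
  assumes S: "open S" "z \<in> S" and hol: "u holomorphic_on S"
    and ode: "\<And>z. z \<in> S \<Longrightarrow> deriv u z ^ 3 = k * (u z ^ 3 - u z) ^ 2"
    and nz: "k \<noteq> 0" "\<And>z. z \<in> S \<Longrightarrow> u z ^ 3 \<noteq> u z"
  shows "schwarzian u z ^ 3 = - 64 / 27 * k ^ 2 * (u z ^ 2 + 1 / 3) ^ 3 / (u z ^ 3 - u z) ^ 2"
proof -
  define p where "p = (\<lambda>z. u z ^ 3 - u z)"
  define p1 where "p1 = (\<lambda>z. 3 * u z ^ 2 - 1)"
  have p0: "p z \<noteq> 0" if "z \<in> S" for z using nz that by (simp add: p_def)
  have du: "(u has_field_derivative deriv u z) (at z)" if "z \<in> S" for z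
    by (rule holomorphic_derivI[OF hol S(1) that])
  have ddu: "(deriv u has_field_derivative deriv (deriv u) z) (at z)" if "z \<in> S" for z
    by (rule holomorphic_derivI[OF holomorphic_deriv[OF hol S(1)] S(1) that])
  have dp: "(p has_field_derivative p1 z * deriv u z) (at z)" if "z \<in> S" for z
    unfolding p_def p1_def by (auto intro!: derivative_eq_intros du that simp: algebra_simps)
  have u1: "deriv u z \<noteq> 0" if "z \<in> S" for z
    using ode[OF that] nz p0[OF that] by (auto simp: p_def)
  have u2: "deriv (deriv u) z = 2 / 3 * p1 z * deriv u z ^ 2 / p z" if z: "z \<in> S" for z
  proof -
    have "((\<lambda>z. deriv u z ^ 3 - k * p z ^ 2) has_field_derivative
       (3 * deriv u z ^ 2 * deriv (deriv u) z - k * (2 * p z * (p1 z * deriv u z)))) (at z)"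
      by (auto intro!: derivative_eq_intros ddu dp z)
    moreover have "((\<lambda>z. deriv u z ^ 3 - k * p z ^ 2) has_field_derivative 0) (at z)"
      by (rule has_field_derivative_transform_within_open[OF DERIV_const S(1) z]) (simp add: ode p_def)
    ultimately have "3 * deriv u z ^ 2 * deriv (deriv u) z - k * (2 * p z * (p1 z * deriv u z)) = 0"
      by (rule DERIV_unique)
    hence "3 * deriv u z ^ 2 * deriv (deriv u) z = k * (2 * p z * (p1 z * deriv u z))" by simp
    hence "(3 * deriv u z ^ 2 * deriv (deriv u) z) * p z = k * (2 * p z * (p1 z * deriv u z)) * p z" by (rule arg_cong)
    also have "\<dots> = 2 * (k * p z ^ 2) * (p1 z * deriv u z)" by (simp add: power2_eq_square)
    also have "k * p z ^ 2 = deriv u z ^ 3" using ode[OF z] by (simp add: p_def)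
    finally have "deriv u z ^ 2 * (3 * deriv (deriv u) z * p z) = deriv u z ^ 2 * (2 * p1 z * deriv u z ^ 2)"
      by (simp add: power2_eq_square power3_eq_cube mult_ac)
    hence "3 * deriv (deriv u) z * p z = 2 * p1 z * deriv u z ^ 2" using u1[OF z] by simp
    thus ?thesis using p0[OF z] by (simp add: field_simps)
  qed
  have q: "deriv (deriv u) z / deriv u z = 2 / 3 * p1 z * deriv u z / p z" if z: "z \<in> S" for z
    using u1[OF z] p0[OF z] by (simp add: u2[OF z] power2_eq_square)
  define T where "T = ((2 / 3 * (6 * u z * deriv u z) * deriv u z + 2 / 3 * p1 z * deriv (deriv u) z) * p z - 2 / 3 * p1 z * deriv u z * (p1 z * deriv u z)) / (p z * p z)"
  have "((\<lambda>z. 2 / 3 * p1 z * deriv u z / p z) has_field_derivative T) (at z)"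
    using p0[OF S(2)] unfolding p1_def T_def
    by (auto intro!: derivative_eq_intros du ddu dp[unfolded p1_def] S(2) simp: algebra_simps)
  hence "((\<lambda>z. deriv (deriv u) z / deriv u z) has_field_derivative T) (at z)"
    by (rule has_field_derivative_transform_within_open[OF _ S]) (simp add: q)
  hence "schwarzian u z = T - 1 / 2 * (2 / 3 * p1 z * deriv u z / p z) ^ 2"
    unfolding schwarzian_def q[OF S(2)] by (simp add: DERIV_imp_deriv)
  also have "\<dots> = (4 * u z * p z - 4 / 9 * p1 z ^ 2) * deriv u z ^ 2 / p z ^ 2"
    unfolding T_def u2[OF S(2)] using p0[OF S(2)] by (simp add: field_simps power2_eq_square)
  also have "4 * u z * p z - 4 / 9 * p1 z ^ 2 = - 4 / 3 * (u z ^ 2 + 1 / 3)"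
    by (simp add: p_def p1_def field_simps power2_eq_square power3_eq_cube)
  finally have "schwarzian u z ^ 3 = (- 4 / 3 * (u z ^ 2 + 1 / 3)) ^ 3 * (deriv u z ^ 3) ^ 2 / (p z ^ 2) ^ 3"
    by (simp add: power_mult_distrib power_divide flip: power_mult)
  also have "deriv u z ^ 3 = k * p z ^ 2" using ode[OF S(2)] by (simp add: p_def)
  also have "(k * p z ^ 2) ^ 2 = k ^ 2 * p z ^ 4" by (simp add: power_mult_distrib flip: power_mult)
  also have "(- 4 / 3 * (u z ^ 2 + 1 / 3)) ^ 3 = - 64 / 27 * (u z ^ 2 + 1 / 3) ^ 3"
    unfolding power_mult_distrib by (simp add: power_divide)
  also have "(p z ^ 2) ^ 3 = p z ^ 4 * p z ^ 2" by (simp flip: power_mult power_add)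
  also have "- 64 / 27 * (u z ^ 2 + 1 / 3) ^ 3 * (k ^ 2 * p z ^ 4) / (p z ^ 4 * p z ^ 2) =
      - 64 / 27 * k ^ 2 * (u z ^ 2 + 1 / 3) ^ 3 / p z ^ 2"
  proof -
    have cancel: "m * N * (K * a) / (a * b) = m * K * N / b" if "a \<noteq> 0" for m N K a b :: complex
      using that by simp
    show ?thesis by (rule cancel) (use p0[OF S(2)] in simp)
  qed
  finally show ?thesis by (simp add: p_def)
qed

lemma equianharmonic_g3:
  assumes "L ^ 6 = - 27 * c / (64::complex)"
  shows "c / 432 = - 4 * (L ^ 2 / 9) ^ 3"
proof -
  have "(L ^ 2 / 9) ^ 3 = L ^ 6 / 729" by (simp add: power_divide flip: power_mult)
  thus ?thesis by (simp add: assms)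
qed

text \<open>
  The Weierstrass coordinates are found as follows. On the curve \<open>w\<^sup>3 = (u\<^sup>3 - u)\<^sup>2\<close> the function
  \<open>t = (u\<^sup>2 - 1) / w\<close> satisfies \<open>t\<^sup>3 + (1/u)\<^sup>2 = 1\<close> and \<open>t' = (2/3) E / u\<close>, which is already a
  Weierstrass equation for \<open>(t, 1/u)\<close>, with the zeros of \<open>u\<close> at infinity. The Moebius transformation
  \<open>X = 3 e / (1 - t) - e\<close> is the translation by a half period; it moves a simple pole of \<open>u\<close> to infinity.
\<close>
lemma uniformise_binomial_ode:
  assumes lat: "complex_lattice \<Lambda>" "lattice_g2 \<Lambda> = 0" "lattice_g3 \<Lambda> = c / 432"
    and L: "L ^ 6 = - 27 * c / 64" "L \<noteq> 0" and e: "e = L ^ 2 / 9"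
    and D: "D sparse_in UNIV" and u: "u holomorphic_on - D" "\<And>z. z \<notin> D \<Longrightarrow> u z ^ 3 \<noteq> u z"
    and E: "E holomorphic_on UNIV" "\<And>z. E z \<noteq> 0"
    and ode: "\<And>z. z \<notin> D \<Longrightarrow> deriv u z ^ 3 = E z ^ 3 * (u z ^ 3 - u z) ^ 2"
  shows "\<exists>g. (\<forall>z. (g has_field_derivative E z / L) (at z)) \<and>
    (\<forall>z. z \<notin> D \<longrightarrow> g z \<notin> \<Lambda> \<longrightarrow> deriv (lattice_wp \<Lambda>) (g z) \<noteq> 0 \<and>
        u z = 2 * (lattice_wp \<Lambda> (g z) + e) ^ 2 / (L * deriv (lattice_wp \<Lambda>) (g z)))"
proof -
  have op: "open (- D)" using sparse_in_UNIV_imp_closed[OF D] by auto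
  have e0: "e \<noteq> 0" unfolding e using L(2) by simp
  have L2: "L ^ 2 = 9 * e" by (simp add: e)
  have g3: "lattice_g3 \<Lambda> = - 4 * e ^ 3" using equianharmonic_g3[OF L(1)] by (simp add: lat e)
  define w where "w = (\<lambda>z. deriv u z / E z)"
  \<comment> \<open>\<open>w\<^sup>3 = u\<^sup>2 (u\<^sup>2 - 1)\<^sup>2\<close> makes \<open>t\<^sup>3\<close> and \<open>t\<^sup>2\<close> simple functions of \<open>u\<close> and \<open>w\<close>\<close>
  define t where "t = (\<lambda>z. (u z ^ 2 - 1) / w z)"
  define X where "X = (\<lambda>z. 3 * e / (1 - t z) - e)"
  define Y where "Y = (\<lambda>z. 2 * (X z + e) ^ 2 / (L * u z))"
  have u0: "u z \<noteq> 0" "u z ^ 2 \<noteq> 1" if "z \<notin> D" for z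
    using u(2)[OF that] by (auto simp: power3_eq_cube power2_eq_square)
  have w3: "w z ^ 3 = u z ^ 2 * (u z ^ 2 - 1) ^ 2" if "z \<notin> D" for z
  proof -
    have "w z ^ 3 = (u z ^ 3 - u z) ^ 2" using ode[OF that] E by (simp add: w_def power_divide)
    also have "u z ^ 3 - u z = u z * (u z ^ 2 - 1)" by (simp add: power3_eq_cube power2_eq_square algebra_simps)
    finally show ?thesis by (simp add: power_mult_distrib)
  qed
  have w0: "w z \<noteq> 0" if "z \<notin> D" for z using w3[OF that] u0[OF that] by auto
  have t3: "t z ^ 3 = 1 - 1 / u z ^ 2" if "z \<notin> D" for z
  proof -
    have "t z ^ 3 = (u z ^ 2 - 1) ^ 3 / (u z ^ 2 * (u z ^ 2 - 1) ^ 2)" by (simp add: t_def power_divide w3[OF that])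
    also have "\<dots> = (u z ^ 2 - 1) / u z ^ 2" using u0[OF that] by (simp add: power3_eq_cube power2_eq_square)
    finally show ?thesis using u0[OF that] by (simp add: diff_divide_distrib)
  qed
  have t1: "1 - t z \<noteq> 0" if "z \<notin> D" for z
  proof
    assume "1 - t z = 0"
    hence "t z ^ 3 = 1" by simp
    thus False using t3[OF that] u0[OF that] by simp
  qed
  have t2: "t z ^ 2 = w z / u z ^ 2" if "z \<notin> D" for z
  proof -
    have "t z ^ 2 = (u z ^ 2 - 1) ^ 2 * w z / w z ^ 3" using w0[OF that] by (simp add: t_def power_divide power2_eq_square power3_eq_cube)
    thus ?thesis using u0[OF that] w0[OF that] by (simp add: w3[OF that])
  qed
  have du: "(u has_field_derivative deriv u z) (at z)" if "z \<notin> D" for z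
    using holomorphic_derivI[OF u(1) op] that by auto
  have EE: "E holomorphic_on - D" by (rule holomorphic_on_subset[OF E(1)]) auto
  have holw: "w holomorphic_on - D" unfolding w_def
    by (intro holomorphic_intros u op EE) (use E in auto)
  have holt: "t holomorphic_on - D" unfolding t_def
    by (intro holomorphic_intros u holw) (use w0 in auto)
  have dt: "(t has_field_derivative 2 / 3 * (E z / u z)) (at z)" if z: "z \<notin> D" for z
  proof -
    have t': "(t has_field_derivative deriv t z) (at z)" using holomorphic_derivI[OF holt op] z by auto
    have "((\<lambda>z. t z ^ 3 * u z ^ 2 - u z ^ 2) has_field_derivative
        (3 * t z ^ 2 * deriv t z * u z ^ 2 + t z ^ 3 * (2 * u z * deriv u z) - 2 * u z * deriv u z)) (at z)"
      using t' du[OF z] by (auto intro!: derivative_eq_intros simp: algebra_simps)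
    moreover have "((\<lambda>z. t z ^ 3 * u z ^ 2 - u z ^ 2) has_field_derivative 0) (at z)"
      by (rule has_field_derivative_transform_within_open[of "\<lambda>_. - 1", OF DERIV_const op])
         (use z u0 in \<open>auto simp: t3 field_simps\<close>)
    ultimately have "3 * t z ^ 2 * deriv t z * u z ^ 2 + t z ^ 3 * (2 * u z * deriv u z) - 2 * u z * deriv u z = 0"
      by (rule DERIV_unique)
    moreover have "deriv u z = w z * E z" using E by (simp add: w_def)
    ultimately have "w z * (3 * deriv t z - 2 * E z / u z) = 0"
      using u0[OF z] unfolding t2[OF z] t3[OF z] by (simp add: field_simps power2_eq_square)
    hence "3 * deriv t z - 2 * E z / u z = 0" using w0[OF z] by simp
    hence "deriv t z = 2 / 3 * (E z / u z)" using u0[OF z] by (simp add: field_simps)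
    thus ?thesis using t' by simp
  qed
  have Xe: "X z + e = 3 * e / (1 - t z)" for z by (simp add: X_def)
  have dX: "(X has_field_derivative E z / L * Y z) (at z)" if z: "z \<notin> D" for z
  proof -
    have "(X has_field_derivative (3 * e * (2 / 3 * (E z / u z)) / ((1 - t z) * (1 - t z)))) (at z)"
      unfolding X_def using t1[OF z] dt[OF z] by (auto intro!: derivative_eq_intros)
    also have "3 * e * (2 / 3 * (E z / u z)) / ((1 - t z) * (1 - t z)) = E z * (18 * e ^ 2) / ((9 * e) * u z * (1 - t z) ^ 2)"
      using e0 by (simp add: power2_eq_square)
    also have "\<dots> = E z / L * Y z"
      unfolding Y_def Xe L2[symmetric] by (simp add: power_divide power2_eq_square mult_ac)
    finally show ?thesis .
  qed
  have Y0: "Y z \<noteq> 0" if "z \<notin> D" for z using u0[OF that] L(2) e0 t1[OF that] by (simp add: Y_def Xe)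
  have "X holomorphic_on - D" using dX op by (subst holomorphic_on_open) auto
  hence holY: "Y holomorphic_on - D" unfolding Y_def
    by (intro holomorphic_intros u) (use u0 L in auto)
  have YX: "Y z ^ 2 = 4 * X z ^ 3 - lattice_g2 \<Lambda> * X z - lattice_g3 \<Lambda>" if z: "z \<notin> D" for z
  proof -
    define s where "s = 1 / (1 - t z)"
    have s: "s \<noteq> 0" "t z = 1 - 1 / s" using t1[OF z] by (auto simp: s_def)
    have Xs: "X z = e * (3 * s - 1)" by (simp add: X_def s_def algebra_simps)
    have "Y z ^ 2 = 4 * (3 * e * s) ^ 4 / (9 * e) * (1 / u z ^ 2)"
      unfolding Y_def Xe by (simp add: s_def power_divide power_mult_distrib L2 flip: power_mult)
    also have "1 / u z ^ 2 = 1 - t z ^ 3" by (simp add: t3[OF z])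
    also have "\<dots> = 3 / s - 3 / s ^ 2 + 1 / s ^ 3"
      unfolding s(2) using s(1) by (simp add: field_simps power2_eq_square power3_eq_cube)
    also have "4 * (3 * e * s) ^ 4 / (9 * e) * (3 / s - 3 / s ^ 2 + 1 / s ^ 3) = 36 * e ^ 3 * (3 * s ^ 3 - 3 * s ^ 2 + s)"
      using s(1) e0 by (simp add: field_simps eval_nat_numeral)
    also have "\<dots> = 4 * X z ^ 3 + 4 * e ^ 3" unfolding Xs by (simp add: algebra_simps eval_nat_numeral)
    finally show ?thesis by (simp add: lat(2) g3)
  qed
  have F: "(\<lambda>z. E z / L) holomorphic_on UNIV" "\<And>z. E z / L \<noteq> 0"
    using E L by (auto intro!: holomorphic_intros)
  obtain g where g: "\<And>z. (g has_field_derivative E z / L) (at z)" 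
     "\<And>z. z \<notin> D \<Longrightarrow> g z \<notin> \<Lambda> \<Longrightarrow> X z = lattice_wp \<Lambda> (g z) \<and> Y z = deriv (lattice_wp \<Lambda>) (g z)"
    using wp_uniformisation[OF lat(1) D F dX holY Y0 YX] by blast
  show ?thesis
  proof (intro exI[of _ g] conjI[OF allI[OF g(1)]] allI impI)
    fix z assume z: "z \<notin> D" "g z \<notin> \<Lambda>"
    have "u z = 2 * (X z + e) ^ 2 / (L * Y z)"
      using u0[OF z(1)] L(2) e0 t1[OF z(1)] by (simp add: Y_def Xe)
    thus "deriv (lattice_wp \<Lambda>) (g z) \<noteq> 0 \<and>
        u z = 2 * (lattice_wp \<Lambda> (g z) + e) ^ 2 / (L * deriv (lattice_wp \<Lambda>) (g z))"
      using g(2)[OF z] Y0[OF z(1)] by simp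
  qed
qed

text \<open>
  The three lemmas on \<open>u = 2 (p + e)\<^sup>2 / (L q)\<close> are the algebra of the explicit solution, with \<open>p\<close> and \<open>q\<close>
  in the place of \<open>\<wp>\<close> and \<open>\<wp>'\<close>. The right-hand side of the Weierstrass equation factors as
  \<open>4 (p + e) (p\<^sup>2 - e p + e\<^sup>2)\<close>.
\<close>
lemma wp_profile_square:
  fixes p q e L :: complex
  assumes "q ^ 2 = 4 * p ^ 3 + 4 * e ^ 3" "q \<noteq> 0" "L ^ 2 = 9 * e"
  shows "(2 * (p + e) ^ 2 / (L * q)) ^ 2 = (p + e) ^ 3 / (9 * e * (p ^ 2 - e * p + e ^ 2))"
    and "p + e \<noteq> 0" "p ^ 2 - e * p + e ^ 2 \<noteq> 0"
proof -
  have f: "q ^ 2 = 4 * (p + e) * (p ^ 2 - e * p + e ^ 2)"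
    unfolding assms(1) by (simp add: algebra_simps power2_eq_square power3_eq_cube)
  have "4 * (p + e) * (p ^ 2 - e * p + e ^ 2) \<noteq> 0" unfolding f[symmetric] using assms(2) by simp
  thus nz: "p + e \<noteq> 0" "p ^ 2 - e * p + e ^ 2 \<noteq> 0" by (auto simp del: distrib_left_numeral)
  have "(2 * (p + e) ^ 2 / (L * q)) ^ 2 = 4 * (p + e) ^ 4 / (9 * e * q ^ 2)"
    by (simp add: power_divide power_mult_distrib assms(3) flip: power_mult)
  also have "\<dots> = (p + e) * (p + e) ^ 3 / ((p + e) * (9 * e * (p ^ 2 - e * p + e ^ 2)))"
  proof -
    have n: "4 * (p + e) ^ 4 = 4 * ((p + e) * (p + e) ^ 3)" by (simp flip: power_Suc)
    have d: "9 * e * q ^ 2 = 4 * ((p + e) * (9 * e * (p ^ 2 - e * p + e ^ 2)))" unfolding f by (simp only: mult_ac)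
    show ?thesis unfolding n d by (rule nonzero_mult_divide_mult_cancel_left) simp
  qed
  also have "\<dots> = (p + e) ^ 3 / (9 * e * (p ^ 2 - e * p + e ^ 2))" using nz(1) by (rule nonzero_mult_divide_mult_cancel_left)
  finally show "(2 * (p + e) ^ 2 / (L * q)) ^ 2 = (p + e) ^ 3 / (9 * e * (p ^ 2 - e * p + e ^ 2))" .
qed

lemma wp_profile_explicit:
  fixes p q e L :: complex
  assumes "q ^ 2 = 4 * p ^ 3 + 4 * e ^ 3" "q \<noteq> 0" "L ^ 2 = 9 * e" "L \<noteq> 0"
  shows "9 * (9 * p + L ^ 2) * q / (2 * L * (81 * p ^ 2 - 9 * L ^ 2 * p + L ^ 4)) = 2 * (p + e) ^ 2 / (L * q)"
proof -
  have L4: "L ^ 4 = 81 * e ^ 2"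
  proof -
    have "L ^ 4 = (L ^ 2) ^ 2" by (simp flip: power_mult)
    thus ?thesis by (simp add: assms(3) power_mult_distrib)
  qed
  define d where "d = p ^ 2 - e * p + e ^ 2"
  have d: "d \<noteq> 0" "q * q = 4 * (p + e) * d"
    using wp_profile_square(3)[OF assms(1-3)] assms(1)
    by (auto simp: d_def algebra_simps power2_eq_square power3_eq_cube)
  have "9 * (9 * p + L ^ 2) * q / (2 * L * (81 * p ^ 2 - 9 * L ^ 2 * p + L ^ 4)) = 81 * ((p + e) * q) / (81 * (2 * L * d))"
    unfolding L4 assms(3) d_def by (simp add: algebra_simps)
  also have "\<dots> = (p + e) * q / (2 * L * d)" by (rule nonzero_mult_divide_mult_cancel_left) simp
  also have "\<dots> = (p + e) * (q * q) / (2 * L * d * q)" using assms(2) by simp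
  also have "\<dots> = 2 * (p + e) ^ 2 / (L * q)" unfolding d(2)
  proof -
    have "s * (4 * s * d) / (2 * L * d * q) = 2 * s ^ 2 / (L * q)" for s
      using d(1) by (simp add: power2_eq_square)
    thus "(p + e) * (4 * (p + e) * d) / (2 * L * d * q) = 2 * (p + e) ^ 2 / (L * q)" .
  qed
  finally show ?thesis .
qed

section \<open>From the Schwarzian equation to the explicit solutions\<close>

lemma square_product_over_roots:
  fixes u :: complex
  assumes "{\<tau>1, \<tau>2, \<tau>3} = {0, 1, -1}"
  shows "(u - \<tau>1) ^ 2 * (u - \<tau>2) ^ 2 * (u - \<tau>3) ^ 2 = (u ^ 3 - u) ^ 2"
proof -
  have "card {\<tau>1, \<tau>2, \<tau>3} = 3" unfolding assms by simp
  hence d: "\<tau>1 \<noteq> \<tau>2" "\<tau>1 \<noteq> \<tau>3" "\<tau>2 \<noteq> \<tau>3" by (auto simp: card_insert_if split: if_splits)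
  have "(\<Prod>\<tau>\<in>{\<tau>1, \<tau>2, \<tau>3}. (u - \<tau>) ^ 2) = (\<Prod>\<tau>\<in>{0, 1, -1}. (u - \<tau>) ^ 2)" unfolding assms ..
  hence "(u - \<tau>1) ^ 2 * (u - \<tau>2) ^ 2 * (u - \<tau>3) ^ 2 = u ^ 2 * (u - 1) ^ 2 * (u + 1) ^ 2"
    using d by (simp add: mult.assoc)
  also have "\<dots> = (u ^ 3 - u) ^ 2" by (simp add: algebra_simps power2_eq_square power3_eq_cube)
  finally show ?thesis .
qed

text \<open>
  A meromorphic function that takes a value on a set with a limit point is constant, hence rational.
\<close>
lemma transcendental_avoids_value:
  assumes "transcendental_meromorphic u"
  shows "\<forall>\<^sub>\<approx>z\<in>UNIV. u z \<noteq> a"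
proof (rule ccontr)
  assume "\<not> ?thesis"
  hence "\<forall>\<^sub>\<approx>z\<in>UNIV. u z = a"
    using meromorphic_imp_constant_or_avoid[OF _ open_UNIV connected_UNIV] assms
    unfolding transcendental_meromorphic_def by blast
  hence "\<forall>\<^sub>\<approx>z\<in>UNIV. u z = poly [:a:] z / poly 1 z" by simp
  thus False using assms unfolding transcendental_meromorphic_def by (metis one_neq_zero)
qed

lemma transcendental_avoids_poly_roots:
  assumes "transcendental_meromorphic u" and "q \<noteq> 0"
  shows "\<forall>\<^sub>\<approx>z\<in>UNIV. poly q (u z) \<noteq> 0"
proof -
  have "\<forall>\<^sub>\<approx>z\<in>UNIV. \<forall>a\<in>{a. poly q a = 0}. u z \<noteq> a"
    by (rule eventually_ball_finite) (use poly_roots_finite[OF assms(2)] transcendental_avoids_value[OF assms(1)] in auto)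
  thus ?thesis by eventually_elim auto
qed

lemma coefficients_of_schwarzian_identity:
  fixes c k \<sigma>1 \<sigma>2 :: complex
  assumes c: "c \<noteq> 0"
    and p: "\<And>x. - 64 / 27 * k ^ 2 * (x ^ 2 + 1 / 3) ^ 3 = c * ((x - \<sigma>1) ^ 3 * (x - \<sigma>2) ^ 3)"
  shows "{\<sigma>1, \<sigma>2} = {\<i> / of_real (sqrt 3), - (\<i> / of_real (sqrt 3))}" "k ^ 2 = - 27 * c / 64"
proof -
  define \<alpha> where "\<alpha> = \<i> / of_real (sqrt 3)"
  have a2: "\<alpha> ^ 2 = - 1 / 3" by (simp add: \<alpha>_def power_divide flip: of_real_power)
  have a0: "\<alpha> \<noteq> 0" "\<alpha> \<noteq> - \<alpha>" by (auto simp: \<alpha>_def)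
  have s: "x = \<sigma>1 \<or> x = \<sigma>2" if "x ^ 2 = - 1 / 3" for x
    using p[of x] c that by auto
  have "\<alpha> = \<sigma>1 \<or> \<alpha> = \<sigma>2" "- \<alpha> = \<sigma>1 \<or> - \<alpha> = \<sigma>2" using s[of \<alpha>] s[of "- \<alpha>"] a2 by auto
  hence cases: "\<sigma>1 = \<alpha> \<and> \<sigma>2 = - \<alpha> \<or> \<sigma>1 = - \<alpha> \<and> \<sigma>2 = \<alpha>" using a0 by auto
  thus "{\<sigma>1, \<sigma>2} = {\<i> / of_real (sqrt 3), - (\<i> / of_real (sqrt 3))}" unfolding \<alpha>_def[symmetric] by auto
  have s12: "\<sigma>1 * \<sigma>2 = 1 / 3" using cases a2 by (auto simp: power2_eq_square)
  have "- 64 / 27 * k ^ 2 * (1 / 3) ^ 3 = c * ((0 - \<sigma>1) ^ 3 * (0 - \<sigma>2) ^ 3)" using p[of 0] by simp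
  also have "(0 - \<sigma>1) ^ 3 * (0 - \<sigma>2) ^ 3 = (\<sigma>1 * \<sigma>2) ^ 3" by (simp add: power3_eq_cube)
  also have "\<dots> = (1 / 3) ^ 3" unfolding s12 ..
  finally have "- 64 / 27 * k ^ 2 = c" unfolding mult_cancel_right by simp
  from this[symmetric] show "k ^ 2 = - 27 * c / 64" by simp
qed

lemma cube_product_over_sigma:
  fixes x :: complex
  assumes "{\<sigma>1, \<sigma>2} = {\<i> / of_real (sqrt 3), - (\<i> / of_real (sqrt 3))}"
  shows "(x - \<sigma>1) ^ 3 * (x - \<sigma>2) ^ 3 = (x ^ 2 + 1 / 3) ^ 3"
proof -
  define \<alpha> where "\<alpha> = \<i> / of_real (sqrt 3)"
  have a2: "\<alpha> * \<alpha> = - 1 / 3" by (simp add: \<alpha>_def power_divide flip: of_real_power of_real_mult power2_eq_square)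
  have "\<sigma>1 = \<alpha> \<and> \<sigma>2 = - \<alpha> \<or> \<sigma>1 = - \<alpha> \<and> \<sigma>2 = \<alpha>"
    using assms unfolding \<alpha>_def[symmetric] by (auto simp: doubleton_eq_iff)
  hence "(x - \<sigma>1) * (x - \<sigma>2) = x ^ 2 + 1 / 3" using a2 by (auto simp: algebra_simps power2_eq_square)
  thus ?thesis by (simp flip: power_mult_distrib)
qed

text \<open>
  The limits found locally make \<open>u'\<^sup>3 / (u\<^sup>3 - u)\<^sup>2\<close> an entire function without zeros after its removable
  singularities are removed. Such a function has a holomorphic logarithm, hence an entire cube root
  \<open>E\<close>. All further identities are used on the complement of a sparse set \<open>D\<close> on which \<open>u\<close> is holomorphic.
\<close>
lemma solution_first_integral:
  fixes c \<sigma>1 \<sigma>2 :: complex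
  assumes c: "c \<noteq> 0" and \<sigma>: "\<sigma>1 ^ 3 \<noteq> \<sigma>1" "\<sigma>2 ^ 3 \<noteq> \<sigma>2"
    and tr: "transcendental_meromorphic u"
    and ode: "\<forall>\<^sub>\<approx>z\<in>UNIV. schwarzian u z ^ 3 = c * ((u z - \<sigma>1) ^ 3 * (u z - \<sigma>2) ^ 3) / (u z ^ 3 - u z) ^ 2"
  obtains E D M where "E holomorphic_on UNIV" "\<And>z. E z \<noteq> 0" "D sparse_in UNIV" "u holomorphic_on - D"
    "\<And>z. z \<notin> D \<Longrightarrow> u z ^ 3 \<noteq> u z" "\<And>z. z \<notin> D \<Longrightarrow> deriv u z ^ 3 = E z ^ 3 * (u z ^ 3 - u z) ^ 2"
    "\<And>z. (u \<longlongrightarrow> 0) (at z) \<Longrightarrow> norm (E z) \<le> M"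
proof -
  have mer: "u meromorphic_on UNIV" using tr by (simp add: transcendental_meromorphic_def)
  hence mer1: "u meromorphic_on {x}" for x by (rule meromorphic_on_subset) auto
  have nc: "\<not> (\<forall>\<^sub>F z in at x. u z = a)" for x a
  proof
    assume "\<forall>\<^sub>F z in at x. u z = a"
    moreover have "\<forall>\<^sub>F z in at x. u z \<noteq> a"
      using transcendental_avoids_value[OF tr, of a] by (rule eventually_cosparse_imp_eventually_at) auto
    ultimately have "\<forall>\<^sub>F z in at x. False" by eventually_elim auto
    thus False by simp
  qed
  define h where "h = (\<lambda>z. deriv u z ^ 3 / (u z ^ 3 - u z) ^ 2)"
  define K where "K = - 729 * c * (\<sigma>1 * \<sigma>2) ^ 3 / 64"
  have loc: "\<exists>l. l \<noteq> 0 \<and> (h \<longlongrightarrow> l) (at x) \<and> ((u \<longlongrightarrow> 0) (at x) \<longrightarrow> l ^ 2 = K)" for x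
    unfolding h_def K_def
    by (rule schwarzian_equation_local[OF mer1 nc c \<sigma>])
       (use eventually_cosparse_imp_eventually_at[OF ode] in auto)
  have merh: "h meromorphic_on UNIV" unfolding h_def by (intro meromorphic_intros mer)
  define H where "H = remove_sings h"
  have H: "H x \<noteq> 0" "(u \<longlongrightarrow> 0) (at x) \<Longrightarrow> H x ^ 2 = K" "H analytic_on {x}" for x
  proof -
    obtain l where l: "l \<noteq> 0" "(h \<longlongrightarrow> l) (at x)" "(u \<longlongrightarrow> 0) (at x) \<longrightarrow> l ^ 2 = K" using loc by blast
    have "H x = l" unfolding H_def by (rule remove_sings_eqI[OF l(2)])
    thus "H x \<noteq> 0" "(u \<longlongrightarrow> 0) (at x) \<Longrightarrow> H x ^ 2 = K" using l by auto
    have "h meromorphic_on {x}" by (rule meromorphic_on_subset[OF merh]) auto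
    thus "H analytic_on {x}" unfolding H_def
      by (intro remove_sings_analytic_at[OF _ l(2)]) (simp add: meromorphic_at_iff)
  qed
  have "H analytic_on UNIV" using H(3) analytic_on_analytic_at by blast
  hence holH: "H holomorphic_on UNIV" by (rule analytic_imp_holomorphic)
  obtain g where g: "g holomorphic_on UNIV" "\<And>z. exp (g z) = H z"
    by (rule holomorphic_logarithm_exists[OF convex_UNIV open_UNIV holH H(1) UNIV_I[of 0]]) auto
  define E where "E = (\<lambda>z. exp (g z / 3))"
  have E: "E holomorphic_on UNIV" "E z \<noteq> 0" "E z ^ 3 = H z" for z
    using g by (auto simp: E_def intro!: holomorphic_intros simp flip: exp_of_nat_mult)
  define D where "D = {z. \<not> (u analytic_on {z} \<and> h z = H z)}"
  have "\<forall>\<^sub>\<approx>z\<in>UNIV. u analytic_on {z} \<and> h z = H z"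
    using meromorphic_on_imp_analytic_cosparse[OF mer] eventually_remove_sings_eq[OF merh]
    by eventually_elim (auto simp: H_def)
  hence D: "D sparse_in UNIV" unfolding D_def eventually_cosparse .
  have hu: "u holomorphic_on - D"
    by (rule analytic_imp_holomorphic, subst analytic_on_analytic_at) (auto simp: D_def)
  have nz: "u z ^ 3 \<noteq> u z" if "z \<notin> D" for z
  proof
    assume "u z ^ 3 = u z"
    hence "h z = 0" by (simp add: h_def)
    thus False using H(1)[of z] that by (auto simp: D_def)
  qed
  have eq: "deriv u z ^ 3 = E z ^ 3 * (u z ^ 3 - u z) ^ 2" if "z \<notin> D" for z
  proof -
    have "E z ^ 3 = deriv u z ^ 3 / (u z ^ 3 - u z) ^ 2" using that E(3)[of z] by (auto simp: D_def h_def)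
    thus ?thesis using nz[OF that] by simp
  qed
  have bound: "norm (E z) \<le> 1 + norm K" if "(u \<longlongrightarrow> 0) (at z)" for z
  proof (rule ccontr)
    assume "\<not> ?thesis"
    hence *: "norm (E z) > 1 + norm K" by simp
    have "(E z ^ 3) ^ 2 = K" using H(2)[OF that] E(3) by simp
    hence "norm ((E z ^ 3) ^ 2) = norm K" by simp
    hence "norm (E z) ^ 6 = norm K" by (simp add: norm_power flip: power_mult)
    moreover have "1 \<le> norm (E z)" using * norm_ge_zero[of K] by linarith
    hence "norm (E z) ^ 1 \<le> norm (E z) ^ 6" by (intro power_increasing) auto
    ultimately show False using * by simp
  qed
  show ?thesis by (rule that[OF E(1,2) D hu nz eq bound])
qed

text \<open>
  Near a point where \<open>\<wp>(g) = - e\<close>, the uniformised form shows that \<open>u\<close> tends to \<open>0\<close>, so \<open>E\<close> is bounded there.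
  Since \<open>\<wp>\<close> takes the value \<open>- e\<close> on a whole translate of the lattice, the rigidity lemma applies to \<open>g\<close>.
\<close>
lemma bounded_multiplier_constant:
  assumes c: "c \<noteq> 0" and lat: "complex_lattice \<Lambda>" "lattice_g2 \<Lambda> = 0" "lattice_g3 \<Lambda> = c / 432"
    and E: "E holomorphic_on UNIV" "\<And>z. E z \<noteq> 0" and D: "D sparse_in UNIV" "u holomorphic_on - D"
    "\<And>z. z \<notin> D \<Longrightarrow> u z ^ 3 \<noteq> u z" "\<And>z. z \<notin> D \<Longrightarrow> deriv u z ^ 3 = E z ^ 3 * (u z ^ 3 - u z) ^ 2"
    and M: "\<And>z. (u \<longlongrightarrow> 0) (at z) \<Longrightarrow> norm (E z) \<le> M"
  shows "\<exists>E0. \<forall>z. E z = E0"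
proof -
  let ?p = "lattice_wp \<Lambda>"
  \<comment> \<open>any sixth root serves here; only afterwards is \<open>L\<close> adapted to \<open>u\<close>\<close>
  obtain L where "- 27 * c / 64 = L ^ 6" using exists_complex_root[of 6 "- 27 * c / 64"] by auto
  hence L: "L ^ 6 = - 27 * c / 64" "L \<noteq> 0" using c by auto
  define e where "e = L ^ 2 / 9"
  have e0: "e \<noteq> 0" using L(2) by (simp add: e_def)
  have L2: "L ^ 2 = 9 * e" by (simp add: e_def)
  have g3: "lattice_g3 \<Lambda> = - 4 * e ^ 3" using equianharmonic_g3[OF L(1)] by (simp add: lat e_def)
  obtain g where g: "\<And>z. (g has_field_derivative E z / L) (at z)"
    "\<And>z. z \<notin> D \<Longrightarrow> g z \<notin> \<Lambda> \<Longrightarrow> deriv ?p (g z) \<noteq> 0 \<and> u z = 2 * (?p (g z) + e) ^ 2 / (L * deriv ?p (g z))"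
    using uniformise_binomial_ode[OF lat L e_def D(1-3) E D(4)] by blast
  have zero: "(u \<longlongrightarrow> 0) (at x)" if x: "g x \<notin> \<Lambda>" "?p (g x) = - e" for x
  proof -
    have gc: "isCont g x" by (rule DERIV_isCont[OF g(1)])
    have pc: "isCont (\<lambda>z. ?p (g z)) x"
      by (rule isCont_o2[OF gc DERIV_isCont[OF wp_has_deriv[OF lat(1) x(1)]]])
    have lim: "((\<lambda>z. ?p (g z)) \<longlongrightarrow> - e) (at x)" using pc x(2) by (simp add: isCont_def)
    have evD: "\<forall>\<^sub>F z in at x. z \<notin> D" using D(1) by (simp add: sparse_in_eventually_iff)
    have evL: "\<forall>\<^sub>F z in at x. g z \<in> - \<Lambda>"
      by (rule topological_tendstoD[OF gc[unfolded isCont_def] lattice_open_compl[OF lat(1)]]) (use x in auto)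
    have "((\<lambda>z. (?p (g z) + e) ^ 3 / (9 * e * (?p (g z) ^ 2 - e * ?p (g z) + e ^ 2))) \<longlongrightarrow>
        (- e + e) ^ 3 / (9 * e * ((- e) ^ 2 - e * (- e) + e ^ 2))) (at x)"
      using e0 by (intro tendsto_intros lim) (auto simp: power2_eq_square)
    moreover have "\<forall>\<^sub>F z in at x. (?p (g z) + e) ^ 3 / (9 * e * (?p (g z) ^ 2 - e * ?p (g z) + e ^ 2)) = u z ^ 2"
      using evD evL
    proof eventually_elim
      case (elim z)
      hence gz: "g z \<notin> \<Lambda>" by simp
      have q: "deriv ?p (g z) ^ 2 = 4 * ?p (g z) ^ 3 + 4 * e ^ 3"
        using wp_differential_equation[OF lat(1) gz] by (simp add: lat(2) g3)
      have "deriv ?p (g z) \<noteq> 0" "u z = 2 * (?p (g z) + e) ^ 2 / (L * deriv ?p (g z))"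
        using g(2)[OF elim(1) gz] by auto
      thus ?case using wp_profile_square(1)[OF q _ L2] by simp
    qed
    ultimately have "((\<lambda>z. u z ^ 2) \<longlongrightarrow> (- e + e) ^ 3 / (9 * e * ((- e) ^ 2 - e * (- e) + e ^ 2))) (at x)"
      by (rule Lim_transform_eventually)
    hence "((\<lambda>z. sqrt (norm (u z ^ 2))) \<longlongrightarrow> sqrt (norm (0 :: complex))) (at x)"
      by (intro tendsto_intros) simp
    thus ?thesis by (simp add: norm_power tendsto_norm_zero_iff)
  qed
  obtain \<zeta> where \<zeta>: "\<zeta> \<notin> \<Lambda>" "?p \<zeta> = - e" using wp_surj[OF lat(1)] by blast
  define N where "N = (\<lambda>\<omega>. \<zeta> + \<omega>) ` \<Lambda>"
  obtain R where R: "R > 0" "\<And>z. \<exists>\<omega>\<in>\<Lambda>. dist z \<omega> < R" using complex_lattice_covering[OF lat(1)] by blast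
  have "\<exists>c. \<forall>z. deriv g z = c"
  proof (rule deriv_const_of_bounded_on_net_preimage[OF _ R(1)])
    show "g holomorphic_on UNIV" using g(1) holomorphic_on_open[OF open_UNIV] by blast
    show "\<exists>\<omega>\<in>N. dist z \<omega> < R" for z
    proof -
      obtain \<omega> where "\<omega> \<in> \<Lambda>" "dist (z - \<zeta>) \<omega> < R" using R(2) by blast
      thus ?thesis unfolding N_def by (intro bexI[of _ "\<zeta> + \<omega>"]) (auto simp: dist_norm algebra_simps)
    qed
    fix z assume "g z \<in> N"
    then obtain \<omega> where \<omega>: "\<omega> \<in> \<Lambda>" "g z = \<zeta> + \<omega>" by (auto simp: N_def)
    have "(u \<longlongrightarrow> 0) (at z)"
      using \<omega> \<zeta> complex_lattice_add_iff[OF lat(1) \<omega>(1)] wp_periodic[OF lat(1) \<omega>(1) \<zeta>(1)] by (intro zero) auto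
    hence "norm (E z) \<le> M" by (rule M)
    thus "norm (deriv g z) \<le> M / norm L" unfolding DERIV_imp_deriv[OF g(1)]
      by (simp add: norm_divide divide_right_mono)
  qed
  then obtain k where "\<And>z. E z / L = k" using DERIV_imp_deriv[OF g(1)] by auto
  hence "\<And>z. E z = k * L" using L(2) by (auto simp: field_simps)
  thus ?thesis by blast
qed

text \<open>
  Once \<open>E\<close> is constant, comparing the two expressions for the cube of the Schwarzian on the infinitely
  many values of \<open>u\<close> determines the parameters. Uniformising again, now with \<open>L\<close> equal to that constant, gives
  \<open>g' = 1\<close>.
\<close>
lemma schwarzian_solution_explicit:
  fixes c \<sigma>1 \<sigma>2 :: complex
  assumes c: "c \<noteq> 0" and \<sigma>: "\<sigma>1 ^ 3 \<noteq> \<sigma>1" "\<sigma>2 ^ 3 \<noteq> \<sigma>2"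
    and tr: "transcendental_meromorphic u"
    and ode: "\<forall>\<^sub>\<approx>z\<in>UNIV. schwarzian u z ^ 3 = c * ((u z - \<sigma>1) ^ 3 * (u z - \<sigma>2) ^ 3) / (u z ^ 3 - u z) ^ 2"
  shows "{\<sigma>1, \<sigma>2} = {\<i> / of_real (sqrt 3), - (\<i> / of_real (sqrt 3))} \<and>
     (\<exists>L z0. L ^ 6 = - 27 * c / 64 \<and> (\<forall>\<^sub>\<approx>z\<in>UNIV. u z = explicit_solution c L z0 z))"
proof -
  have "c / 432 \<noteq> 0" using c by simp
  then obtain \<Lambda> where lat: "complex_lattice \<Lambda>" "lattice_g2 \<Lambda> = 0" "lattice_g3 \<Lambda> = c / 432"
    and wp: "weierstrass_wp 0 (c / 432) = lattice_wp \<Lambda>"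
    by (rule weierstrass_wp_equianharmonic)
  let ?p = "lattice_wp \<Lambda>"
  obtain E D M where E: "E holomorphic_on UNIV" "\<And>z. E z \<noteq> 0" and D: "D sparse_in UNIV" "u holomorphic_on - D"
    "\<And>z. z \<notin> D \<Longrightarrow> u z ^ 3 \<noteq> u z" "\<And>z. z \<notin> D \<Longrightarrow> deriv u z ^ 3 = E z ^ 3 * (u z ^ 3 - u z) ^ 2"
    and M: "\<And>z. (u \<longlongrightarrow> 0) (at z) \<Longrightarrow> norm (E z) \<le> M"
    by (rule solution_first_integral[OF c \<sigma> tr ode]) (rule that; assumption)
  obtain L where EL: "\<And>z. E z = L" using bounded_multiplier_constant[OF c lat E D M] by blast
  have L0: "L \<noteq> 0" using E(2) EL by auto
  have op: "open (- D)" using sparse_in_UNIV_imp_closed[OF D(1)] by auto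
  have evD: "\<forall>\<^sub>\<approx>z\<in>UNIV. z \<notin> D" by (rule eventually_not_in_cosparse[OF D(1)])
  define k where "k = L ^ 3"
  \<comment> \<open>the difference of the numerators of the two expressions for \<open>S(u,z)\<^sup>3\<close>, as a polynomial in \<open>u\<close>\<close>
  define q where "q = smult (- 64 / 27 * k ^ 2) ([:1/3, 0, 1:] ^ 3) - smult c (([:-\<sigma>1, 1:] ^ 3) * ([:-\<sigma>2, 1:] ^ 3))"
  have pq: "poly q x = - 64 / 27 * k ^ 2 * (x ^ 2 + 1 / 3) ^ 3 - c * ((x - \<sigma>1) ^ 3 * (x - \<sigma>2) ^ 3)" for x
    by (simp add: q_def power2_eq_square algebra_simps)
  have "\<forall>\<^sub>\<approx>z\<in>UNIV. poly q (u z) = 0"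
    using evD ode
  proof eventually_elim
    case (elim z)
    have "schwarzian u z ^ 3 = - 64 / 27 * k ^ 2 * (u z ^ 2 + 1 / 3) ^ 3 / (u z ^ 3 - u z) ^ 2"
      by (rule schwarzian_cube_of_binomial_ode[OF op _ D(2)]) (use elim L0 D(3,4) EL in \<open>auto simp: k_def\<close>)
    hence "- 64 / 27 * k ^ 2 * (u z ^ 2 + 1 / 3) ^ 3 / (u z ^ 3 - u z) ^ 2 = c * ((u z - \<sigma>1) ^ 3 * (u z - \<sigma>2) ^ 3) / (u z ^ 3 - u z) ^ 2"
      using elim(2) by simp
    moreover have "(u z ^ 3 - u z) ^ 2 \<noteq> 0" using D(3) elim(1) by simp
    ultimately have "- 64 / 27 * k ^ 2 * (u z ^ 2 + 1 / 3) ^ 3 = c * ((u z - \<sigma>1) ^ 3 * (u z - \<sigma>2) ^ 3)"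
      using divide_cancel_right by blast
    thus ?case unfolding pq by simp
  qed
  hence "q = 0"
  proof (rule contrapos_pp)
    assume "q \<noteq> 0"
    show "\<not> (\<forall>\<^sub>\<approx>z\<in>UNIV. poly q (u z) = 0)"
    proof
      assume "\<forall>\<^sub>\<approx>z\<in>UNIV. poly q (u z) = 0"
      with transcendental_avoids_poly_roots[OF tr \<open>q \<noteq> 0\<close>] have "\<forall>\<^sub>\<approx>z\<in>(UNIV::complex set). False"
        by eventually_elim auto
      thus False by simp
    qed
  qed
  hence id: "- 64 / 27 * k ^ 2 * (x ^ 2 + 1 / 3) ^ 3 = c * ((x - \<sigma>1) ^ 3 * (x - \<sigma>2) ^ 3)" for x
    using pq[of x] by simp
  note co = coefficients_of_schwarzian_identity[OF c id]
  have L: "L ^ 6 = - 27 * c / 64" using co(2) by (simp add: k_def flip: power_mult)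
  define e where "e = L ^ 2 / 9"
  have L2: "L ^ 2 = 9 * e" by (simp add: e_def)
  have g3: "lattice_g3 \<Lambda> = - 4 * e ^ 3" using equianharmonic_g3[OF L] by (simp add: lat e_def)
  obtain g where g: "\<And>z. (g has_field_derivative E z / L) (at z)"
    "\<And>z. z \<notin> D \<Longrightarrow> g z \<notin> \<Lambda> \<Longrightarrow> deriv ?p (g z) \<noteq> 0 \<and> u z = 2 * (?p (g z) + e) ^ 2 / (L * deriv ?p (g z))"
    using uniformise_binomial_ode[OF lat L L0 e_def D(1-3) E D(4)] by blast
  have "((\<lambda>z. g z - z) has_field_derivative 0) (at z)" for z
    using DERIV_diff[OF g(1) DERIV_ident, of z] EL L0 by simp
  hence "(\<lambda>z. g z - z) constant_on UNIV"
    by (intro has_field_derivative_0_imp_constant_on) auto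
  then obtain b where b: "\<And>z. g z - z = b" by (auto simp: constant_on_def)
  hence gz: "g z = z - (- b)" for z using b[of z] by (simp add: algebra_simps)
  have "g -` \<Lambda> sparse_in UNIV"
    by (rule sparse_vimage_nonzero_deriv[OF complex_lattice_sparse[OF lat(1)] g(1)]) (use E L0 in auto)
  hence "\<forall>\<^sub>\<approx>z\<in>UNIV. g z \<notin> \<Lambda>" using eventually_not_in_cosparse[of "g -` \<Lambda>" UNIV] by simp
  with evD have "\<forall>\<^sub>\<approx>z\<in>UNIV. u z = explicit_solution c L (- b) z"
  proof eventually_elim
    case (elim z)
    have q: "deriv ?p (g z) ^ 2 = 4 * ?p (g z) ^ 3 + 4 * e ^ 3"
      using wp_differential_equation[OF lat(1) elim(2)] by (simp add: lat(2) g3)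
    have u: "deriv ?p (g z) \<noteq> 0" "u z = 2 * (?p (g z) + e) ^ 2 / (L * deriv ?p (g z))"
      using g(2)[OF elim] by auto
    have "u z = 9 * (9 * ?p (g z) + L ^ 2) * deriv ?p (g z) / (2 * L * (81 * ?p (g z) ^ 2 - 9 * L ^ 2 * ?p (g z) + L ^ 4))"
      unfolding u(2) by (rule wp_profile_explicit[OF q u(1) L2 L0, symmetric])
    thus ?case unfolding explicit_solution_def wp Let_def gz .
  qed
  thus ?thesis using co(1) L by blast
qed

section \<open>The explicit solutions solve the equation\<close>

lemma eventually_cosparse_shift:
  fixes a :: complex
  assumes "\<forall>\<^sub>\<approx>z\<in>UNIV. P z"
  shows "\<forall>\<^sub>\<approx>z\<in>UNIV. P (z + a)"
proof -
  have "\<forall>\<^sub>F z in at x. P (z + a)" for x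
  proof -
    have "\<forall>\<^sub>F z in at (x + a). P z" using assms by (rule eventually_cosparse_imp_eventually_at) auto
    moreover have "filterlim (\<lambda>z. z + a) (at (x + a)) (at x)"
      by (intro filterlim_atI tendsto_intros) (auto simp: eventually_at_filter)
    ultimately show ?thesis by (simp add: filterlim_iff)
  qed
  thus ?thesis by (simp add: eventually_cosparse_open_eq)
qed

lemma lattice_infinite:
  assumes lat: "complex_lattice \<Lambda>"
  shows "infinite \<Lambda>"
proof
  assume fin: "finite \<Lambda>"
  obtain \<omega>1 \<omega>2 where w: "\<omega>2 / \<omega>1 \<notin> \<real>" "\<Lambda> = {of_int m * \<omega>1 + of_int n * \<omega>2 | m n. True}"
    using lat unfolding complex_lattice_def by auto
  have "\<omega>1 \<noteq> 0" using w by auto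
  hence "inj (\<lambda>m::int. of_int m * \<omega>1)" by (auto simp: inj_def)
  moreover have "range (\<lambda>m::int. of_int m * \<omega>1) \<subseteq> \<Lambda>"
  proof clarify
    fix m :: int
    have "of_int m * \<omega>1 = of_int m * \<omega>1 + of_int 0 * \<omega>2" by simp
    thus "of_int m * \<omega>1 \<in> \<Lambda>" unfolding w(2) by blast
  qed
  ultimately have "finite (UNIV :: int set)" using fin by (metis finite_imageD finite_subset)
  thus False by simp
qed

text \<open>
  The left-hand side is the quotient rule applied to \<open>2 (p + e)\<^sup>2 / (L q)\<close> with \<open>p' = q\<close> and \<open>q' = 6 p\<^sup>2\<close>.
\<close>
lemma wp_profile_deriv:
  fixes p q e L :: complex
  assumes q: "q ^ 2 = 4 * p ^ 3 + 4 * e ^ 3" "q \<noteq> 0" and L: "L ^ 2 = 9 * e" "L \<noteq> 0"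
  shows "(2 * (2 * (p + e) * q) * (L * q) - 2 * (p + e) ^ 2 * (L * (6 * p ^ 2))) / ((L * q) * (L * q)) =
    (p + e) * (p - 2 * e) ^ 2 / (L * (p ^ 2 - e * p + e ^ 2))"
proof -
  define d where "d = p ^ 2 - e * p + e ^ 2"
  have nz: "p + e \<noteq> 0" "d \<noteq> 0" using wp_profile_square(2,3)[OF q L(1)] by (auto simp: d_def)
  have q2: "q ^ 2 = 4 * (p + e) * d" unfolding q(1) d_def by (simp add: algebra_simps power2_eq_square power3_eq_cube)
  have "2 * (2 * (p + e) * q) * (L * q) - 2 * (p + e) ^ 2 * (L * (6 * p ^ 2)) = L * (p + e) * (4 * q ^ 2 - 12 * (p + e) * p ^ 2)"
    by (simp add: algebra_simps power2_eq_square)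
  also have "4 * q ^ 2 - 12 * (p + e) * p ^ 2 = 4 * ((p + e) * (p - 2 * e) ^ 2)"
    unfolding q(1) by (simp add: algebra_simps power2_eq_square power3_eq_cube)
  finally have "(2 * (2 * (p + e) * q) * (L * q) - 2 * (p + e) ^ 2 * (L * (6 * p ^ 2))) / ((L * q) * (L * q)) =
     L * (p + e) * (4 * ((p + e) * (p - 2 * e) ^ 2)) / (L * L * q ^ 2)" by (simp add: power2_eq_square mult_ac)
  also have "\<dots> = (p + e) * (p - 2 * e) ^ 2 / (L * d)"
  proof -
    have cancel: "L * s * (4 * (s * r)) / (L * L * (4 * s * d)) = s * r / (L * d)" if "s \<noteq> 0" for s r
      using that L(2) by (simp add: divide_simps)
    show ?thesis unfolding q2 by (rule cancel[OF nz(1)])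
  qed
  finally show ?thesis by (simp add: d_def)
qed

lemma wp_profile_ode:
  fixes p q e L :: complex
  assumes q: "q ^ 2 = 4 * p ^ 3 + 4 * e ^ 3" "q \<noteq> 0" and L: "L ^ 2 = 9 * e" "L \<noteq> 0"
    and u: "u = 2 * (p + e) ^ 2 / (L * q)"
  shows "((p + e) * (p - 2 * e) ^ 2 / (L * (p ^ 2 - e * p + e ^ 2))) ^ 3 = L ^ 3 * (u ^ 3 - u) ^ 2"
    and "p \<noteq> 2 * e \<Longrightarrow> u ^ 3 \<noteq> u"
proof -
  define d where "d = p ^ 2 - e * p + e ^ 2"
  have nz: "p + e \<noteq> 0" "d \<noteq> 0" using wp_profile_square(2,3)[OF q L(1)] by (auto simp: d_def)
  have e0: "e \<noteq> 0" using L by auto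
  have u2: "u ^ 2 = (p + e) ^ 3 / (L ^ 2 * d)"
    using wp_profile_square(1)[OF q L(1)] by (simp add: u d_def L(1))
  have u21: "u ^ 2 - 1 = (p - 2 * e) ^ 3 / (L ^ 2 * d)"
  proof -
    have "(p + e) ^ 3 - 9 * e * d = (p - 2 * e) ^ 3" by (simp add: d_def algebra_simps power2_eq_square power3_eq_cube)
    moreover have "A / M - 1 = B / M" if "A - M = B" "M \<noteq> 0" for A B M :: complex
      using that by (simp flip: that(1) add: diff_divide_distrib)
    ultimately show ?thesis unfolding u2 L(1) using nz(2) e0 by simp
  qed
  have uu: "u ^ 3 - u = u * (u ^ 2 - 1)" by (simp add: algebra_simps power2_eq_square power3_eq_cube)
  have "L ^ 3 * (u ^ 3 - u) ^ 2 = L ^ 3 * (u ^ 2 * (u ^ 2 - 1) ^ 2)" unfolding uu by (simp add: power_mult_distrib)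
  also have "\<dots> = L ^ 3 * ((p + e) ^ 3 * ((p - 2 * e) ^ 3) ^ 2) / (L ^ 3 * (L ^ 3 * d ^ 3))"
  proof -
    have "L ^ 3 * (a / (L ^ 2 * d) * (b / (L ^ 2 * d)) ^ 2) = L ^ 3 * (a * b ^ 2) / (L ^ 3 * (L ^ 3 * d ^ 3))" for a b
      using L(2) nz(2) by (simp add: field_simps power2_eq_square power3_eq_cube)
    thus ?thesis by (subst u21, subst u2)
  qed
  also have "\<dots> = (p + e) ^ 3 * ((p - 2 * e) ^ 3) ^ 2 / (L ^ 3 * d ^ 3)"
    by (rule nonzero_mult_divide_mult_cancel_left) (use L(2) in simp)
  also have "\<dots> = ((p + e) * (p - 2 * e) ^ 2 / (L * d)) ^ 3"
    by (simp add: power_divide power_mult_distrib flip: power_mult)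
  finally show "((p + e) * (p - 2 * e) ^ 2 / (L * (p ^ 2 - e * p + e ^ 2))) ^ 3 = L ^ 3 * (u ^ 3 - u) ^ 2"
    by (simp add: d_def)
  assume "p \<noteq> 2 * e"
  hence "u ^ 2 - 1 \<noteq> 0" unfolding u21 using L(2) nz(2) by simp
  moreover have "u \<noteq> 0" using nz(1) q(2) L(2) by (simp add: u)
  ultimately have "u ^ 3 - u \<noteq> 0" unfolding uu by simp
  thus "u ^ 3 \<noteq> u" by simp
qed

text \<open>
  Off the sparse set \<open>D\<close>, which collects the zeros of the denominators and the points where \<open>u\<^sup>3 = u\<close>, the
  function is \<open>2 (\<wp> + e)\<^sup>2 / (L \<wp>')\<close> and satisfies \<open>u'\<^sup>3 = L\<^sup>3 (u\<^sup>3 - u)\<^sup>2\<close>. The square \<open>u\<^sup>2\<close> depends on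
  \<open>\<wp>\<close> alone and tends to infinity with \<open>\<wp>\<close>. So \<open>u\<close> has a pole at each point of \<open>z0 + \<Lambda>\<close>, and the
  denominator of a rational representation would have infinitely many roots.
\<close>
lemma explicit_solution_properties:
  assumes c: "c \<noteq> 0" and L: "L ^ 6 = - 27 * c / 64"
    and u: "\<forall>\<^sub>\<approx>z\<in>UNIV. u z = explicit_solution c L z0 z"
  shows "transcendental_meromorphic u" "elliptic u"
    "\<forall>\<^sub>\<approx>z\<in>UNIV. schwarzian u z ^ 3 = c * (u z ^ 2 + 1 / 3) ^ 3 / (u z ^ 3 - u z) ^ 2"
proof -
  have "c / 432 \<noteq> 0" using c by simp
  then obtain \<Lambda> where lat: "complex_lattice \<Lambda>" "lattice_g2 \<Lambda> = 0" "lattice_g3 \<Lambda> = c / 432"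
    and wp: "weierstrass_wp 0 (c / 432) = lattice_wp \<Lambda>"
    by (rule weierstrass_wp_equianharmonic)
  let ?p = "lattice_wp \<Lambda>"
  have L0: "L \<noteq> 0" using L c by auto
  define e where "e = L ^ 2 / 9"
  have L2: "L ^ 2 = 9 * e" by (simp add: e_def)
  have g3: "lattice_g3 \<Lambda> = - 4 * e ^ 3" using equianharmonic_g3[OF L] by (simp add: lat e_def)
  have q2: "deriv ?p z ^ 2 = 4 * ?p z ^ 3 + 4 * e ^ 3" if "z \<notin> \<Lambda>" for z
    using wp_differential_equation[OF lat(1) that] by (simp add: lat(2) g3)
  have merp: "?p meromorphic_on UNIV" by (rule wp_meromorphic[OF lat(1)])
  have evL: "\<forall>\<^sub>\<approx>z\<in>UNIV. z \<notin> \<Lambda>" by (rule eventually_not_in_cosparse[OF complex_lattice_sparse[OF lat(1)]])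
  have avoid: "\<forall>\<^sub>\<approx>z\<in>UNIV. ?p z \<noteq> a" for a
  proof (rule ccontr)
    assume "\<not> ?thesis"
    hence "\<forall>\<^sub>\<approx>z\<in>UNIV. ?p z = a"
      using meromorphic_imp_constant_or_avoid[OF merp open_UNIV connected_UNIV] by blast
    hence "\<forall>\<^sub>F z in at 0. ?p z = a" by (rule eventually_cosparse_imp_eventually_at) auto
    hence "(?p \<longlongrightarrow> a) (at 0)" by (rule tendsto_eventually)
    thus False using wp_tends_to_infinity_at_0[OF lat(1)] not_tendsto_and_filterlim_at_infinity[of "at 0" ?p a] by auto
  qed
  define D where "D = {z. \<not> (z - z0 \<notin> \<Lambda> \<and> deriv ?p (z - z0) \<noteq> 0 \<and> ?p (z - z0) \<noteq> 2 * e \<and>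
      u z = explicit_solution c L z0 z)}"
  have "\<forall>\<^sub>\<approx>z\<in>UNIV. \<forall>x\<in>{x. poly [:4 * e ^ 3, 0, 0, 4:] x = 0}. ?p z \<noteq> x"
  proof (rule eventually_ball_finite)
    have "[:4 * e ^ 3, 0, 0, 4:] \<noteq> 0" by simp
    thus "finite {x. poly [:4 * e ^ 3, 0, 0, 4:] x = 0}" by (rule poly_roots_finite)
  qed (use avoid in auto)
  hence "\<forall>\<^sub>\<approx>z\<in>UNIV. z \<notin> \<Lambda> \<and> deriv ?p z \<noteq> 0 \<and> ?p z \<noteq> 2 * e"
    using evL avoid[of "2 * e"]
  proof eventually_elim
    case (elim z)
    have "4 * ?p z ^ 3 + 4 * e ^ 3 \<noteq> 0" using elim(1) by (auto simp: algebra_simps power3_eq_cube)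
    thus ?case using elim q2[of z] by auto
  qed
  from eventually_cosparse_shift[OF this, of "- z0"] u
  have evD: "\<forall>\<^sub>\<approx>z\<in>UNIV. z - z0 \<notin> \<Lambda> \<and> deriv ?p (z - z0) \<noteq> 0 \<and> ?p (z - z0) \<noteq> 2 * e \<and>
      u z = explicit_solution c L z0 z"
    by eventually_elim auto
  hence D: "D sparse_in UNIV" unfolding D_def eventually_cosparse .
  have op: "open (- D)" using sparse_in_UNIV_imp_closed[OF D] by auto
  have ueq: "u z = 2 * (?p (z - z0) + e) ^ 2 / (L * deriv ?p (z - z0))" if "z \<notin> D" for z
  proof -
    have "u z = 9 * (9 * ?p (z - z0) + L ^ 2) * deriv ?p (z - z0) / (2 * L * (81 * ?p (z - z0) ^ 2 - 9 * L ^ 2 * ?p (z - z0) + L ^ 4))"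
      using that by (simp add: D_def explicit_solution_def wp Let_def)
    also have "\<dots> = 2 * (?p (z - z0) + e) ^ 2 / (L * deriv ?p (z - z0))"
      by (rule wp_profile_explicit[OF q2 _ L2 L0]) (use that in \<open>auto simp: D_def\<close>)
    finally show ?thesis .
  qed
  have du: "(u has_field_derivative (?p (z - z0) + e) * (?p (z - z0) - 2 * e) ^ 2 / (L * (?p (z - z0) ^ 2 - e * ?p (z - z0) + e ^ 2))) (at z)"
    if z: "z \<notin> D" for z
  proof -
    have zL: "z - z0 \<notin> \<Lambda>" "deriv ?p (z - z0) \<noteq> 0" using z by (auto simp: D_def)
    have sh: "((\<lambda>z. z - z0) has_field_derivative 1) (at z)" by (auto intro!: derivative_eq_intros)
    have 1: "((\<lambda>z. ?p (z - z0)) has_field_derivative deriv ?p (z - z0)) (at z)"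
      using DERIV_chain'[OF sh wp_has_deriv[OF lat(1) zL(1)]] by simp
    have 2: "((\<lambda>z. deriv ?p (z - z0)) has_field_derivative 6 * ?p (z - z0) ^ 2) (at z)"
      using DERIV_chain'[OF sh wp_second_derivative[OF lat(1) zL(1)]] by (simp add: lat(2))
    have "((\<lambda>z. 2 * (?p (z - z0) + e) ^ 2 / (L * deriv ?p (z - z0))) has_field_derivative
      (2 * (2 * (?p (z - z0) + e) * deriv ?p (z - z0)) * (L * deriv ?p (z - z0)) - 2 * (?p (z - z0) + e) ^ 2 * (L * (6 * ?p (z - z0) ^ 2)))
        / ((L * deriv ?p (z - z0)) * (L * deriv ?p (z - z0)))) (at z)"
      using zL(2) L0 by (auto intro!: derivative_eq_intros 1 2)
    hence "((\<lambda>z. 2 * (?p (z - z0) + e) ^ 2 / (L * deriv ?p (z - z0))) has_field_derivative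
       (?p (z - z0) + e) * (?p (z - z0) - 2 * e) ^ 2 / (L * (?p (z - z0) ^ 2 - e * ?p (z - z0) + e ^ 2))) (at z)"
      unfolding wp_profile_deriv[OF q2[OF zL(1)] zL(2) L2 L0] .
    thus ?thesis
      by (rule has_field_derivative_transform_within_open[OF _ op]) (use z in \<open>auto simp: ueq\<close>)
  qed
  have evD': "\<forall>\<^sub>\<approx>z\<in>UNIV. z \<in> - D" using eventually_not_in_cosparse[OF D] by simp
  thus "\<forall>\<^sub>\<approx>z\<in>UNIV. schwarzian u z ^ 3 = c * (u z ^ 2 + 1 / 3) ^ 3 / (u z ^ 3 - u z) ^ 2"
  proof eventually_elim
    case (elim z)
    have "schwarzian u z ^ 3 = - 64 / 27 * (L ^ 3) ^ 2 * (u z ^ 2 + 1 / 3) ^ 3 / (u z ^ 3 - u z) ^ 2"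
    proof (rule schwarzian_cube_of_binomial_ode[OF op elim])
      show "u holomorphic_on - D" using du op by (subst holomorphic_on_open) auto
      fix z assume "z \<in> - D"
      hence z: "z \<notin> D" "z - z0 \<notin> \<Lambda>" "deriv ?p (z - z0) \<noteq> 0" "?p (z - z0) \<noteq> 2 * e" by (auto simp: D_def)
      show "deriv u z ^ 3 = L ^ 3 * (u z ^ 3 - u z) ^ 2"
        unfolding DERIV_imp_deriv[OF du[OF z(1)]] by (rule wp_profile_ode(1)[OF q2[OF z(2)] z(3) L2 L0 ueq[OF z(1)]])
      show "u z ^ 3 \<noteq> u z" by (rule wp_profile_ode(2)[OF q2[OF z(2)] z(3) L2 L0 ueq[OF z(1)] z(4)])
    qed (use L0 in auto)
    moreover have k: "- 64 / 27 * (L ^ 3) ^ 2 = c" using L by (simp flip: power_mult)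
    ultimately show ?case unfolding k by simp
  qed
  have mer: "u meromorphic_on UNIV"
  proof -
    have m1: "(\<lambda>z. ?p (z - z0)) meromorphic_on UNIV"
      by (rule meromorphic_on_compose[OF merp]) (auto intro!: analytic_intros)
    have m2: "(\<lambda>z. deriv ?p (z - z0)) meromorphic_on UNIV"
      by (rule meromorphic_on_compose[OF meromorphic_on_deriv[OF merp]]) (auto intro!: analytic_intros)
    have "explicit_solution c L z0 meromorphic_on UNIV"
      unfolding explicit_solution_def[abs_def] Let_def wp by (intro meromorphic_intros m1 m2)
    thus ?thesis using meromorphic_on_cong'[OF u refl] by simp
  qed
  have shift: "\<forall>\<^sub>\<approx>z\<in>UNIV. u (z + \<omega>) = u z" if \<omega>: "\<omega> \<in> \<Lambda>" for \<omega>
    using evD eventually_cosparse_shift[OF u, of \<omega>]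
  proof eventually_elim
    case (elim z)
    have "?p (z + \<omega> - z0) = ?p (z - z0)" "deriv ?p (z + \<omega> - z0) = deriv ?p (z - z0)"
      using wp_periodic[OF lat(1) \<omega>, of "z - z0"] deriv_wp_periodic[OF lat(1) \<omega>, of "z - z0"] elim(1)
      by (simp_all add: algebra_simps)
    thus ?case using elim by (simp add: explicit_solution_def wp Let_def)
  qed
  obtain \<omega>1 \<omega>2 where w: "\<omega>2 / \<omega>1 \<notin> \<real>" "\<Lambda> = {of_int m * \<omega>1 + of_int n * \<omega>2 | m n. True}"
    using lat(1) unfolding complex_lattice_def by auto
  have "of_int 1 * \<omega>1 + of_int 0 * \<omega>2 \<in> \<Lambda>" "of_int 0 * \<omega>1 + of_int 1 * \<omega>2 \<in> \<Lambda>" unfolding w(2) by blast+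
  hence "\<omega>1 \<in> \<Lambda>" "\<omega>2 \<in> \<Lambda>" by simp_all
  thus "elliptic u" unfolding elliptic_def using mer w(1) shift by blast
  have pole: "((\<lambda>z. 1 / u z ^ 2) \<longlongrightarrow> 0) (at (z0 + \<omega>))" if \<omega>: "\<omega> \<in> \<Lambda>" for \<omega>
  proof -
    have fl: "filterlim (\<lambda>z. z - z0 - \<omega>) (at 0) (at (z0 + \<omega>))"
      by (intro filterlim_atI) (auto intro!: tendsto_eq_intros always_eventually simp: eventually_at_filter)
    have "((\<lambda>z. inverse (?p (z - z0 - \<omega>))) \<longlongrightarrow> 0) (at (z0 + \<omega>))"
      by (rule filterlim_compose[OF tendsto_inverse_0 filterlim_compose[OF wp_tends_to_infinity_at_0[OF lat(1)] fl]])
    moreover have "\<forall>\<^sub>F z in at (z0 + \<omega>). inverse (?p (z - z0 - \<omega>)) = inverse (?p (z - z0))"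
      using eventually_cosparse_imp_eventually_at[OF evD UNIV_I]
    proof eventually_elim
      case (elim z)
      have "- \<omega> \<in> \<Lambda>" by (rule complex_lattice_uminus[OF lat(1) \<omega>])
      from wp_periodic[OF lat(1) this, of "z - z0"] elim show ?case by simp
    qed
    ultimately have s: "((\<lambda>z. inverse (?p (z - z0))) \<longlongrightarrow> 0) (at (z0 + \<omega>))"
      by (rule Lim_transform_eventually)
    \<comment> \<open>\<open>1 / u\<^sup>2\<close> written as a rational function of \<open>1 / \<wp>\<close> that vanishes at \<open>0\<close>\<close>
    define F where "F = (\<lambda>s. 9 * e * (s * (1 - e * s + e ^ 2 * s ^ 2)) / (1 + e * s) ^ 3)"
    have "((\<lambda>z. F (inverse (?p (z - z0))))
        \<longlongrightarrow> F 0) (at (z0 + \<omega>))"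
      unfolding F_def by (intro tendsto_intros s) auto
    moreover have "\<forall>\<^sub>F z in at (z0 + \<omega>). F (inverse (?p (z - z0)))
        = 1 / u z ^ 2"
      using eventually_cosparse_imp_eventually_at[OF evD' UNIV_I]
        eventually_cosparse_imp_eventually_at[OF eventually_cosparse_shift[OF avoid[of 0], of "- z0"] UNIV_I]
    proof eventually_elim
      case (elim z)
      define P where "P = ?p (z - z0)"
      have P0: "P \<noteq> 0" using elim(2) by (simp add: P_def)
      have z: "z \<notin> D" "z - z0 \<notin> \<Lambda>" "deriv ?p (z - z0) \<noteq> 0" using elim by (auto simp: D_def)
      have "u z ^ 2 = (P + e) ^ 3 / (9 * e * (P ^ 2 - e * P + e ^ 2))"
        unfolding ueq[OF z(1)] P_def by (rule wp_profile_square(1)[OF q2[OF z(2)] z(3) L2])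
      hence "1 / u z ^ 2 = 9 * e * (P ^ 2 - e * P + e ^ 2) / (P + e) ^ 3" by simp
      also have "P ^ 2 - e * P + e ^ 2 = (inverse P * (1 - e * inverse P + e ^ 2 * inverse P ^ 2)) * P ^ 3"
        using P0 by (simp add: field_simps power2_eq_square power3_eq_cube)
      also have "(P + e) ^ 3 = (1 + e * inverse P) ^ 3 * P ^ 3"
        using P0 by (simp add: field_simps flip: power_mult_distrib)
      also have "9 * e * (inverse P * (1 - e * inverse P + e ^ 2 * inverse P ^ 2) * P ^ 3) / ((1 + e * inverse P) ^ 3 * P ^ 3) =
         9 * e * (inverse P * (1 - e * inverse P + e ^ 2 * inverse P ^ 2)) / (1 + e * inverse P) ^ 3"
      proof -
        have "9 * e * (N * k) / (M * k) = 9 * e * N / M" if "k \<noteq> 0" for N M k using that by simp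
        thus ?thesis using P0 by simp
      qed
      finally show ?case by (simp add: P_def F_def)
    qed
    ultimately have "((\<lambda>z. 1 / u z ^ 2) \<longlongrightarrow> F 0) (at (z0 + \<omega>))"
      by (rule Lim_transform_eventually)
    thus ?thesis by (simp add: F_def)
  qed
  show "transcendental_meromorphic u"
    unfolding transcendental_meromorphic_def
  proof (intro conjI mer notI)
    assume "\<exists>a b :: complex poly. b \<noteq> 0 \<and> (\<forall>\<^sub>\<approx>z\<in>UNIV. u z = poly a z / poly b z)"
    then obtain a b :: "complex poly" where ab: "b \<noteq> 0" "\<forall>\<^sub>\<approx>z\<in>UNIV. u z = poly a z / poly b z" by blast
    have "poly b x = 0" if "x \<in> (+) z0 ` \<Lambda>" for x
    proof (rule ccontr)
      assume bx: "poly b x \<noteq> 0"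
      obtain \<omega> where \<omega>: "\<omega> \<in> \<Lambda>" "x = z0 + \<omega>" using \<open>x \<in> (+) z0 ` \<Lambda>\<close> by auto
      have "((\<lambda>z. (poly a z / poly b z) ^ 2 * (1 / u z ^ 2)) \<longlongrightarrow> (poly a x / poly b x) ^ 2 * 0) (at x)"
        using bx by (intro tendsto_intros pole[OF \<omega>(1), folded \<omega>(2)]) auto
      moreover have "\<forall>\<^sub>F z in at x. (poly a z / poly b z) ^ 2 * (1 / u z ^ 2) = 1"
        using eventually_cosparse_imp_eventually_at[OF ab(2) UNIV_I] eventually_cosparse_imp_eventually_at[OF evD' UNIV_I]
      proof eventually_elim
        case (elim z)
        hence z: "z \<notin> D" "z - z0 \<notin> \<Lambda>" "deriv ?p (z - z0) \<noteq> 0" by (auto simp: D_def)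
        have "u z \<noteq> 0"
          using wp_profile_square(2)[OF q2[OF z(2)] z(3) L2] z(3) L0 by (simp add: ueq[OF z(1)])
        thus ?case using elim(1) by simp
      qed
      ultimately have "((\<lambda>_. 1 :: complex) \<longlongrightarrow> (poly a x / poly b x) ^ 2 * 0) (at x)"
        by (rule Lim_transform_eventually)
      thus False by (simp add: tendsto_const_iff)
    qed
    hence "(+) z0 ` \<Lambda> \<subseteq> {x. poly b x = 0}" by blast
    hence "finite ((+) z0 ` \<Lambda>)" using poly_roots_finite[OF ab(1)] finite_subset by blast
    hence "finite \<Lambda>" by (rule finite_imageD) auto
    thus False using lattice_infinite[OF lat(1)] by blast
  qed
qed

theorem theorem5:
  fixes c \<sigma>1 \<sigma>2 \<tau>1 \<tau>2 \<tau>3 :: complex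
  assumes "c \<noteq> 0"
    and "{\<tau>1, \<tau>2, \<tau>3} = {0, 1, -1}"
    and "{\<sigma>1, \<sigma>2} \<inter> {\<tau>1, \<tau>2, \<tau>3} = {}"
  shows "(\<forall>u. transcendental_meromorphic u \<and> schwarzian_eq_solution c \<sigma>1 \<sigma>2 \<tau>1 \<tau>2 \<tau>3 u
              \<longrightarrow> elliptic u) \<and>
         ((\<exists>u. transcendental_meromorphic u \<and> schwarzian_eq_solution c \<sigma>1 \<sigma>2 \<tau>1 \<tau>2 \<tau>3 u)
              \<longleftrightarrow> {\<sigma>1, \<sigma>2} = {\<i> / of_real (sqrt 3), - (\<i> / of_real (sqrt 3))}) \<and>
         ({\<sigma>1, \<sigma>2} = {\<i> / of_real (sqrt 3), - (\<i> / of_real (sqrt 3))} \<longrightarrow>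
            (\<forall>u.
              (transcendental_meromorphic u \<and> schwarzian_eq_solution c \<sigma>1 \<sigma>2 \<tau>1 \<tau>2 \<tau>3 u \<longleftrightarrow>
                (\<exists>L z0. L ^ 6 = - 27 * c / 64 \<and>
                  (\<forall>\<^sub>\<approx>z\<in>UNIV. u z = explicit_solution c L z0 z)))))"
proof -
  have sol: "schwarzian_eq_solution c \<sigma>1 \<sigma>2 \<tau>1 \<tau>2 \<tau>3 u \<longleftrightarrow>
      (\<forall>\<^sub>\<approx>z\<in>UNIV. schwarzian u z ^ 3 = c * ((u z - \<sigma>1) ^ 3 * (u z - \<sigma>2) ^ 3) / (u z ^ 3 - u z) ^ 2)" for u
    unfolding schwarzian_eq_solution_def square_product_over_roots[OF assms(2)] ..
  have cube: "\<sigma> ^ 3 \<noteq> \<sigma>" if "\<sigma> \<notin> {0, 1, -1}" for \<sigma> :: complex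
  proof
    assume "\<sigma> ^ 3 = \<sigma>"
    hence "\<sigma> * ((\<sigma> - 1) * (\<sigma> + 1)) = 0" by (simp add: algebra_simps power3_eq_cube)
    thus False using that by (simp add: eq_neg_iff_add_eq_0)
  qed
  have \<sigma>: "\<sigma>1 ^ 3 \<noteq> \<sigma>1" "\<sigma>2 ^ 3 \<noteq> \<sigma>2"
    using assms(3) unfolding assms(2) by (auto intro!: cube)
  let ?S = "\<lambda>u. transcendental_meromorphic u \<and> schwarzian_eq_solution c \<sigma>1 \<sigma>2 \<tau>1 \<tau>2 \<tau>3 u"
  let ?X = "\<lambda>u. \<exists>L z0. L ^ 6 = - 27 * c / 64 \<and> (\<forall>\<^sub>\<approx>z\<in>UNIV. u z = explicit_solution c L z0 z)"
  let ?\<sigma> = "{\<sigma>1, \<sigma>2} = {\<i> / of_real (sqrt 3), - (\<i> / of_real (sqrt 3))}"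
  have forward: "?\<sigma> \<and> ?X u" if "?S u" for u
    using schwarzian_solution_explicit[OF assms(1) \<sigma>, of u] that sol by blast
  have ell: "elliptic u" if "?X u" for u
    using explicit_solution_properties(2)[OF assms(1)] that by blast
  have backward: "?S u" if roots: "?\<sigma>" and X: "?X u" for u
  proof -
    obtain L z0 where "L ^ 6 = - 27 * c / 64" "\<forall>\<^sub>\<approx>z\<in>UNIV. u z = explicit_solution c L z0 z" using X by blast
    from explicit_solution_properties(1,3)[OF assms(1) this] show ?thesis
      unfolding sol cube_product_over_sigma[OF roots] by blast
  qed
  have ex: "\<exists>u. ?X u"
  proof -
    obtain L where "- 27 * c / 64 = L ^ 6" using exists_complex_root[of 6 "- 27 * c / 64"] by auto
    thus ?thesis by (intro exI[of _ "explicit_solution c L 0"] exI[of _ L] exI[of _ 0]) auto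
  qed
  show ?thesis
    using forward backward ell ex by blast
qed

end
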